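(* Let $\Gamma$ be a finitely generated group and let $\rho \in \mathrm{Hom}(\Gamma,\mathrm{GL}(n,\mathbb{C}))$ be a semi-simple representation. If $\Phi_2(\chi_\rho) = \chi_\rho$, then there exist $p,q \in \mathbb{N}$ with $p+q =n$ such that $\rho$ is conjugated (in $\mathrm{GL}(n,\mathbb{C})$) to a representation with values in $\mathrm{U}(p,q)$.
   Context: $n$ is a positive integer and $\mathbb{N}$ contains $0$. A representation into $\mathrm{GL}(n,\mathbb{C})$ is irreducible if its image has no stable subspaces of $\mathbb{C}^n$ other than $\{0\}$ and $\mathbb{C}^n$, and semi-simple if it is a direct sum of irreducible representations. $\mathcal{X}_{\mathrm{GL}(n,\mathbb{C})}(\Gamma)=\mathrm{Hom}(\Gamma,\mathrm{GL}(n,\mathbb{C}))//\mathrm{GL}(n,\mathbb{C})$ is the GIT quotient by conjugation, as an affine algebraic set; $\chi_\rho$ denotes the image of $\rho$, and $\chi_\rho=\chi_{\rho'}$ iff all conjugation-invariant regular functions agree at $\rho$ and $\rho'$ (equivalently, $\mathrm{tr}\,\rho(\gamma)=\mathrm{tr}\,\rho'(\gamma)$ for all $\gamma\in\Gamma$). $\Phi_2$ is the anti-holomorphic involution of $\mathcal{X}_{\mathrm{GL}(n,\mathbb{C})}(\Gamma)$ induced by $A\mapsto(\overline{A}^{T})^{-1}$: $\Phi_2(\chi_\rho)=\chi_{\rho_2}$ with $\rho_2(\gamma)=(\overline{\rho(\gamma)}^{T})^{-1}$. $\mathrm{U}(p,q)=\{M\in\mathrm{GL}(p+q,\mathbb{C}):\overline{M}^{T}I_{p,q}M=I_{p,q}\}$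 with $I_{p,q}=\begin{pmatrix}I_p&0\\0&-I_q\end{pmatrix}$. *)

theory Defs
  imports "Jordan_Normal_Form.Schur_Decomposition" "HOL-Algebra.Generated_Groups"
begin

definition finitely_generated_group :: "('a, 'b) monoid_scheme \<Rightarrow> bool" where
  "finitely_generated_group G \<longleftrightarrow>
     group G \<and> (\<exists>S. finite S \<and> S \<subseteq> carrier G \<and> generate G S = carrier G)"


section \<open>Representations into GL(n,C)\<close>

definition GL :: "nat \<Rightarrow> complex mat monoid" where
  "GL n = units_of (ring_mat TYPE(complex) n ())"

text \<open>The set Hom(G, GL(n,C)) is \<open>hom G (GL n)\<close>. Members of \<open>hom\<close> are total functions whose values
  outside \<open>carrier G\<close> are arbitrary; none of the notions below depends on those values.\<close>

definition conj_rep :: "nat \<Rightarrow> complex mat \<Rightarrow> ('a \<Rightarrow> complex mat) \<Rightarrow> 'a \<Rightarrow> complex mat" where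
  "conj_rep n g \<rho> = (\<lambda>\<gamma>. g \<otimes>\<^bsub>GL n\<^esub> \<rho> \<gamma> \<otimes>\<^bsub>GL n\<^esub> inv\<^bsub>GL n\<^esub> g)"

definition conjugate_reps ::
  "('a, 'b) monoid_scheme \<Rightarrow> nat \<Rightarrow> ('a \<Rightarrow> complex mat) \<Rightarrow> ('a \<Rightarrow> complex mat) \<Rightarrow> bool" where
  "conjugate_reps G n \<rho> \<rho>' \<longleftrightarrow>
     (\<exists>g\<in>carrier (GL n). \<forall>\<gamma>\<in>carrier G. \<rho>' \<gamma> = conj_rep n g \<rho> \<gamma>)"

definition stable_subspace ::
  "('a, 'b) monoid_scheme \<Rightarrow> nat \<Rightarrow> ('a \<Rightarrow> complex mat) \<Rightarrow> complex vec set \<Rightarrow> bool" where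
  "stable_subspace G n \<rho> W \<longleftrightarrow>
     VectorSpace.subspace class_ring W (module_vec TYPE(complex) n) \<and>
     (\<forall>\<gamma>\<in>carrier G. \<forall>w\<in>W. \<rho> \<gamma> *\<^sub>v w \<in> W)"

definition irreducible_rep :: "('a, 'b) monoid_scheme \<Rightarrow> nat \<Rightarrow> ('a \<Rightarrow> complex mat) \<Rightarrow> bool" where
  "irreducible_rep G n \<rho> \<longleftrightarrow> \<rho> \<in> hom G (GL n) \<and>
     (\<forall>W. stable_subspace G n \<rho> W \<longrightarrow> W = {0\<^sub>v n} \<or> W = carrier_vec n)"

text \<open>The direct sum of representations of dimensions \<open>m\<^sub>1, \<dots>, m\<^sub>k\<close>, given as a list of pairs
  (dimension, representation), is the block diagonal representation; being a direct sum of
  representations is understood up to a change of basis.\<close>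

definition direct_sum_rep :: "(nat \<times> ('a \<Rightarrow> complex mat)) list \<Rightarrow> 'a \<Rightarrow> complex mat" where
  "direct_sum_rep \<sigma>s = (\<lambda>\<gamma>. diag_block_mat (map (\<lambda>(m, \<sigma>). \<sigma> \<gamma>) \<sigma>s))"

definition semisimple_rep :: "('a, 'b) monoid_scheme \<Rightarrow> nat \<Rightarrow> ('a \<Rightarrow> complex mat) \<Rightarrow> bool" where
  "semisimple_rep G n \<rho> \<longleftrightarrow> \<rho> \<in> hom G (GL n) \<and>
     (\<exists>\<sigma>s. (\<forall>(m, \<sigma>)\<in>set \<sigma>s. 0 < m \<and> irreducible_rep G m \<sigma>) \<and>
           sum_list (map fst \<sigma>s) = n \<and>
           conjugate_reps G n \<rho> (direct_sum_rep \<sigma>s))"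


section \<open>The character variety\<close>

text \<open>Regular functions on the affine algebraic set Hom(G, GL(n,C)): polynomials in the matrix
  entries of the \<open>\<rho> \<gamma>\<close>. The inverse determinants in the coordinate ring of GL(n,C) need no
  separate clause since \<open>1 / det (\<rho> \<gamma>) = det (\<rho> (inv \<gamma>))\<close> for \<open>\<rho>\<close> in \<open>hom G (GL n)\<close>; for the same
  reason, for finitely generated \<open>G\<close> this is the coordinate ring obtained by embedding
  Hom(G, GL(n,C)) into a finite power of GL(n,C) via generators. The functions are total here, and
  only their values on \<open>hom G (GL n)\<close> matter.\<close>

inductive_set regular_funs ::
  "('a, 'b) monoid_scheme \<Rightarrow> nat \<Rightarrow> (('a \<Rightarrow> complex mat) \<Rightarrow> complex) set"
  for G n where
  const: "(\<lambda>\<rho>. c) \<in> regular_funs G n"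
| entry: "\<lbrakk>\<gamma> \<in> carrier G; i < n; j < n\<rbrakk> \<Longrightarrow> (\<lambda>\<rho>. \<rho> \<gamma> $$ (i, j)) \<in> regular_funs G n"
| add: "\<lbrakk>f \<in> regular_funs G n; h \<in> regular_funs G n\<rbrakk> \<Longrightarrow> (\<lambda>\<rho>. f \<rho> + h \<rho>) \<in> regular_funs G n"
| mult: "\<lbrakk>f \<in> regular_funs G n; h \<in> regular_funs G n\<rbrakk> \<Longrightarrow> (\<lambda>\<rho>. f \<rho> * h \<rho>) \<in> regular_funs G n"

definition invariant_funs ::
  "('a, 'b) monoid_scheme \<Rightarrow> nat \<Rightarrow> (('a \<Rightarrow> complex mat) \<Rightarrow> complex) set" where
  "invariant_funs G n = {f \<in> regular_funs G n.
     \<forall>\<rho>\<in>hom G (GL n). \<forall>g\<in>carrier (GL n). f (conj_rep n g \<rho>) = f \<rho>}"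

text \<open>A point of the GIT quotient is identified with the values that the invariant regular
  functions take at it, so \<open>chi G n \<rho>\<close> is evaluation at \<open>\<rho>\<close>, an algebra homomorphism from the
  invariants to the complex numbers. Choosing finitely many generators of the algebra of invariants
  would give the usual embedding in an affine space. The quotient map is surjective, so the quotient
  is the image of \<open>chi\<close>.\<close>

definition chi :: "('a, 'b) monoid_scheme \<Rightarrow> nat \<Rightarrow> ('a \<Rightarrow> complex mat) \<Rightarrow>
    (('a \<Rightarrow> complex mat) \<Rightarrow> complex) \<Rightarrow> complex" where
  "chi G n \<rho> = (\<lambda>f\<in>invariant_funs G n. f \<rho>)"

definition char_variety ::
  "('a, 'b) monoid_scheme \<Rightarrow> nat \<Rightarrow> ((('a \<Rightarrow> complex mat) \<Rightarrow> complex) \<Rightarrow> complex) set" where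
  "char_variety G n = chi G n ` hom G (GL n)"

definition rho2 :: "nat \<Rightarrow> ('a \<Rightarrow> complex mat) \<Rightarrow> 'a \<Rightarrow> complex mat" where
  "rho2 n \<rho> = (\<lambda>\<gamma>. inv\<^bsub>GL n\<^esub> (mat_adjoint (\<rho> \<gamma>)))"

text \<open>The map induced on the quotient by \<open>rho2\<close>; it is well defined on \<open>char_variety G n\<close> by the
  theorem \<open>Phi2_chi\<close> below.\<close>

definition Phi2 :: "('a, 'b) monoid_scheme \<Rightarrow> nat \<Rightarrow>
    ((('a \<Rightarrow> complex mat) \<Rightarrow> complex) \<Rightarrow> complex) \<Rightarrow>
    ((('a \<Rightarrow> complex mat) \<Rightarrow> complex) \<Rightarrow> complex)" where
  "Phi2 G n x = (THE y. \<exists>\<rho>\<in>hom G (GL n). x = chi G n \<rho> \<and> y = chi G n (rho2 n \<rho>))"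


section \<open>The groups U(p,q)\<close>

definition I_pq :: "nat \<Rightarrow> nat \<Rightarrow> complex mat" where
  "I_pq p q = four_block_mat (1\<^sub>m p) (0\<^sub>m p q) (0\<^sub>m q p) (- 1\<^sub>m q)"

definition U_pq :: "nat \<Rightarrow> nat \<Rightarrow> complex mat set" where
  "U_pq p q = {M \<in> carrier (GL (p + q)). mat_adjoint M * I_pq p q * M = I_pq p q}"


section \<open>Well-definedness of the involution\<close>

lemma GL_simps [simp]:
  "x \<otimes>\<^bsub>GL n\<^esub> y = x * y" "\<one>\<^bsub>GL n\<^esub> = 1\<^sub>m n"
  "carrier (GL n) = Units (ring_mat TYPE(complex) n ())"
  by (simp_all add: GL_def units_of_def ring_mat_simps)

lemma group_GL: "group (GL n)"
proof -
  interpret ring "ring_mat TYPE(complex) n ()" by (rule ring_mat)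
  show ?thesis unfolding GL_def by (rule units_group)
qed

lemma GL_carrier_mat: "A \<in> carrier (GL n) \<Longrightarrow> A \<in> carrier_mat n n"
  by (auto simp: Units_def ring_mat_simps)

lemma GL_memI:
  assumes "A \<in> carrier_mat n n" "B \<in> carrier_mat n n" "A * B = 1\<^sub>m n" "B * A = 1\<^sub>m n"
  shows "A \<in> carrier (GL n)"
  using assms by (auto simp: Units_def ring_mat_simps)

lemma mat_adjoint_eq: "mat_adjoint A = transpose_mat (map_mat cnj A)"
  by (rule eq_matI) (auto simp: mat_adjoint_def mat_of_rows_def)

lemma mat_adjoint_mult:
  assumes "(A :: complex mat) \<in> carrier_mat n n" "B \<in> carrier_mat n n"
  shows "mat_adjoint (A * B) = mat_adjoint B * mat_adjoint A"
  unfolding mat_adjoint_eq using assms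
  by (intro eq_matI) (auto simp: scalar_prod_def intro!: sum.cong)

lemma mat_adjoint_one: "mat_adjoint (1\<^sub>m n :: complex mat) = 1\<^sub>m n"
  unfolding mat_adjoint_eq by (rule eq_matI) auto

lemma mat_adjoint_carrier [simp]:
  "(A :: complex mat) \<in> carrier_mat n n \<Longrightarrow> mat_adjoint A \<in> carrier_mat n n"
  unfolding mat_adjoint_eq by auto

lemma inv_GL:
  assumes "A \<in> carrier (GL n)"
  shows "A * inv\<^bsub>GL n\<^esub> A = 1\<^sub>m n" "inv\<^bsub>GL n\<^esub> A * A = 1\<^sub>m n" "inv\<^bsub>GL n\<^esub> A \<in> carrier (GL n)"
  using group.r_inv[OF group_GL assms] group.l_inv[OF group_GL assms]
    group.inv_closed[OF group_GL assms] by simp_all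

lemma adjoint_GL:
  assumes A: "A \<in> carrier (GL n)"
  shows "mat_adjoint A \<in> carrier (GL n)"
    "inv\<^bsub>GL n\<^esub> (mat_adjoint A) = mat_adjoint (inv\<^bsub>GL n\<^esub> A)"
proof -
  let ?B = "inv\<^bsub>GL n\<^esub> A"
  note B = inv_GL[OF A]
  have c: "A \<in> carrier_mat n n" "?B \<in> carrier_mat n n"
    using A B(3) by (blast intro: GL_carrier_mat)+
  have 1: "mat_adjoint A * mat_adjoint ?B = 1\<^sub>m n" "mat_adjoint ?B * mat_adjoint A = 1\<^sub>m n"
    unfolding mat_adjoint_mult[OF c(2,1), symmetric] mat_adjoint_mult[OF c, symmetric] B
    by (rule mat_adjoint_one)+
  show m: "mat_adjoint A \<in> carrier (GL n)"
    using GL_memI[OF _ _ 1] c by simp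
  have m': "mat_adjoint ?B \<in> carrier (GL n)"
    using GL_memI[OF _ _ 1(2,1)] c by simp
  show "inv\<^bsub>GL n\<^esub> (mat_adjoint A) = mat_adjoint ?B"
    using group.inv_equality[OF group_GL _ m m'] 1 by simp
qed

lemma rho2_eq:
  assumes "group G" "\<rho> \<in> hom G (GL n)" "\<gamma> \<in> carrier G"
  shows "rho2 n \<rho> \<gamma> = mat_adjoint (\<rho> (inv\<^bsub>G\<^esub> \<gamma>))"
proof -
  interpret group_hom G "GL n" \<rho>
    using assms group_GL by (simp add: group_hom_def group_hom_axioms_def)
  have "\<rho> \<gamma> \<in> carrier (GL n)" using assms(2,3) by (rule hom_in_carrier)
  then show ?thesis
    unfolding rho2_def using adjoint_GL(2) hom_inv[OF assms(3)] by simp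
qed

lemma rho2_hom:
  assumes "group G" "\<rho> \<in> hom G (GL n)"
  shows "rho2 n \<rho> \<in> hom G (GL n)"
proof (rule homI)
  interpret G: group G by fact
  fix x assume x: "x \<in> carrier G"
  have *: "\<rho> z \<in> carrier (GL n)" if "z \<in> carrier G" for z
    using assms(2) that by (rule hom_in_carrier)
  show "rho2 n \<rho> x \<in> carrier (GL n)"
    unfolding rho2_eq[OF assms x] using x * by (intro adjoint_GL) simp
  fix y assume y: "y \<in> carrier G"
  have "\<rho> (inv\<^bsub>G\<^esub> (x \<otimes>\<^bsub>G\<^esub> y)) = \<rho> (inv\<^bsub>G\<^esub> y) * \<rho> (inv\<^bsub>G\<^esub> x)"
    using assms(2) x y by (simp add: G.inv_mult_group hom_mult)
  moreover have "\<rho> (inv\<^bsub>G\<^esub> y) \<in> carrier_mat n n" "\<rho> (inv\<^bsub>G\<^esub> x) \<in> carrier_mat n n"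
    using x y * by (meson G.inv_closed GL_carrier_mat)+
  ultimately show "rho2 n \<rho> (x \<otimes>\<^bsub>G\<^esub> y) = rho2 n \<rho> x \<otimes>\<^bsub>GL n\<^esub> rho2 n \<rho> y"
    using x y by (simp add: rho2_eq[OF assms] mat_adjoint_mult)
qed

lemma conj_rep_hom:
  assumes "\<rho> \<in> hom G (GL n)" "g \<in> carrier (GL n)"
  shows "conj_rep n g \<rho> \<in> hom G (GL n)"
proof -
  interpret H: group "GL n" by (rule group_GL)
  have c: "\<rho> z \<in> carrier (GL n)" if "z \<in> carrier G" for z
    using assms(1) that by (rule hom_in_carrier)
  show ?thesis
  proof (rule homI)
    fix x y assume x: "x \<in> carrier G" and y: "y \<in> carrier G"
    have "inv\<^bsub>GL n\<^esub> g \<otimes>\<^bsub>GL n\<^esub> (g \<otimes>\<^bsub>GL n\<^esub> (\<rho> y \<otimes>\<^bsub>GL n\<^esub> inv\<^bsub>GL n\<^esub> g)) = \<rho> y \<otimes>\<^bsub>GL n\<^esub> inv\<^bsub>GL n\<^esub> g"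
      using assms(2) c[OF y] by (simp add: H.m_assoc[symmetric] del: GL_simps)
    then show "conj_rep n g \<rho> (x \<otimes>\<^bsub>G\<^esub> y) = conj_rep n g \<rho> x \<otimes>\<^bsub>GL n\<^esub> conj_rep n g \<rho> y"
      unfolding conj_rep_def using assms(2) c[OF x] c[OF y] hom_mult[OF assms(1) x y]
      by (simp add: H.m_assoc del: GL_simps)
  qed (use assms(2) c in \<open>simp add: conj_rep_def del: GL_simps\<close>)
qed

text \<open>Conjugating the values of a regular function after precomposing it with \<open>rho2\<close> gives a regular
  function again.\<close>

lemma regular_funs_conj:
  assumes "group G" "f \<in> regular_funs G n"
  shows "\<exists>h\<in>regular_funs G n. \<forall>\<rho>\<in>hom G (GL n). h \<rho> = cnj (f (rho2 n \<rho>))"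
  using assms(2)
proof induction
  case (const c)
  show ?case by (rule bexI[OF _ regular_funs.const[of "cnj c"]]) simp
next
  case (entry \<gamma> i j)
  interpret group G by fact
  have inv: "inv\<^bsub>G\<^esub> \<gamma> \<in> carrier G" using entry by simp
  have "\<rho> (inv\<^bsub>G\<^esub> \<gamma>) $$ (j, i) = cnj (rho2 n \<rho> \<gamma> $$ (i, j))" if r: "\<rho> \<in> hom G (GL n)" for \<rho>
    using GL_carrier_mat[OF hom_in_carrier[OF r inv]] entry rho2_eq[OF assms(1) r entry(1)]
    by (simp add: mat_adjoint_eq)
  then show ?case by (intro bexI[OF _ regular_funs.entry[OF inv entry(3,2)]]) simp
next
  case (add f h)
  then obtain f' h' where "f' \<in> regular_funs G n" "h' \<in> regular_funs G n"
    "\<forall>\<rho>\<in>hom G (GL n). f' \<rho> = cnj (f (rho2 n \<rho>))" "\<forall>\<rho>\<in>hom G (GL n). h' \<rho> = cnj (h (rho2 n \<rho>))"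
    by blast
  then show ?case by (intro bexI[OF _ regular_funs.add[of f' _ _ h']]) simp_all
next
  case (mult f h)
  then obtain f' h' where "f' \<in> regular_funs G n" "h' \<in> regular_funs G n"
    "\<forall>\<rho>\<in>hom G (GL n). f' \<rho> = cnj (f (rho2 n \<rho>))" "\<forall>\<rho>\<in>hom G (GL n). h' \<rho> = cnj (h (rho2 n \<rho>))"
    by blast
  then show ?case by (intro bexI[OF _ regular_funs.mult[of f' _ _ h']]) simp_all
qed

lemma regular_funs_cong:
  assumes "f \<in> regular_funs G n" "\<And>\<gamma>. \<gamma> \<in> carrier G \<Longrightarrow> \<rho> \<gamma> = \<rho>' \<gamma>"
  shows "f \<rho> = f \<rho>'"
  using assms by induction auto

lemma rho2_conj_rep:
  assumes "\<rho> \<in> hom G (GL n)" "g \<in> carrier (GL n)" "\<gamma> \<in> carrier G"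
  shows "rho2 n (conj_rep n g \<rho>) \<gamma> = conj_rep n (inv\<^bsub>GL n\<^esub> (mat_adjoint g)) (rho2 n \<rho>) \<gamma>"
proof -
  interpret H: group "GL n" by (rule group_GL)
  note r = hom_in_carrier[OF assms(1,3)]
  note c = GL_carrier_mat[OF assms(2)] GL_carrier_mat[OF r] GL_carrier_mat[OF inv_GL(3)[OF assms(2)]]
  have "mat_adjoint (conj_rep n g \<rho> \<gamma>)
      = mat_adjoint (inv\<^bsub>GL n\<^esub> g) \<otimes>\<^bsub>GL n\<^esub> (mat_adjoint (\<rho> \<gamma>) \<otimes>\<^bsub>GL n\<^esub> mat_adjoint g)"
    using c by (simp add: conj_rep_def mat_adjoint_mult[of _ n] assoc_mult_mat[of _ n n _ n _ n])
  also have "\<dots> = inv\<^bsub>GL n\<^esub> (mat_adjoint g) \<otimes>\<^bsub>GL n\<^esub> (mat_adjoint (\<rho> \<gamma>) \<otimes>\<^bsub>GL n\<^esub> mat_adjoint g)"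
    using adjoint_GL(2)[OF assms(2)] by simp
  finally show ?thesis
    using adjoint_GL(1)[OF assms(2)] adjoint_GL(1)[OF r]
    by (simp add: rho2_def conj_rep_def H.inv_mult_group H.m_assoc del: GL_simps)
qed

lemma invariant_funs_conj:
  assumes "group G" "f \<in> invariant_funs G n"
  shows "\<exists>h\<in>invariant_funs G n. \<forall>\<rho>\<in>hom G (GL n). h \<rho> = cnj (f (rho2 n \<rho>))"
proof -
  have f: "f \<in> regular_funs G n"
    and inv: "\<And>\<rho> g. \<rho> \<in> hom G (GL n) \<Longrightarrow> g \<in> carrier (GL n) \<Longrightarrow> f (conj_rep n g \<rho>) = f \<rho>"
    using assms(2) by (auto simp: invariant_funs_def)
  obtain h where h: "h \<in> regular_funs G n" "\<And>\<rho>. \<rho> \<in> hom G (GL n) \<Longrightarrow> h \<rho> = cnj (f (rho2 n \<rho>))"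
    using regular_funs_conj[OF assms(1) f] by blast
  have "h (conj_rep n g \<rho>) = h \<rho>" if r: "\<rho> \<in> hom G (GL n)" and g: "g \<in> carrier (GL n)" for \<rho> g
  proof -
    have "f (rho2 n (conj_rep n g \<rho>)) = f (conj_rep n (inv\<^bsub>GL n\<^esub> (mat_adjoint g)) (rho2 n \<rho>))"
      by (rule regular_funs_cong[OF f rho2_conj_rep[OF r g]])
    also have "\<dots> = f (rho2 n \<rho>)"
      by (intro inv rho2_hom assms(1) r inv_GL(3) adjoint_GL(1) g)
    finally show ?thesis using h(2)[OF r] h(2)[OF conj_rep_hom[OF r g]] by simp
  qed
  then show ?thesis using h by (auto simp: invariant_funs_def)
qed

lemma chi_eq_iff: "chi G n \<rho> = chi G n \<rho>' \<longleftrightarrow> (\<forall>f\<in>invariant_funs G n. f \<rho> = f \<rho>')"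
  unfolding chi_def by (auto simp: restrict_def fun_eq_iff)

theorem Phi2_chi:
  assumes "group G" "\<rho> \<in> hom G (GL n)"
  shows "Phi2 G n (chi G n \<rho>) = chi G n (rho2 n \<rho>)"
  unfolding Phi2_def
proof (rule the_equality)
  show "\<exists>\<rho>'\<in>hom G (GL n). chi G n \<rho> = chi G n \<rho>' \<and> chi G n (rho2 n \<rho>) = chi G n (rho2 n \<rho>')"
    using assms(2) by blast
next
  fix y assume "\<exists>\<rho>'\<in>hom G (GL n). chi G n \<rho> = chi G n \<rho>' \<and> y = chi G n (rho2 n \<rho>')"
  then obtain \<rho>' where r': "\<rho>' \<in> hom G (GL n)" and eq: "chi G n \<rho> = chi G n \<rho>'"
    and y: "y = chi G n (rho2 n \<rho>')" by blast
  have "f (rho2 n \<rho>') = f (rho2 n \<rho>)" if inv_f: "f \<in> invariant_funs G n" for f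
  proof -
    obtain h where h: "h \<in> invariant_funs G n"
      and hf: "\<And>\<rho>. \<rho> \<in> hom G (GL n) \<Longrightarrow> h \<rho> = cnj (f (rho2 n \<rho>))"
      using invariant_funs_conj[OF assms(1) inv_f] by blast
    have "h \<rho> = h \<rho>'" using eq h by (simp add: chi_eq_iff)
    then show ?thesis using hf[OF r'] hf[OF assms(2)] by simp
  qed
  then show "y = chi G n (rho2 n \<rho>)" unfolding y chi_eq_iff by blast
qed

end

theory Submission
  imports Defs
begin

text \<open>A representation \<open>\<rho>\<close> is conjugate into some \<open>U(p,q)\<close> as soon as it leaves a nondegenerate Hermitian
  form \<open>P\<close> invariant: by Sylvester's law of inertia (\<open>sylvester_inertia\<close>) \<open>P = g\<^sup>* I\<^sub>p\<^sub>q g\<close>, and then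
  conjugation by \<open>g\<close> carries \<open>\<rho>\<close> into the unitary group of \<open>I\<^sub>p\<^sub>q\<close>. The hypothesis on
  \<open>\<chi>\<^sub>\<rho>\<close>, tested on traces, says that \<open>tr \<rho>(g\<inverse>) = cnj (tr \<rho>(g))\<close>, that is, \<open>\<rho>\<close> and its conjugate
  dual have the same character. The form \<open>P\<close> is constructed from this symmetry and semi-simplicity.

  The source of invariant forms is the character. For a function \<open>\<psi>(g) = tr (E \<rho>(g))\<close> with
  \<open>\<psi>(g\<inverse>) = cnj (\<psi>(g))\<close>, where \<open>E\<close> is an idempotent commuting with \<open>\<rho>\<close>, the rule
  \<open>\<langle>g, h\<rangle> = \<psi>(g\<inverse> h)\<close> is a Hermitian form on the group algebra, invariant under left
  multiplication. Its radical contains every element that acts as zero on the image of \<open>E\<close>, so the form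
  lives on the space \<open>A\<close> spanned by the matrices \<open>E \<rho>(g)\<close>. This is a stable subspace of the space of all
  \<open>n \<times> n\<close> matrices, on which the group acts by left multiplication and which is therefore a sum of \<open>n\<close>
  copies of \<open>\<rho>\<close>. Semi-simplicity provides an equivariant projection onto \<open>A\<close>
  (\<open>equivariant_projection\<close>), and composing with it extends the form to the sum of \<open>n\<close> copies. The
  extended form takes the value \<open>tr E\<close> at \<open>(E, E)\<close>, so if \<open>E\<close> is nonzero, some pair of copies carries a
  nonzero invariant form (\<open>exists_invariant_form\<close>), and its Hermitian or anti-Hermitian part gives a
  nonzero Hermitian one.

  Nondegeneracy is reached by descent. Given an invariant Hermitian form with kernel \<open>N\<close>, let \<open>E\<close> be
  an equivariant projection onto \<open>N\<close>. On the complement the form is nondegenerate, so the character of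
  the complement has the symmetry \<open>\<psi>(g\<inverse>) = cnj (\<psi>(g))\<close>, and hence so has the character of \<open>N\<close>
  (\<open>trace_idempotent_inv\<close>). If \<open>N\<close> is nonzero, the construction above yields a nonzero form on \<open>N\<close>, and
  adding it makes the kernel smaller (\<open>enlarge_invariant_form\<close>).\<close>

section \<open>Traces\<close>

definition trace :: "complex mat \<Rightarrow> complex" where
  "trace A = (\<Sum>i<dim_row A. A $$ (i, i))"

lemma trace_add:
  assumes "A \<in> carrier_mat n n" "B \<in> carrier_mat n n"
  shows "trace (A + B) = trace A + trace B"
  using assms by (auto simp: trace_def sum.distrib)

lemma trace_smult: "A \<in> carrier_mat n n \<Longrightarrow> trace (c \<cdot>\<^sub>m A) = c * trace A"
  by (auto simp: trace_def sum_distrib_left)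

lemma trace_comm:
  assumes "A \<in> carrier_mat n m" "B \<in> carrier_mat m n"
  shows "trace (A * B) = trace (B * A)"
proof -
  have "trace (A * B) = (\<Sum>i<n. \<Sum>j<m. A $$ (i, j) * B $$ (j, i))"
    using assms by (auto simp: trace_def scalar_prod_def atLeast0LessThan intro!: sum.cong)
  also have "\<dots> = (\<Sum>j<m. \<Sum>i<n. B $$ (j, i) * A $$ (i, j))"
    by (subst sum.swap) (simp add: mult.commute)
  also have "\<dots> = trace (B * A)"
    using assms by (auto simp: trace_def scalar_prod_def atLeast0LessThan intro!: sum.cong)
  finally show ?thesis .
qed

lemma trace_adjoint: "A \<in> carrier_mat n n \<Longrightarrow> trace (mat_adjoint A) = cnj (trace A)"
  by (auto simp: trace_def mat_adjoint_eq)

text \<open>The diagonal of an idempotent triangular matrix consists of zeros and ones, so the trace counts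
  the ones. If there are none, the matrix is strictly triangular, and since every entry is a sum of
  products of entries nearer to the diagonal, all of them vanish.\<close>

lemma idempotent_upper_triangular:
  fixes B :: "complex mat"
  assumes B: "B \<in> carrier_mat n n" and BB: "B * B = B" and ut: "upper_triangular B"
  shows "\<exists>k::nat. trace B = of_nat k \<and> (k = 0 \<longrightarrow> B = 0\<^sub>m n n)"
proof -
  have entry: "B $$ (i, j) = (\<Sum>k<n. B $$ (i, k) * B $$ (k, j))" if "i < n" "j < n" for i j
  proof -
    have "B $$ (i, j) = (B * B) $$ (i, j)" using BB by simp
    also have "\<dots> = (\<Sum>k<n. B $$ (i, k) * B $$ (k, j))"
      using B that by (simp add: scalar_prod_def atLeast0LessThan)
    finally show ?thesis .
  qed
  have low: "B $$ (i, j) = 0" if "j < i" "i < n" for i j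
    using ut B that by (auto simp: upper_triangular_def)
  have diag: "B $$ (i, i) \<in> {0, 1}" if i: "i < n" for i
  proof -
    have "(\<Sum>k<n. B $$ (i, k) * B $$ (k, i))
        = (\<Sum>k<n. if k = i then B $$ (i, i) * B $$ (i, i) else 0)"
    proof (intro sum.cong refl)
      fix k assume "k \<in> {..<n}"
      then show "B $$ (i, k) * B $$ (k, i) = (if k = i then B $$ (i, i) * B $$ (i, i) else 0)"
        using low[of k i] low[of i k] i by (cases k i rule: linorder_cases) auto
    qed
    also have "\<dots> = B $$ (i, i) * B $$ (i, i)" using i by (simp only: sum.delta finite_lessThan lessThan_iff if_True)
    finally have "B $$ (i, i) = B $$ (i, i) * B $$ (i, i)" by (rule trans[OF entry[OF i i]])
    then have "B $$ (i, i) * (1 - B $$ (i, i)) = 0" by (simp only: right_diff_distrib mult_1_right right_minus_eq)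
    then show ?thesis by simp
  qed
  let ?K = "{i. i < n \<and> B $$ (i, i) = 1}"
  have "trace B = (\<Sum>i<n. if B $$ (i, i) = 1 then 1 else 0)"
    unfolding trace_def using B diag by (intro sum.cong) auto
  also have "\<dots> = of_nat (card ?K)"
    by (simp add: sum.If_cases Int_def)
  finally have tr: "trace B = of_nat (card ?K)" .
  have zero: "B = 0\<^sub>m n n" if "card ?K = 0"
  proof -
    have d0: "B $$ (i, i) = 0" if "i < n" for i
      using diag[OF that] \<open>card ?K = 0\<close> that by auto
    have "B $$ (i, j) = 0" if "i < n" "j < n" for i j
      using that
    proof (induction "j - i" arbitrary: i j rule: less_induct)
      case less
      show ?case
      proof (cases "i < j")
        case True
        have "B $$ (i, k) * B $$ (k, j) = 0" if k: "k < n" for k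
        proof (cases "i < k \<and> k < j")
          case True
          then have "k - i < j - i" by arith
          then show ?thesis using less(1)[of k i] less(2) k by simp
        next
          case False
          then show ?thesis
            using low[of k i] low[of j k] d0[OF k] less(2,3) k
            by (cases "k = i \<or> k = j") auto
        qed
        then show ?thesis unfolding entry[OF less(2,3)] by (intro sum.neutral ballI) simp
      next
        case False
        then show ?thesis using low[of j i] d0 less(2,3) by (cases "i = j") auto
      qed
    qed
    then show ?thesis using B by (intro eq_matI) auto
  qed
  show ?thesis
    by (intro exI[of _ "card ?K"] conjI impI tr zero)
qed

text \<open>The number \<open>k\<close> is the rank. Traces of idempotents serve as dimensions of subspaces throughout;
  that only the zero matrix has \<open>k = 0\<close> depends on characteristic zero.\<close>

lemma trace_idempotent:
  fixes A :: "complex mat"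
  assumes A: "A \<in> carrier_mat n n" and AA: "A * A = A"
  obtains k :: nat where "trace A = of_nat k" "k = 0 \<Longrightarrow> A = 0\<^sub>m n n"
proof -
  from char_poly_factorized[OF A] obtain as where as: "char_poly A = (\<Prod>a\<leftarrow>as. [:- a, 1:])"
    by blast
  from schur_decomposition_exists[OF A as] obtain B where
    B: "B \<in> carrier_mat n n" and ut: "upper_triangular B" and sim: "similar_mat A B" by blast
  from sim obtain P Q where w: "similar_mat_wit A B P Q" by (auto simp: similar_mat_def)
  from similar_mat_witD2[OF A w] have PQ: "P * Q = 1\<^sub>m n" and QP: "Q * P = 1\<^sub>m n"
    and eq: "A = P * B * Q" and P: "P \<in> carrier_mat n n" and Q: "Q \<in> carrier_mat n n" by auto
  note assoc = assoc_mult_mat[of _ n n _ n _ n]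
  have canc: "Q * (P * X) = X" "P * (Q * X) = X" if "X \<in> carrier_mat n n" for X
    using assoc_mult_mat[OF Q P that] assoc_mult_mat[OF P Q that] that unfolding QP PQ by auto
  have AQ: "A = P * (B * Q)" using eq P B Q by (simp add: assoc)
  have Beq: "B = Q * (A * P)"
    unfolding AQ using P B Q by (simp add: assoc canc QP)
  have "B * B = Q * (A * (A * P))"
    unfolding Beq using P A Q by (simp add: assoc canc)
  also have "\<dots> = Q * (A * P)" using P A AA by (metis assoc_mult_mat)
  finally have "B * B = B" using Beq by simp
  moreover have "trace B = trace A"
  proof -
    have "trace B = trace ((A * P) * Q)"
      unfolding Beq by (rule trace_comm[of _ n n]) (use P A Q in auto)
    then show ?thesis using P A Q PQ by (simp add: assoc)
  qed
  moreover have "A = 0\<^sub>m n n" if "B = 0\<^sub>m n n"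
    unfolding AQ that using P Q by simp
  ultimately show thesis using idempotent_upper_triangular[OF B _ ut] that by metis
qed

section \<open>Subspaces of spaces of rectangular matrices\<close>

definition lin_sub :: "nat \<Rightarrow> nat \<Rightarrow> complex mat set \<Rightarrow> bool" where
  "lin_sub n m W \<longleftrightarrow> W \<subseteq> carrier_mat n m \<and> 0\<^sub>m n m \<in> W \<and>
     (\<forall>X\<in>W. \<forall>Y\<in>W. X + Y \<in> W) \<and> (\<forall>c. \<forall>X\<in>W. c \<cdot>\<^sub>m X \<in> W)"

definition subspace_sum :: "complex mat set \<Rightarrow> complex mat set \<Rightarrow> complex mat set" where
  "subspace_sum U Z = {X + Y |X Y. X \<in> U \<and> Y \<in> Z}"

lemma lin_subD:
  assumes "lin_sub n m W"
  shows "X \<in> W \<Longrightarrow> X \<in> carrier_mat n m" "0\<^sub>m n m \<in> W"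
    "X \<in> W \<Longrightarrow> Y \<in> W \<Longrightarrow> X + Y \<in> W" "X \<in> W \<Longrightarrow> c \<cdot>\<^sub>m X \<in> W"
  using assms by (auto simp: lin_sub_def)

lemma lin_sub_minus:
  assumes "lin_sub n m W" "X \<in> W" "Y \<in> W"
  shows "X - Y \<in> W"
proof -
  have "X - Y = X + (-1) \<cdot>\<^sub>m Y"
    using lin_subD(1)[OF assms(1,2)] lin_subD(1)[OF assms(1,3)] by (intro eq_matI) auto
  then show ?thesis using assms lin_subD(3,4)[OF assms(1)] by metis
qed

lemma lin_sub_sum:
  assumes U: "lin_sub n m U" and Z: "lin_sub n m Z"
  shows "lin_sub n m (subspace_sum U Z)"
  unfolding lin_sub_def
proof (intro conjI ballI allI)
  note UD = lin_subD[OF U] and ZD = lin_subD[OF Z]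
  show "subspace_sum U Z \<subseteq> carrier_mat n m" using UD(1) ZD(1) by (auto simp: subspace_sum_def)
  have "0\<^sub>m n m = 0\<^sub>m n m + (0\<^sub>m n m :: complex mat)" by simp
  then show "0\<^sub>m n m \<in> subspace_sum U Z" using UD(2) ZD(2) unfolding subspace_sum_def by blast
  fix A assume "A \<in> subspace_sum U Z"
  then obtain X Y where A: "A = X + Y" and XY: "X \<in> U" "Y \<in> Z" by (auto simp: subspace_sum_def)
  show "c \<cdot>\<^sub>m A \<in> subspace_sum U Z" for c
  proof -
    have "c \<cdot>\<^sub>m A = c \<cdot>\<^sub>m X + c \<cdot>\<^sub>m Y"
      unfolding A by (rule add_smult_distrib_left_mat[of _ n m]) (use UD(1) ZD(1) XY in auto)
    then show ?thesis using UD(4) ZD(4) XY unfolding subspace_sum_def by blast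
  qed
  fix B assume "B \<in> subspace_sum U Z"
  then obtain X' Y' where B: "B = X' + Y'" and XY': "X' \<in> U" "Y' \<in> Z"
    by (auto simp: subspace_sum_def)
  have "A + B = (X + X') + (Y + Y')"
    unfolding A B using UD(1)[OF XY(1)] UD(1)[OF XY'(1)] ZD(1)[OF XY(2)] ZD(1)[OF XY'(2)]
    by (intro eq_matI) auto
  then show "A + B \<in> subspace_sum U Z"
    using UD(3) ZD(3) XY XY' unfolding subspace_sum_def by blast
qed

lemma subspace_sum_upper:
  assumes U: "lin_sub n m U" and Z: "lin_sub n m Z"
  shows "U \<subseteq> subspace_sum U Z" "Z \<subseteq> subspace_sum U Z"
proof
  fix X assume X: "X \<in> U"
  have "X = X + 0\<^sub>m n m" using lin_subD(1)[OF U X] by simp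
  then show "X \<in> subspace_sum U Z" using X lin_subD(2)[OF Z] unfolding subspace_sum_def by blast
next
  show "Z \<subseteq> subspace_sum U Z"
  proof
    fix X assume X: "X \<in> Z"
    have "X = 0\<^sub>m n m + X" using lin_subD(1)[OF Z X] by simp
    then show "X \<in> subspace_sum U Z" using X lin_subD(2)[OF U] unfolding subspace_sum_def by blast
  qed
qed

lemma lin_sub_int: "lin_sub n m U \<Longrightarrow> lin_sub n m Z \<Longrightarrow> lin_sub n m (U \<inter> Z)"
  unfolding lin_sub_def by blast

section \<open>Complete reducibility\<close>

locale matrix_rep = group G for G :: "('a, 'b) monoid_scheme" (structure) +
  fixes n :: nat and \<rho> :: "'a \<Rightarrow> complex mat"
  assumes hom: "\<rho> \<in> hom G (GL n)"
begin

lemma rep_GL: "g \<in> carrier G \<Longrightarrow> \<rho> g \<in> carrier (GL n)"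
  using hom_in_carrier[OF hom] .

lemma rep_carrier: "g \<in> carrier G \<Longrightarrow> \<rho> g \<in> carrier_mat n n"
  using rep_GL GL_carrier_mat by blast

lemma rep_mult: "g \<in> carrier G \<Longrightarrow> h \<in> carrier G \<Longrightarrow> \<rho> (g \<otimes> h) = \<rho> g * \<rho> h"
  using hom_mult[OF hom] by simp

lemma rep_one: "\<rho> \<one> = 1\<^sub>m n"
  using hom_one[OF hom is_group group_GL] by simp

lemma rep_inv:
  assumes "g \<in> carrier G"
  shows "\<rho> (inv g) * \<rho> g = 1\<^sub>m n" "\<rho> g * \<rho> (inv g) = 1\<^sub>m n"
  using assms rep_mult[of "inv g" g] rep_mult[of g "inv g"] rep_one by auto

definition stable :: "nat \<Rightarrow> complex mat set \<Rightarrow> bool" where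
  "stable m W \<longleftrightarrow> lin_sub n m W \<and> (\<forall>g\<in>carrier G. \<forall>X\<in>W. \<rho> g * X \<in> W)"

text \<open>The zero space counts as simple, so that images of irreducible representations under equivariant
  maps are always simple.\<close>

definition simple :: "nat \<Rightarrow> complex mat set \<Rightarrow> bool" where
  "simple m W \<longleftrightarrow> stable m W \<and> (\<forall>U. stable m U \<longrightarrow> U \<subseteq> W \<longrightarrow> U = {0\<^sub>m n m} \<or> U = W)"

lemma stable_sum:
  assumes "stable m U" "stable m Z"
  shows "stable m (subspace_sum U Z)"
  unfolding stable_def
proof (intro conjI ballI)
  have U: "lin_sub n m U" and Z: "lin_sub n m Z" using assms by (auto simp: stable_def)
  show "lin_sub n m (subspace_sum U Z)" using U Z by (rule lin_sub_sum)
  fix g A assume g: "g \<in> carrier G" and "A \<in> subspace_sum U Z"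
  then obtain X Y where A: "A = X + Y" and XY: "X \<in> U" "Y \<in> Z" by (auto simp: subspace_sum_def)
  have "\<rho> g * A = \<rho> g * X + \<rho> g * Y"
    unfolding A by (rule mult_add_distrib_mat[of _ n n])
      (use rep_carrier[OF g] lin_subD(1)[OF U] lin_subD(1)[OF Z] XY in auto)
  then show "\<rho> g * A \<in> subspace_sum U Z"
    using XY g assms unfolding subspace_sum_def stable_def by blast
qed

lemma stable_int: "stable m U \<Longrightarrow> stable m Z \<Longrightarrow> stable m (U \<inter> Z)"
  unfolding stable_def using lin_sub_int by blast

lemma stable_zero: "stable m {0\<^sub>m n m}"
  unfolding stable_def lin_sub_def using rep_carrier by (auto intro: right_mult_zero_mat)

text \<open>Starting from the zero space, each simple subspace is added to the complement \<open>Z\<close> if it meets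
  \<open>U + Z\<close> only in zero; by simplicity it is otherwise contained in \<open>U + Z\<close> already.\<close>

lemma complement_absorbing_simples:
  assumes "finite \<W>" "\<And>W. W \<in> \<W> \<Longrightarrow> simple m W" and U: "stable m U"
  shows "\<exists>Z. stable m Z \<and> U \<inter> Z = {0\<^sub>m n m} \<and> (\<forall>W\<in>\<W>. W \<subseteq> subspace_sum U Z)"
  using assms(1,2)
proof (induction \<W> rule: finite_induct)
  case empty
  show ?case
    using stable_zero lin_subD(2) U by (intro exI[of _ "{0\<^sub>m n m}"]) (auto simp: stable_def)
next
  case (insert W \<W>)
  from insert(3,4) obtain Z where Z: "stable m Z" and UZ: "U \<inter> Z = {0\<^sub>m n m}"
    and abs: "\<And>W. W \<in> \<W> \<Longrightarrow> W \<subseteq> subspace_sum U Z" by auto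
  have W: "simple m W" using insert(4) by simp
  then have Ws: "stable m W" by (simp add: simple_def)
  have lin: "lin_sub n m U" "lin_sub n m Z" "lin_sub n m W" using U Z Ws by (auto simp: stable_def)
  note UZs = stable_sum[OF U Z]
  have "W \<inter> subspace_sum U Z = {0\<^sub>m n m} \<or> W \<inter> subspace_sum U Z = W"
    using W stable_int[OF Ws UZs] unfolding simple_def by blast
  then show ?case
  proof
    assume "W \<inter> subspace_sum U Z = W"
    then show ?thesis using Z UZ abs by blast
  next
    assume W0: "W \<inter> subspace_sum U Z = {0\<^sub>m n m}"
    let ?Z = "subspace_sum Z W"
    have "U \<inter> ?Z \<subseteq> {0\<^sub>m n m}"
    proof
      fix u assume "u \<in> U \<inter> ?Z"
      then obtain z w where u: "u \<in> U" and eq: "u = z + w" and z: "z \<in> Z" and w: "w \<in> W"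
        by (auto simp: subspace_sum_def)
      have c: "u \<in> carrier_mat n m" "z \<in> carrier_mat n m" "w \<in> carrier_mat n m"
        using u z w lin lin_subD(1) by blast+
      have "w = u + (-1) \<cdot>\<^sub>m z" using eq c by (intro eq_matI) auto
      then have "w \<in> subspace_sum U Z"
        using u lin_subD(4)[OF lin(2) z] unfolding subspace_sum_def by blast
      then have "w = 0\<^sub>m n m" using w W0 by blast
      then have "u = z" using eq c by simp
      then show "u \<in> {0\<^sub>m n m}" using u z UZ by blast
    qed
    then have "U \<inter> ?Z = {0\<^sub>m n m}" using lin_subD(2) lin(1) lin_sub_sum[OF lin(2,3)] by blast
    moreover have "subspace_sum U Z \<subseteq> subspace_sum U ?Z" "W \<subseteq> subspace_sum U ?Z"
      using subspace_sum_upper[OF lin(2,3)] subspace_sum_upper(2)[OF lin(1) lin_sub_sum[OF lin(2,3)]]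
      unfolding subspace_sum_def by blast+
    ultimately show ?thesis using stable_sum[OF Z Ws] abs by blast
  qed
qed

text \<open>Stated for \<open>n \<times> m\<close> matrices, that is, for \<open>m\<close> copies of the representation space. Two values of
  \<open>m\<close> matter: \<open>m = 1\<close> gives projections inside the representation space itself, and \<open>m = n\<close> gives
  projections onto spaces spanned by matrices of the representation.\<close>

definition semisimple :: "nat \<Rightarrow> bool" where
  "semisimple m \<longleftrightarrow> (\<exists>\<W>. finite \<W> \<and> (\<forall>W\<in>\<W>. simple m W) \<and>
     (\<forall>S. lin_sub n m S \<longrightarrow> (\<forall>W\<in>\<W>. W \<subseteq> S) \<longrightarrow> S = carrier_mat n m))"

text \<open>If the simple subspaces span everything, the space \<open>Z\<close> of the preceding lemma is a stable
  complement of \<open>U\<close>, and \<open>E\<close> is the projection onto \<open>U\<close> along \<open>Z\<close>.\<close>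

lemma equivariant_projection:
  assumes ss: "semisimple m" and U: "stable m U"
  obtains E :: "complex mat \<Rightarrow> complex mat"
  where "\<And>X. X \<in> carrier_mat n m \<Longrightarrow> E X \<in> U" "\<And>X. X \<in> U \<Longrightarrow> E X = X"
    "\<And>X Y. X \<in> carrier_mat n m \<Longrightarrow> Y \<in> carrier_mat n m \<Longrightarrow> E (X + Y) = E X + E Y"
    "\<And>c X. X \<in> carrier_mat n m \<Longrightarrow> E (c \<cdot>\<^sub>m X) = c \<cdot>\<^sub>m E X"
    "\<And>g X. g \<in> carrier G \<Longrightarrow> X \<in> carrier_mat n m \<Longrightarrow> E (\<rho> g * X) = \<rho> g * E X"
proof -
  from ss obtain \<W> where "finite \<W>" "\<And>W. W \<in> \<W> \<Longrightarrow> simple m W"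
    and span: "\<And>S. lin_sub n m S \<Longrightarrow> (\<forall>W\<in>\<W>. W \<subseteq> S) \<Longrightarrow> S = carrier_mat n m"
    unfolding semisimple_def by blast
  from complement_absorbing_simples[OF this(1,2) U] obtain Z where Z: "stable m Z"
    and UZ: "U \<inter> Z = {0\<^sub>m n m}" and abs: "\<forall>W\<in>\<W>. W \<subseteq> subspace_sum U Z" by blast
  have Ul: "lin_sub n m U" and Zl: "lin_sub n m Z" using U Z by (auto simp: stable_def)
  note UD = lin_subD[OF Ul] and ZD = lin_subD[OF Zl]
  have all: "subspace_sum U Z = carrier_mat n m" by (rule span[OF lin_sub_sum[OF Ul Zl] abs])
  define E where "E X = (SOME u. u \<in> U \<and> (\<exists>z\<in>Z. u + z = X))" for X
  have ex: "E X \<in> U \<and> (\<exists>z\<in>Z. E X + z = X)" if X: "X \<in> carrier_mat n m" for X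
  proof -
    from X have "X \<in> subspace_sum U Z" unfolding all .
    then have "\<exists>u. u \<in> U \<and> (\<exists>z\<in>Z. u + z = X)" by (auto simp: subspace_sum_def)
    then show ?thesis unfolding E_def by (rule someI_ex)
  qed
  have uniq: "E (u + z) = u" if u: "u \<in> U" and z: "z \<in> Z" for u z
  proof -
    have c: "u \<in> carrier_mat n m" "z \<in> carrier_mat n m" using u z UD(1) ZD(1) by auto
    then obtain z' where z': "z' \<in> Z" "E (u + z) + z' = u + z" and e: "E (u + z) \<in> U"
      using ex[of "u + z"] by auto
    have c': "z' \<in> carrier_mat n m" "E (u + z) \<in> carrier_mat n m" using z' e UD(1) ZD(1) by auto
    have eq: "E (u + z) - u = z - z'"
    proof (rule eq_matI)
      fix i j assume "i < dim_row (z - z')" "j < dim_col (z - z')"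
      then have ij: "i < n" "j < m" using c c' by auto
      have "(u + z) $$ (i, j) = (E (u + z) + z') $$ (i, j)" using z'(2) by simp
      then show "(E (u + z) - u) $$ (i, j) = (z - z') $$ (i, j)"
        using ij c c' by (simp add: algebra_simps)
    qed (use c c' in auto)
    have "E (u + z) - u \<in> U \<inter> Z"
      using lin_sub_minus[OF Ul e u] lin_sub_minus[OF Zl z z'(1)] eq by auto
    then have 0: "E (u + z) - u = 0\<^sub>m n m" using UZ by blast
    show ?thesis
    proof (rule eq_matI)
      fix i j assume ij: "i < dim_row u" "j < dim_col u"
      then have "(E (u + z) - u) $$ (i, j) = 0" using 0 c by simp
      then show "E (u + z) $$ (i, j) = u $$ (i, j)" using ij c c' by simp
    qed (use c c' in auto)
  qed
  show thesis
  proof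
    fix X assume "X \<in> U"
    then show "E X = X" using uniq[OF _ ZD(2), of X] UD(1) by simp
  next
    fix X Y :: "complex mat" assume X: "X \<in> carrier_mat n m" and Y: "Y \<in> carrier_mat n m"
    obtain z where z: "z \<in> Z" "E X + z = X" and eX: "E X \<in> U" using ex[OF X] by blast
    obtain z' where z': "z' \<in> Z" "E Y + z' = Y" and eY: "E Y \<in> U" using ex[OF Y] by blast
    have "X + Y = (E X + E Y) + (z + z')"
    proof -
      have "X + Y = (E X + z) + (E Y + z')" using z z' by simp
      also have "\<dots> = (E X + E Y) + (z + z')"
        using UD(1)[OF eX] UD(1)[OF eY] ZD(1)[OF z(1)] ZD(1)[OF z'(1)] by (intro eq_matI) auto
      finally show "X + Y = (E X + E Y) + (z + z')" .
    qed
    then show "E (X + Y) = E X + E Y" using uniq[OF UD(3)[OF eX eY] ZD(3)[OF z(1) z'(1)]] by simp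
  next
    fix X :: "complex mat" and c assume X: "X \<in> carrier_mat n m"
    obtain z where z: "z \<in> Z" "E X + z = X" and eX: "E X \<in> U" using ex[OF X] by blast
    have "c \<cdot>\<^sub>m (E X + z) = c \<cdot>\<^sub>m E X + c \<cdot>\<^sub>m z"
      by (rule add_smult_distrib_left_mat) (use UD(1)[OF eX] ZD(1)[OF z(1)] in auto)
    then show "E (c \<cdot>\<^sub>m X) = c \<cdot>\<^sub>m E X" using uniq[OF UD(4)[OF eX] ZD(4)[OF z(1)], of c c] unfolding z(2) by simp
  next
    fix X :: "complex mat" and g assume X: "X \<in> carrier_mat n m" and g: "g \<in> carrier G"
    obtain z where z: "z \<in> Z" "E X + z = X" and eX: "E X \<in> U" using ex[OF X] by blast
    have "\<rho> g * (E X + z) = \<rho> g * E X + \<rho> g * z"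
      by (rule mult_add_distrib_mat) (use UD(1)[OF eX] ZD(1)[OF z(1)] rep_carrier[OF g] in auto)
    moreover have "\<rho> g * E X \<in> U" "\<rho> g * z \<in> Z" using U Z g eX z(1) by (auto simp: stable_def)
    note uniq[OF this]
    ultimately show "E (\<rho> g * X) = \<rho> g * E X" unfolding z(2) by simp
  qed (use ex in blast)
qed

end

section \<open>Matrices supported on one column\<close>

definition in_column :: "nat \<Rightarrow> nat \<Rightarrow> complex vec \<Rightarrow> complex mat" where
  "in_column m j v = mat (dim_vec v) m (\<lambda>(r, c). if c = j then v $ r else 0)"

lemma in_column_carrier [simp]: "v \<in> carrier_vec n \<Longrightarrow> in_column m j v \<in> carrier_mat n m"
  by (auto simp: in_column_def)

lemma in_column_zero: "in_column m j (0\<^sub>v n) = 0\<^sub>m n m"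
  by (rule eq_matI) (auto simp: in_column_def)

lemma in_column_add:
  "v \<in> carrier_vec n \<Longrightarrow> w \<in> carrier_vec n \<Longrightarrow> in_column m j (v + w) = in_column m j v + in_column m j w"
  by (rule eq_matI) (auto simp: in_column_def)

lemma in_column_smult: "v \<in> carrier_vec n \<Longrightarrow> in_column m j (c \<cdot>\<^sub>v v) = c \<cdot>\<^sub>m in_column m j v"
  by (rule eq_matI) (auto simp: in_column_def)

lemma mult_in_column:
  assumes "A \<in> carrier_mat k n" "v \<in> carrier_vec n"
  shows "A * in_column m j v = in_column m j (A *\<^sub>v v)"
  using assms by (intro eq_matI) (auto simp: in_column_def scalar_prod_def)

lemma first_columns_Suc:
  fixes X :: "complex mat"
  assumes "X \<in> carrier_mat n m"
  shows "mat n m (\<lambda>(r, c). if c < Suc k then X $$ (r, c) else 0)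
    = mat n m (\<lambda>(r, c). if c < k then X $$ (r, c) else 0) + in_column m k (col X k)"
    (is "?L = ?R")
proof (rule eq_matI)
  show "dim_row ?L = dim_row ?R" "dim_col ?L = dim_col ?R"
    using assms by (auto simp: in_column_def)
  fix i j assume "i < dim_row ?R" "j < dim_col ?R"
  then have ij: "i < n" "j < m" using assms by (auto simp: in_column_def)
  have "in_column m k (col X k) $$ (i, j) = (if j = k then X $$ (i, j) else 0)"
    using ij assms by (auto simp: in_column_def)
  moreover have "in_column m k (col X k) \<in> carrier_mat n m"
    by (intro in_column_carrier carrier_vecI) (use assms in simp)
  ultimately show "?L $$ (i, j) = ?R $$ (i, j)"
    using ij by (auto simp: less_Suc_eq)
qed

lemma columns_span:
  assumes S: "lin_sub n m S" and col: "\<And>j v. j < m \<Longrightarrow> v \<in> carrier_vec n \<Longrightarrow> in_column m j v \<in> S"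
  shows "S = carrier_mat n m"
proof -
  have "X \<in> S" if X: "X \<in> carrier_mat n m" for X
  proof -
    have "k \<le> m \<Longrightarrow> mat n m (\<lambda>(r, c). if c < k then X $$ (r, c) else 0) \<in> S" for k
    proof (induction k)
      case 0
      have "mat n m (\<lambda>(r, c). if c < 0 then X $$ (r, c) else 0) = 0\<^sub>m n m" by (rule eq_matI) auto
      then show ?case by (metis lin_subD(2)[OF S])
    next
      case (Suc k)
      have "mat n m (\<lambda>(r, c). if c < Suc k then X $$ (r, c) else 0)
          = mat n m (\<lambda>(r, c). if c < k then X $$ (r, c) else 0) + in_column m k (col X k)"
        by (rule first_columns_Suc[OF X])
      moreover have "col X k \<in> carrier_vec n" using X by (intro carrier_vecI) simp
      note lin_subD(3)[OF S Suc.IH[OF Suc_leD[OF Suc.prems]] col[OF Suc_le_lessD[OF Suc.prems] this]]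
      ultimately show ?case by (simp only:)
    qed
    from this[OF le_refl] have "mat n m (\<lambda>(r, c). if c < m then X $$ (r, c) else 0) \<in> S" .
    moreover have "mat n m (\<lambda>(r, c). if c < m then X $$ (r, c) else 0) = X"
      using X by (intro eq_matI) auto
    ultimately show ?thesis by simp
  qed
  then show ?thesis using lin_subD(1)[OF S] by blast
qed

section \<open>Spanning by images of irreducible representations\<close>

text \<open>A triple \<open>(k, \<sigma>, C)\<close> in \<open>F\<close> is an intertwiner \<open>C\<close> from the irreducible representation \<open>\<sigma>\<close> of dimension
  \<open>k\<close> to \<open>\<rho>\<close>; the images of these intertwiners span. In contrast to a decomposition into diagonal
  blocks, this is easily carried through direct sums and changes of basis.\<close>

definition spanned_by_irreducibles ::
  "('a, 'b) monoid_scheme \<Rightarrow> nat \<Rightarrow> ('a \<Rightarrow> complex mat) \<Rightarrow>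
    (nat \<times> ('a \<Rightarrow> complex mat) \<times> complex mat) set \<Rightarrow> bool" where
  "spanned_by_irreducibles G n \<rho> F \<longleftrightarrow> finite F \<and>
     (\<forall>(k, \<sigma>, C)\<in>F. irreducible_rep G k \<sigma> \<and> C \<in> carrier_mat n k \<and>
        (\<forall>g\<in>carrier G. \<rho> g * C = C * \<sigma> g)) \<and>
     (\<forall>S. 0\<^sub>v n \<in> S \<longrightarrow> (\<forall>v\<in>S. \<forall>w\<in>S. v + w \<in> S) \<longrightarrow>
        (\<forall>(k, \<sigma>, C)\<in>F. \<forall>w\<in>carrier_vec k. C *\<^sub>v w \<in> S) \<longrightarrow> carrier_vec n \<subseteq> S)"

lemma stable_subspaceI:
  assumes "W \<subseteq> carrier_vec n" "0\<^sub>v n \<in> W" "\<And>v w. v \<in> W \<Longrightarrow> w \<in> W \<Longrightarrow> v + w \<in> W"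
    "\<And>c v. v \<in> W \<Longrightarrow> c \<cdot>\<^sub>v v \<in> W" "\<And>g v. g \<in> carrier G \<Longrightarrow> v \<in> W \<Longrightarrow> \<rho> g *\<^sub>v v \<in> W"
  shows "stable_subspace G n \<rho> W"
proof -
  have "submodule class_ring W (module_vec TYPE(complex) n)"
    by (intro submodule.intro vec_module) (use assms in \<open>auto simp: module_vec_simps\<close>)
  then show ?thesis
    using assms(5) vec_vs unfolding stable_subspace_def VectorSpace.subspace_def by blast
qed

lemma irreducible_rep_carrier:
  assumes "irreducible_rep G k \<sigma>" "g \<in> carrier G"
  shows "\<sigma> g \<in> carrier_mat k k"
proof -
  have "\<sigma> \<in> hom G (GL k)" using assms(1) by (simp only: irreducible_rep_def)
  from GL_carrier_mat[OF hom_in_carrier[OF this assms(2)]] show ?thesis .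
qed

context matrix_rep
begin

text \<open>The matrices with a single nonzero column, taken from the image of \<open>C\<close>, form the image of the
  irreducible representation \<open>\<sigma>\<close> under an equivariant map, so a stable subspace pulls back to one
  for \<open>\<sigma>\<close>.\<close>

lemma simple_column:
  assumes irr: "irreducible_rep G k \<sigma>" and C: "C \<in> carrier_mat n k"
    and eq: "\<And>g. g \<in> carrier G \<Longrightarrow> \<rho> g * C = C * \<sigma> g"
  shows "simple m ((\<lambda>w. in_column m j (C *\<^sub>v w)) ` carrier_vec k)" (is "simple m (?f ` _)")
proof -
  have \<sigma>: "\<sigma> g \<in> carrier_mat k k" if "g \<in> carrier G" for g
    using irr that by (rule irreducible_rep_carrier)
  have f0: "?f (0\<^sub>v k) = 0\<^sub>m n m"
  proof -
    have "C *\<^sub>v 0\<^sub>v k = 0\<^sub>v n" using C by (intro eq_vecI) auto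
    then show ?thesis by (simp only: in_column_zero)
  qed
  have fadd: "?f (v + w) = ?f v + ?f w" if "v \<in> carrier_vec k" "w \<in> carrier_vec k" for v w
    using mult_add_distrib_mat_vec[OF C that] in_column_add[of "C *\<^sub>v v" n "C *\<^sub>v w"] C that by simp
  have fsm: "?f (c \<cdot>\<^sub>v v) = c \<cdot>\<^sub>m ?f v" if "v \<in> carrier_vec k" for c v
    using mult_mat_vec[OF C that] in_column_smult[of "C *\<^sub>v v" n] C that by simp
  have fg: "\<rho> g * ?f v = ?f (\<sigma> g *\<^sub>v v)" if g: "g \<in> carrier G" and v: "v \<in> carrier_vec k" for g v
  proof -
    have "\<rho> g * ?f v = in_column m j (\<rho> g *\<^sub>v (C *\<^sub>v v))"
      by (rule mult_in_column[OF rep_carrier[OF g]]) (use C v in auto)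
    also have "\<rho> g *\<^sub>v (C *\<^sub>v v) = (\<rho> g * C) *\<^sub>v v"
      by (rule assoc_mult_mat_vec[OF rep_carrier[OF g] C v, symmetric])
    also have "\<dots> = C *\<^sub>v (\<sigma> g *\<^sub>v v)"
      unfolding eq[OF g] by (rule assoc_mult_mat_vec[OF C \<sigma>[OF g] v])
    finally show ?thesis .
  qed
  have fc: "?f v \<in> carrier_mat n m" if "v \<in> carrier_vec k" for v
    using C that by simp
  have "stable m (?f ` carrier_vec k)"
    unfolding stable_def lin_sub_def
  proof (intro conjI ballI allI)
    show "?f ` carrier_vec k \<subseteq> carrier_mat n m" using fc by blast
    show "0\<^sub>m n m \<in> ?f ` carrier_vec k" using f0 by (metis imageI zero_carrier_vec)
    fix X assume "X \<in> ?f ` carrier_vec k"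
    then obtain v where v: "X = ?f v" "v \<in> carrier_vec k" by blast
    show "c \<cdot>\<^sub>m X \<in> ?f ` carrier_vec k" for c
      unfolding v(1) fsm[OF v(2), symmetric] using v(2) by (intro imageI) simp
    show "\<rho> g * X \<in> ?f ` carrier_vec k" if "g \<in> carrier G" for g
      unfolding v(1) fg[OF that v(2)] using v(2) \<sigma>[OF that] by (intro imageI) simp
    fix Y assume "Y \<in> ?f ` carrier_vec k"
    then obtain w where w: "Y = ?f w" "w \<in> carrier_vec k" by blast
    show "X + Y \<in> ?f ` carrier_vec k"
      unfolding v(1) w(1) fadd[OF v(2) w(2), symmetric] using v(2) w(2) by (intro imageI) simp
  qed
  moreover have "U = {0\<^sub>m n m} \<or> U = ?f ` carrier_vec k"
    if U: "stable m U" and sub: "U \<subseteq> ?f ` carrier_vec k" for U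
  proof -
    have Ul: "lin_sub n m U" using U by (simp add: stable_def)
    let ?V = "{v \<in> carrier_vec k. ?f v \<in> U}"
    have "stable_subspace G k \<sigma> ?V"
    proof (rule stable_subspaceI)
      show "0\<^sub>v k \<in> ?V" using f0 lin_subD(2)[OF Ul] by simp
      show "v + w \<in> ?V" if "v \<in> ?V" "w \<in> ?V" for v w
        using that fadd[of v w] lin_subD(3)[OF Ul, of "?f v" "?f w"] by simp
      show "c \<cdot>\<^sub>v v \<in> ?V" if "v \<in> ?V" for c v
        using that fsm[of v c] lin_subD(4)[OF Ul, of "?f v" c] by simp
      show "\<sigma> g *\<^sub>v v \<in> ?V" if "g \<in> carrier G" "v \<in> ?V" for g v
      proof -
        have v: "v \<in> carrier_vec k" and "?f v \<in> U" using that(2) by auto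
        then have "\<rho> g * ?f v \<in> U" using U that(1) unfolding stable_def by blast
        then have "?f (\<sigma> g *\<^sub>v v) \<in> U" unfolding fg[OF that(1) v] .
        then show ?thesis using mult_mat_vec_carrier[OF \<sigma>[OF that(1)] v] by blast
      qed
    qed auto
    then have "?V = {0\<^sub>v k} \<or> ?V = carrier_vec k" using irr unfolding irreducible_rep_def by blast
    then show ?thesis
    proof
      assume V: "?V = {0\<^sub>v k}"
      have "X = 0\<^sub>m n m" if "X \<in> U" for X
      proof -
        obtain v where v: "X = ?f v" "v \<in> carrier_vec k" using \<open>X \<in> U\<close> sub by blast
        then have "v \<in> ?V" using \<open>X \<in> U\<close> by simp
        then have "v = 0\<^sub>v k" unfolding V by simp
        then show ?thesis using v(1) f0 by simp
      qed
      then show ?thesis using lin_subD(2)[OF Ul] by blast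
    next
      assume "?V = carrier_vec k"
      then show ?thesis using sub by blast
    qed
  qed
  ultimately show ?thesis by (simp add: simple_def)
qed

lemma semisimple_if_spanned:
  assumes F: "spanned_by_irreducibles G n \<rho> F"
  shows "semisimple m"
proof -
  let ?W = "\<lambda>(t :: nat \<times> ('a \<Rightarrow> complex mat) \<times> complex mat) j.
      (\<lambda>w. in_column m j (snd (snd t) *\<^sub>v w)) ` carrier_vec (fst t)"
  let ?\<W> = "(\<lambda>(t, j). ?W t j) ` (F \<times> {..<m})"
  have fin: "finite F" and irr: "\<And>k \<sigma> C. (k, \<sigma>, C) \<in> F \<Longrightarrow> irreducible_rep G k \<sigma> \<and>
      C \<in> carrier_mat n k \<and> (\<forall>g\<in>carrier G. \<rho> g * C = C * \<sigma> g)"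
    and span: "\<And>S. 0\<^sub>v n \<in> S \<Longrightarrow> (\<forall>v\<in>S. \<forall>w\<in>S. v + w \<in> S) \<Longrightarrow>
        (\<forall>(k, \<sigma>, C)\<in>F. \<forall>w\<in>carrier_vec k. C *\<^sub>v w \<in> S) \<Longrightarrow> carrier_vec n \<subseteq> S"
    using F unfolding spanned_by_irreducibles_def by blast+
  have "S = carrier_mat n m" if S: "lin_sub n m S" and sub: "\<forall>W\<in>?\<W>. W \<subseteq> S" for S
  proof (rule columns_span[OF S])
    fix j and v :: "complex vec" assume j: "j < m" and v: "v \<in> carrier_vec n"
    have "carrier_vec n \<subseteq> {v \<in> carrier_vec n. in_column m j v \<in> S}"
    proof (rule span)
      show "0\<^sub>v n \<in> {v \<in> carrier_vec n. in_column m j v \<in> S}"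
        using lin_subD(2)[OF S] by (simp add: in_column_zero)
      show "\<forall>v\<in>{v \<in> carrier_vec n. in_column m j v \<in> S}. \<forall>w\<in>{v \<in> carrier_vec n. in_column m j v \<in> S}.
          v + w \<in> {v \<in> carrier_vec n. in_column m j v \<in> S}"
        using lin_subD(3)[OF S] by (auto simp: in_column_add)
      have "in_column m j (C *\<^sub>v w) \<in> S" if "(k, \<sigma>, C) \<in> F" "w \<in> carrier_vec k" for k \<sigma> C w
      proof -
        have "?W (k, \<sigma>, C) j \<in> ?\<W>" using that(1) j by blast
        from bspec[OF sub this] have "?W (k, \<sigma>, C) j \<subseteq> S" .
        then show ?thesis using that(2) by auto
      qed
      then show "\<forall>(k, \<sigma>, C)\<in>F. \<forall>w\<in>carrier_vec k. C *\<^sub>v w \<in> {v \<in> carrier_vec n. in_column m j v \<in> S}"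
        using irr by fastforce
    qed
    then show "in_column m j v \<in> S" using v by blast
  qed
  moreover have "\<forall>W\<in>?\<W>. simple m W"
  proof (clarify, simp only: fst_conv snd_conv)
    fix k \<sigma> C j assume F: "(k, \<sigma>, C) \<in> F"
    show "simple m ((\<lambda>w. in_column m j (C *\<^sub>v w)) ` carrier_vec k)"
      by (rule simple_column[of k \<sigma>]) (use irr[OF F] in blast)+
  qed
  ultimately show ?thesis
    unfolding semisimple_def using fin by (intro exI[of _ ?\<W>]) auto
qed

end

lemma direct_sum_rep_carrier:
  assumes "\<And>m \<sigma>. (m, \<sigma>) \<in> set \<sigma>s \<Longrightarrow> \<sigma> g \<in> carrier_mat m m"
  shows "direct_sum_rep \<sigma>s g \<in> carrier_mat (sum_list (map fst \<sigma>s)) (sum_list (map fst \<sigma>s))"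
proof -
  have "map dim_row (map (\<lambda>(m, \<sigma>). \<sigma> g) \<sigma>s) = map fst \<sigma>s" "map dim_col (map (\<lambda>(m, \<sigma>). \<sigma> g) \<sigma>s) = map fst \<sigma>s"
    using carrier_matD[OF assms] by auto
  then show ?thesis unfolding direct_sum_rep_def carrier_mat_def
    by (simp only: dim_diag_block_mat mem_Collect_eq simp_thms)
qed

text \<open>For the block diagonal matrices with blocks \<open>\<sigma>\<close> and \<open>\<rho>'\<close>, the inclusions \<open>J1\<close>, \<open>J2\<close> of the two
  summands are intertwiners; composing with \<open>J2\<close> transports the family found for \<open>\<rho>'\<close>.\<close>

lemma spanned_direct_sum:
  assumes "\<And>m \<sigma>. (m, \<sigma>) \<in> set \<sigma>s \<Longrightarrow> irreducible_rep G m \<sigma>"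
  shows "\<exists>F. spanned_by_irreducibles G (sum_list (map fst \<sigma>s)) (direct_sum_rep \<sigma>s) F"
  using assms
proof (induction \<sigma>s)
  case Nil
  have "v \<in> S" if "0\<^sub>v 0 \<in> S" "v \<in> carrier_vec 0" for v :: "complex vec" and S
  proof -
    have "v = 0\<^sub>v 0" using that by auto
    then show ?thesis using that by simp
  qed
  then show ?case
    by (intro exI[of _ "{}"]) (auto simp: spanned_by_irreducibles_def)
next
  case (Cons t \<sigma>s)
  obtain m \<sigma> where t: "t = (m, \<sigma>)" by (cases t)
  let ?n = "sum_list (map fst \<sigma>s)" and ?\<rho> = "direct_sum_rep \<sigma>s"
  from Cons obtain F where F: "spanned_by_irreducibles G ?n ?\<rho> F" by fastforce
  then have fin: "finite F" and irr: "\<And>k \<sigma> C. (k, \<sigma>, C) \<in> F \<Longrightarrow> irreducible_rep G k \<sigma> \<and>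
      C \<in> carrier_mat ?n k \<and> (\<forall>g\<in>carrier G. ?\<rho> g * C = C * \<sigma> g)"
    and span: "\<And>S. 0\<^sub>v ?n \<in> S \<Longrightarrow> (\<forall>v\<in>S. \<forall>w\<in>S. v + w \<in> S) \<Longrightarrow>
        (\<forall>(k, \<sigma>, C)\<in>F. \<forall>w\<in>carrier_vec k. C *\<^sub>v w \<in> S) \<Longrightarrow> carrier_vec ?n \<subseteq> S"
    unfolding spanned_by_irreducibles_def by blast+
  note irrc = irreducible_rep_carrier
  have irr\<sigma>: "irreducible_rep G m \<sigma>" using Cons.prems t by simp
  have \<rho>: "?\<rho> g \<in> carrier_mat ?n ?n" if "g \<in> carrier G" for g
    using direct_sum_rep_carrier irrc[OF _ that] Cons.prems by (metis list.set_intros(2))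
  have block: "direct_sum_rep (t # \<sigma>s) g = four_block_mat (\<sigma> g) (0\<^sub>m m ?n) (0\<^sub>m ?n m) (?\<rho> g)"
    if "g \<in> carrier G" for g
    using irrc[OF irr\<sigma> that] \<rho>[OF that]
    unfolding t direct_sum_rep_def list.map diag_block_mat.simps Let_def prod.case
    by (simp only: carrier_matD)
  let ?J1 = "1\<^sub>m m @\<^sub>r 0\<^sub>m ?n m :: complex mat" and ?J2 = "0\<^sub>m m ?n @\<^sub>r 1\<^sub>m ?n :: complex mat"
  have J: "?J1 \<in> carrier_mat (m + ?n) m" "?J2 \<in> carrier_mat (m + ?n) ?n" by auto
  have J1: "direct_sum_rep (t # \<sigma>s) g * ?J1 = ?J1 * \<sigma> g" if g: "g \<in> carrier G" for g
  proof -
    note c = irrc[OF irr\<sigma> g] \<rho>[OF g]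
    have "direct_sum_rep (t # \<sigma>s) g * ?J1 = \<sigma> g @\<^sub>r 0\<^sub>m ?n m"
      unfolding block[OF g] append_rows_def
      by (subst mult_four_block_mat[OF c(1) _ _ c(2)]) (use c in auto)
    also have "\<dots> = ?J1 * \<sigma> g"
      using c by (intro eq_matI) (auto simp: append_rows_def scalar_prod_def if_distrib[of "\<lambda>x. x * _"] cong: if_cong)
    finally show ?thesis .
  qed
  have J2: "direct_sum_rep (t # \<sigma>s) g * ?J2 = ?J2 * ?\<rho> g" if g: "g \<in> carrier G" for g
  proof -
    note c = irrc[OF irr\<sigma> g] \<rho>[OF g]
    have "direct_sum_rep (t # \<sigma>s) g * ?J2 = 0\<^sub>m m ?n @\<^sub>r ?\<rho> g"
      unfolding block[OF g] append_rows_def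
      by (subst mult_four_block_mat[OF c(1) _ _ c(2)]) (use c in auto)
    also have "\<dots> = ?J2 * ?\<rho> g"
      using c by (intro eq_matI) (auto simp: append_rows_def scalar_prod_def if_distrib[of "\<lambda>x. x * _"] cong: if_cong)
    finally show ?thesis .
  qed
  let ?F = "insert (m, \<sigma>, ?J1) ((\<lambda>(k, \<tau>, C). (k, \<tau>, ?J2 * C)) ` F)"
  have "spanned_by_irreducibles G (m + ?n) (direct_sum_rep (t # \<sigma>s)) ?F"
    unfolding spanned_by_irreducibles_def
  proof (intro conjI allI impI)
    show "finite ?F" using fin by simp
    have eqJ: "direct_sum_rep (t # \<sigma>s) g * (?J2 * C) = ?J2 * C * \<tau> g"
      if F: "(k, \<tau>, C) \<in> F" and g: "g \<in> carrier G" for k \<tau> C g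
    proof -
      have C: "C \<in> carrier_mat ?n k" and \<tau>: "\<tau> g \<in> carrier_mat k k" and eq: "?\<rho> g * C = C * \<tau> g"
        using irr[OF F] irrc[of G k \<tau> g] g by auto
      have D: "direct_sum_rep (t # \<sigma>s) g \<in> carrier_mat (m + ?n) (m + ?n)"
        unfolding block[OF g] using irrc[OF irr\<sigma> g] \<rho>[OF g] by simp
      show ?thesis
        unfolding assoc_mult_mat[OF D J(2) C, symmetric] J2[OF g] assoc_mult_mat[OF J(2) \<rho>[OF g] C]
          eq assoc_mult_mat[OF J(2) C \<tau>] ..
    qed
    have carJ: "?J2 * C \<in> carrier_mat (m + ?n) k" if "(k, \<tau>, C) \<in> F" for k \<tau> C
      using J(2) irr[OF that] by (intro mult_carrier_mat) auto
    show "\<forall>(k, \<tau>, C)\<in>?F. irreducible_rep G k \<tau> \<and> C \<in> carrier_mat (m + ?n) k \<and>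
        (\<forall>g\<in>carrier G. direct_sum_rep (t # \<sigma>s) g * C = C * \<tau> g)"
    proof (intro ballI, elim insertE imageE)
      fix y assume "y = (m, \<sigma>, ?J1)"
      then show "case y of (k, \<tau>, C) \<Rightarrow> irreducible_rep G k \<tau> \<and> C \<in> carrier_mat (m + ?n) k \<and>
          (\<forall>g\<in>carrier G. direct_sum_rep (t # \<sigma>s) g * C = C * \<tau> g)"
        using irr\<sigma> J(1) J1 by simp
    next
      fix y x assume y: "y = (case x of (k, \<tau>, C) \<Rightarrow> (k, \<tau>, ?J2 * C))" and x: "x \<in> F"
      obtain k \<tau> C where x': "x = (k, \<tau>, C)" by (cases x)
      have F: "(k, \<tau>, C) \<in> F" using x x' by simp
      show "case y of (k, \<tau>, C) \<Rightarrow> irreducible_rep G k \<tau> \<and> C \<in> carrier_mat (m + ?n) k \<and>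
          (\<forall>g\<in>carrier G. direct_sum_rep (t # \<sigma>s) g * C = C * \<tau> g)"
        unfolding y x' prod.case using irr[OF F] eqJ[OF F] carJ[OF F] by blast
    qed
  next
    fix S assume S0: "0\<^sub>v (m + ?n) \<in> S" and Sadd: "\<forall>v\<in>S. \<forall>w\<in>S. v + w \<in> S"
      and SF: "\<forall>(k, \<tau>, C)\<in>?F. \<forall>w\<in>carrier_vec k. C *\<^sub>v w \<in> S"
    have 1: "?J1 *\<^sub>v v \<in> S" if "v \<in> carrier_vec m" for v using SF that by simp
    have app2: "?J2 *\<^sub>v v = 0\<^sub>v m @\<^sub>v v" if "v \<in> carrier_vec ?n" for v
    proof -
      have "0\<^sub>m m ?n *\<^sub>v v = 0\<^sub>v m" using that by (intro eq_vecI) auto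
      then show ?thesis
        using mat_mult_append[OF _ _ that, of "0\<^sub>m m ?n" m "1\<^sub>m ?n" ?n] that by simp
    qed
    have app1: "?J1 *\<^sub>v v = v @\<^sub>v 0\<^sub>v ?n" if "v \<in> carrier_vec m" for v
    proof -
      have "0\<^sub>m ?n m *\<^sub>v v = 0\<^sub>v ?n" using that by (intro eq_vecI) auto
      then show ?thesis
        using mat_mult_append[OF _ _ that, of "1\<^sub>m m" m "0\<^sub>m ?n m" ?n] that by simp
    qed
    have "carrier_vec ?n \<subseteq> {v \<in> carrier_vec ?n. ?J2 *\<^sub>v v \<in> S}"
    proof (rule span)
      have "?J2 *\<^sub>v 0\<^sub>v ?n = 0\<^sub>v (m + ?n)"
        unfolding app2[OF zero_carrier_vec] by (intro eq_vecI) auto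
      then show "0\<^sub>v ?n \<in> {v \<in> carrier_vec ?n. ?J2 *\<^sub>v v \<in> S}" using S0 by simp
      show "\<forall>v\<in>{v \<in> carrier_vec ?n. ?J2 *\<^sub>v v \<in> S}. \<forall>w\<in>{v \<in> carrier_vec ?n. ?J2 *\<^sub>v v \<in> S}.
          v + w \<in> {v \<in> carrier_vec ?n. ?J2 *\<^sub>v v \<in> S}"
        using Sadd by (auto simp: mult_add_distrib_mat_vec[OF J(2)])
      have "?J2 *\<^sub>v (C *\<^sub>v w) \<in> S" "C *\<^sub>v w \<in> carrier_vec ?n"
        if F: "(k, \<tau>, C) \<in> F" and w: "w \<in> carrier_vec k" for k \<tau> C w
      proof -
        have C: "C \<in> carrier_mat ?n k" using irr[OF F] by blast
        have "(k, \<tau>, ?J2 * C) \<in> ?F" using F by force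
        from bspec[OF SF this] have "(?J2 * C) *\<^sub>v w \<in> S" using w by simp
        then show "?J2 *\<^sub>v (C *\<^sub>v w) \<in> S" unfolding assoc_mult_mat_vec[OF J(2) C w] .
        show "C *\<^sub>v w \<in> carrier_vec ?n" using C w by simp
      qed
      then show "\<forall>(k, \<tau>, C)\<in>F. \<forall>w\<in>carrier_vec k. C *\<^sub>v w \<in> {v \<in> carrier_vec ?n. ?J2 *\<^sub>v v \<in> S}"
        by blast
    qed
    then have 2: "?J2 *\<^sub>v v \<in> S" if "v \<in> carrier_vec ?n" for v using that by blast
    show "carrier_vec (m + ?n) \<subseteq> S"
    proof
      fix v :: "complex vec" assume v: "v \<in> carrier_vec (m + ?n)"
      have "v = ?J1 *\<^sub>v vec_first v m + ?J2 *\<^sub>v vec_last v ?n"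
        unfolding app1[OF vec_first_carrier] app2[OF vec_last_carrier]
        using v by (intro eq_vecI) (auto simp: vec_first_def vec_last_def)
      then show "v \<in> S"
        using 1[OF vec_first_carrier] 2[OF vec_last_carrier] Sadd by metis
    qed
  qed
  then show ?case by (intro exI[of _ ?F]) (simp only: t list.map sum_list.Cons fst_conv)
qed

lemma spanned_conjugate:
  assumes F: "spanned_by_irreducibles G n \<sigma> F" and \<rho>: "\<And>g. g \<in> carrier G \<Longrightarrow> \<rho> g \<in> carrier_mat n n"
    and \<sigma>: "\<And>g. g \<in> carrier G \<Longrightarrow> \<sigma> g \<in> carrier_mat n n"
    and AB: "A \<in> carrier_mat n n" "B \<in> carrier_mat n n" "B * A = 1\<^sub>m n"
    and eq: "\<And>g. g \<in> carrier G \<Longrightarrow> \<rho> g * B = B * \<sigma> g"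
  shows "spanned_by_irreducibles G n \<rho> ((\<lambda>(k, \<tau>, C). (k, \<tau>, B * C)) ` F)"
  unfolding spanned_by_irreducibles_def
proof (intro conjI allI impI)
  have fin: "finite F" and irr: "\<And>k \<tau> C. (k, \<tau>, C) \<in> F \<Longrightarrow> irreducible_rep G k \<tau> \<and>
      C \<in> carrier_mat n k \<and> (\<forall>g\<in>carrier G. \<sigma> g * C = C * \<tau> g)"
    and span: "\<And>S. 0\<^sub>v n \<in> S \<Longrightarrow> (\<forall>v\<in>S. \<forall>w\<in>S. v + w \<in> S) \<Longrightarrow>
        (\<forall>(k, \<sigma>, C)\<in>F. \<forall>w\<in>carrier_vec k. C *\<^sub>v w \<in> S) \<Longrightarrow> carrier_vec n \<subseteq> S"
    using F unfolding spanned_by_irreducibles_def by blast+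
  show "finite ((\<lambda>(k, \<tau>, C). (k, \<tau>, B * C)) ` F)" using fin by simp
  have eqB: "\<rho> g * (B * C) = B * C * \<tau> g" if F: "(k, \<tau>, C) \<in> F" and g: "g \<in> carrier G" for k \<tau> C g
  proof -
    have C: "C \<in> carrier_mat n k" and \<tau>: "\<tau> g \<in> carrier_mat k k" and eq': "\<sigma> g * C = C * \<tau> g"
      using irr[OF F] irreducible_rep_carrier[of G k \<tau> g] g by auto
    show ?thesis
      unfolding assoc_mult_mat[OF \<rho>[OF g] AB(2) C, symmetric] eq[OF g]
        assoc_mult_mat[OF AB(2) \<sigma>[OF g] C] eq' assoc_mult_mat[OF AB(2) C \<tau>] ..
  qed
  show "\<forall>(k, \<tau>, C)\<in>(\<lambda>(k, \<tau>, C). (k, \<tau>, B * C)) ` F. irreducible_rep G k \<tau> \<and> C \<in> carrier_mat n k \<and>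
      (\<forall>g\<in>carrier G. \<rho> g * C = C * \<tau> g)"
  proof (intro ballI, elim imageE)
    fix y x assume y: "y = (case x of (k, \<tau>, C) \<Rightarrow> (k, \<tau>, B * C))" and x: "x \<in> F"
    obtain k \<tau> C where x': "x = (k, \<tau>, C)" by (cases x)
    have F: "(k, \<tau>, C) \<in> F" using x x' by simp
    show "case y of (k, \<tau>, C) \<Rightarrow> irreducible_rep G k \<tau> \<and> C \<in> carrier_mat n k \<and>
        (\<forall>g\<in>carrier G. \<rho> g * C = C * \<tau> g)"
      unfolding y x' prod.case using irr[OF F] eqB[OF F] mult_carrier_mat[OF AB(2)] by blast
  qed
  fix S assume S0: "0\<^sub>v n \<in> S" and Sadd: "\<forall>v\<in>S. \<forall>w\<in>S. v + w \<in> S"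
    and SF: "\<forall>(k, \<tau>, C)\<in>(\<lambda>(k, \<tau>, C). (k, \<tau>, B * C)) ` F. \<forall>w\<in>carrier_vec k. C *\<^sub>v w \<in> S"
  have "carrier_vec n \<subseteq> {v \<in> carrier_vec n. B *\<^sub>v v \<in> S}"
  proof (rule span)
    have "B *\<^sub>v 0\<^sub>v n = 0\<^sub>v n" using AB(2) by (intro eq_vecI) auto
    then show "0\<^sub>v n \<in> {v \<in> carrier_vec n. B *\<^sub>v v \<in> S}" using S0 by simp
    show "\<forall>v\<in>{v \<in> carrier_vec n. B *\<^sub>v v \<in> S}. \<forall>w\<in>{v \<in> carrier_vec n. B *\<^sub>v v \<in> S}.
        v + w \<in> {v \<in> carrier_vec n. B *\<^sub>v v \<in> S}"
      using Sadd by (auto simp: mult_add_distrib_mat_vec[OF AB(2)])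
    have "B *\<^sub>v (C *\<^sub>v w) \<in> S" "C *\<^sub>v w \<in> carrier_vec n"
      if F: "(k, \<tau>, C) \<in> F" and w: "w \<in> carrier_vec k" for k \<tau> C w
    proof -
      have C: "C \<in> carrier_mat n k" using irr[OF F] by blast
      have "(k, \<tau>, B * C) \<in> (\<lambda>(k, \<tau>, C). (k, \<tau>, B * C)) ` F" using F by force
      from bspec[OF SF this] have "(B * C) *\<^sub>v w \<in> S" using w by simp
      then show "B *\<^sub>v (C *\<^sub>v w) \<in> S" unfolding assoc_mult_mat_vec[OF AB(2) C w] .
      show "C *\<^sub>v w \<in> carrier_vec n" using C w by simp
    qed
    then show "\<forall>(k, \<tau>, C)\<in>F. \<forall>w\<in>carrier_vec k. C *\<^sub>v w \<in> {v \<in> carrier_vec n. B *\<^sub>v v \<in> S}"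
      by blast
  qed
  then have B: "B *\<^sub>v v \<in> S" if "v \<in> carrier_vec n" for v using that by blast
  show "carrier_vec n \<subseteq> S"
  proof
    fix v :: "complex vec" assume v: "v \<in> carrier_vec n"
    have "v = B *\<^sub>v (A *\<^sub>v v)"
      unfolding assoc_mult_mat_vec[OF AB(2,1) v, symmetric] AB(3) using v by simp
    then show "v \<in> S" using B[of "A *\<^sub>v v"] AB(1) v by simp
  qed
qed

lemma semisimple_rep_imp_semisimple:
  assumes "group G" and ss: "semisimple_rep G n \<rho>"
  shows "matrix_rep.semisimple G n \<rho> m"
proof -
  have hom: "\<rho> \<in> hom G (GL n)" using ss by (simp only: semisimple_rep_def)
  interpret matrix_rep G n \<rho> by (intro matrix_rep.intro matrix_rep_axioms.intro assms(1) hom)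
  from ss obtain \<sigma>s where irr: "\<forall>(m, \<sigma>)\<in>set \<sigma>s. 0 < m \<and> irreducible_rep G m \<sigma>"
    and n: "sum_list (map fst \<sigma>s) = n" and conj: "conjugate_reps G n \<rho> (direct_sum_rep \<sigma>s)"
    unfolding semisimple_rep_def by blast
  have irr': "irreducible_rep G k \<sigma>" if "(k, \<sigma>) \<in> set \<sigma>s" for k \<sigma> using irr that by blast
  from spanned_direct_sum[of \<sigma>s G] irr' n obtain F where
    F: "spanned_by_irreducibles G n (direct_sum_rep \<sigma>s) F" by metis
  from conj obtain A where A: "A \<in> carrier (GL n)"
    and eq: "\<And>g. g \<in> carrier G \<Longrightarrow> direct_sum_rep \<sigma>s g = A * \<rho> g * inv\<^bsub>GL n\<^esub> A"
    by (auto simp: conjugate_reps_def conj_rep_def simp del: GL_simps(3))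
  let ?B = "inv\<^bsub>GL n\<^esub> A"
  note B = inv_GL[OF A]
  have Ac: "A \<in> carrier_mat n n" and Bc: "?B \<in> carrier_mat n n"
    using GL_carrier_mat A B(3) by blast+
  have eq': "\<rho> g * ?B = ?B * direct_sum_rep \<sigma>s g" if g: "g \<in> carrier G" for g
  proof -
    note c = Ac Bc rep_carrier[OF g]
    have "?B * direct_sum_rep \<sigma>s g = (?B * A) * (\<rho> g * ?B)"
      unfolding eq[OF g] assoc_mult_mat[OF c(1,3,2)]
      by (rule assoc_mult_mat[symmetric]) (use c in auto)
    then show ?thesis using c B(2) by simp
  qed
  have "spanned_by_irreducibles G n \<rho> ((\<lambda>(k, \<tau>, C). (k, \<tau>, ?B * C)) ` F)"
    by (rule spanned_conjugate[OF F rep_carrier _ Ac Bc B(2) eq'])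
      (use eq Ac Bc rep_carrier in auto)
  then show ?thesis by (rule semisimple_if_spanned)
qed

section \<open>Sesquilinear forms and their matrices\<close>

lemma adjoint_add:
  assumes "(A :: complex mat) \<in> carrier_mat n n" "B \<in> carrier_mat n n"
  shows "mat_adjoint (A + B) = mat_adjoint A + mat_adjoint B"
  unfolding mat_adjoint_eq using assms by (intro eq_matI) auto

lemma adjoint_smult: "mat_adjoint (c \<cdot>\<^sub>m A) = cnj c \<cdot>\<^sub>m mat_adjoint A"
  unfolding mat_adjoint_eq by (intro eq_matI) auto

lemma adjoint_zero: "mat_adjoint (0\<^sub>m n m) = (0\<^sub>m m n :: complex mat)"
  unfolding mat_adjoint_eq by (intro eq_matI) auto

lemma adjoint_adjoint: "mat_adjoint (mat_adjoint A) = (A :: complex mat)"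
  unfolding mat_adjoint_eq by (intro eq_matI) auto

lemma adjoint_cscalar_prod:
  fixes A :: "complex mat"
  assumes A: "A \<in> carrier_mat n n" and v: "v \<in> carrier_vec n" and w: "w \<in> carrier_vec n"
  shows "(A *\<^sub>v v) \<bullet>c w = v \<bullet>c (mat_adjoint A *\<^sub>v w)"
proof -
  have "(A *\<^sub>v v) \<bullet>c w = (\<Sum>i<n. \<Sum>j<n. A $$ (i, j) * v $ j * cnj (w $ i))"
    using assms by (auto simp: scalar_prod_def atLeast0LessThan sum_distrib_right intro!: sum.cong)
  also have "\<dots> = (\<Sum>j<n. \<Sum>i<n. v $ j * cnj (cnj (A $$ (i, j)) * w $ i))"
    by (subst sum.swap) (simp add: mult.commute mult.left_commute)
  also have "\<dots> = v \<bullet>c (mat_adjoint A *\<^sub>v w)"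
    using assms by (auto simp: mat_adjoint_eq scalar_prod_def atLeast0LessThan sum_distrib_left
        intro!: sum.cong)
  finally show ?thesis .
qed

text \<open>An induction principle for vectors: it replaces finite sums of basis vectors, which are awkward
  because vectors of a fixed dimension do not form a type.\<close>

lemma unit_vecs_span:
  fixes v :: "complex vec"
  assumes S0: "0\<^sub>v n \<in> S" and add: "\<And>v w. v \<in> S \<Longrightarrow> w \<in> S \<Longrightarrow> v + w \<in> S"
    and unit: "\<And>c k. k < n \<Longrightarrow> c \<cdot>\<^sub>v unit_vec n k \<in> S" and v: "v \<in> carrier_vec n"
  shows "v \<in> S"
proof -
  have "k \<le> n \<Longrightarrow> vec n (\<lambda>i. if i < k then v $ i else 0) \<in> S" for k
  proof (induction k)
    case 0
    have "vec n (\<lambda>i. if i < 0 then v $ i else 0) = 0\<^sub>v n" by (rule eq_vecI) auto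
    then show ?case by (metis S0)
  next
    case (Suc k)
    have "vec n (\<lambda>i. if i < Suc k then v $ i else 0)
        = vec n (\<lambda>i. if i < k then v $ i else 0) + v $ k \<cdot>\<^sub>v unit_vec n k"
      using Suc.prems by (intro eq_vecI) (auto simp: less_Suc_eq)
    moreover note add[OF Suc.IH[OF Suc_leD[OF Suc.prems]] unit[OF Suc_le_lessD[OF Suc.prems]]]
    ultimately show ?case by (simp only:)
  qed
  from this[OF le_refl] have "vec n (\<lambda>i. if i < n then v $ i else 0) \<in> S" .
  moreover have "vec n (\<lambda>i. if i < n then v $ i else 0) = v" using v by (intro eq_vecI) auto
  ultimately show ?thesis by (simp only:)
qed

lemma linear_functional_vec:
  fixes f :: "complex vec \<Rightarrow> complex"
  assumes add: "\<And>v w. v \<in> carrier_vec n \<Longrightarrow> w \<in> carrier_vec n \<Longrightarrow> f (v + w) = f v + f w"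
    and smult: "\<And>c v. v \<in> carrier_vec n \<Longrightarrow> f (c \<cdot>\<^sub>v v) = c * f v"
    and v: "v \<in> carrier_vec n"
  shows "f v = vec n (\<lambda>k. f (unit_vec n k)) \<bullet> v"
proof -
  let ?u = "vec n (\<lambda>k. f (unit_vec n k))"
  have "v \<in> {v \<in> carrier_vec n. f v = ?u \<bullet> v}"
  proof (rule unit_vecs_span[OF _ _ _ v])
    have "0 \<cdot>\<^sub>v 0\<^sub>v n = (0\<^sub>v n :: complex vec)" by (intro eq_vecI) auto
    then have "f (0\<^sub>v n) = 0" using smult[of "0\<^sub>v n" 0] by simp
    then show "0\<^sub>v n \<in> {v \<in> carrier_vec n. f v = ?u \<bullet> v}" by simp
    show "v + w \<in> {v \<in> carrier_vec n. f v = ?u \<bullet> v}"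
      if "v \<in> {v \<in> carrier_vec n. f v = ?u \<bullet> v}" "w \<in> {v \<in> carrier_vec n. f v = ?u \<bullet> v}" for v w
      using that scalar_prod_add_distrib[of ?u n v w] by (simp add: add)
    show "c \<cdot>\<^sub>v unit_vec n k \<in> {v \<in> carrier_vec n. f v = ?u \<bullet> v}" if "k < n" for c k
      using that smult[of "unit_vec n k" c] by simp
  qed
  then show ?thesis by simp
qed

lemma sesquilinear_form_matrix:
  fixes f :: "complex vec \<Rightarrow> complex vec \<Rightarrow> complex"
  assumes addl: "\<And>u v w. u \<in> carrier_vec n \<Longrightarrow> v \<in> carrier_vec n \<Longrightarrow> w \<in> carrier_vec n \<Longrightarrow>
      f (u + v) w = f u w + f v w"
    and smultl: "\<And>c v w. v \<in> carrier_vec n \<Longrightarrow> w \<in> carrier_vec n \<Longrightarrow> f (c \<cdot>\<^sub>v v) w = cnj c * f v w"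
    and addr: "\<And>u v w. u \<in> carrier_vec n \<Longrightarrow> v \<in> carrier_vec n \<Longrightarrow> w \<in> carrier_vec n \<Longrightarrow>
      f u (v + w) = f u v + f u w"
    and smultr: "\<And>c v w. v \<in> carrier_vec n \<Longrightarrow> w \<in> carrier_vec n \<Longrightarrow> f v (c \<cdot>\<^sub>v w) = c * f v w"
  shows "\<exists>M\<in>carrier_mat n n. \<forall>v\<in>carrier_vec n. \<forall>w\<in>carrier_vec n. f v w = (M *\<^sub>v w) \<bullet>c v"
proof (intro bexI ballI)
  let ?M = "mat n n (\<lambda>(k, l). f (unit_vec n k) (unit_vec n l))"
  show "?M \<in> carrier_mat n n" by simp
  fix v w :: "complex vec" assume v: "v \<in> carrier_vec n" and w: "w \<in> carrier_vec n"
  have row: "f (unit_vec n k) w = (?M *\<^sub>v w) $ k" if k: "k < n" for k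
  proof -
    have "f (unit_vec n k) w = vec n (\<lambda>l. f (unit_vec n k) (unit_vec n l)) \<bullet> w"
      by (rule linear_functional_vec[OF _ _ w]) (use addr smultr in auto)
    also have "vec n (\<lambda>l. f (unit_vec n k) (unit_vec n l)) = row ?M k"
      using k by (intro eq_vecI) auto
    finally show ?thesis using k by simp
  qed
  have "cnj (f v w) = vec n (\<lambda>k. cnj (f (unit_vec n k) w)) \<bullet> v"
    by (rule linear_functional_vec[OF _ _ v, of "\<lambda>v. cnj (f v w)"]) (use addl smultl w in auto)
  also have "\<dots> = conjugate (?M *\<^sub>v w) \<bullet> v"
    using v row by (auto simp: scalar_prod_def intro!: sum.cong)
  finally have "f v w = cnj (conjugate (?M *\<^sub>v w) \<bullet> v)" by (metis complex_cnj_cnj)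
  also have "\<dots> = (?M *\<^sub>v w) \<bullet>c v"
    using v by (auto simp: scalar_prod_def intro!: sum.cong)
  finally show "f v w = (?M *\<^sub>v w) \<bullet>c v" .
qed

lemma mat_eq_by_forms:
  fixes A B :: "complex mat"
  assumes A: "A \<in> carrier_mat n n" and B: "B \<in> carrier_mat n n"
    and eq: "\<And>v w. v \<in> carrier_vec n \<Longrightarrow> w \<in> carrier_vec n \<Longrightarrow> (A *\<^sub>v w) \<bullet>c v = (B *\<^sub>v w) \<bullet>c v"
  shows "A = B"
proof (rule eq_matI)
  fix i j assume "i < dim_row B" "j < dim_col B"
  then have ij: "i < n" "j < n" using B by auto
  have cu: "conjugate (unit_vec n i :: complex vec) = unit_vec n i"
    by (rule eq_vecI) (auto simp: unit_vec_def)
  have entry: "M $$ (i, j) = (M *\<^sub>v unit_vec n j) \<bullet>c unit_vec n i" if M: "M \<in> carrier_mat n n"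
    for M :: "complex mat"
    using M ij unfolding cu by (simp add: scalar_prod_right_unit[of _ n])
  show "A $$ (i, j) = B $$ (i, j)"
    unfolding entry[OF A] entry[OF B] by (rule eq) auto
qed (use A B in auto)

lemma mat_eq_by_vecs:
  fixes A B :: "complex mat"
  assumes A: "A \<in> carrier_mat n n" and B: "B \<in> carrier_mat n n"
    and eq: "\<And>v. v \<in> carrier_vec n \<Longrightarrow> A *\<^sub>v v = B *\<^sub>v v"
  shows "A = B"
  by (rule mat_eq_by_forms[OF A B]) (simp add: eq)

lemma mult_square [simp]:
  "A \<in> carrier_mat n n \<Longrightarrow> B \<in> carrier_mat n n \<Longrightarrow> A * B \<in> carrier_mat n n"
  by (rule mult_carrier_mat)

section \<open>Invariant Hermitian forms and their kernels\<close>

context matrix_rep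
begin

definition invariant_form :: "complex mat \<Rightarrow> bool" where
  "invariant_form P \<longleftrightarrow> P \<in> carrier_mat n n \<and>
     (\<forall>g\<in>carrier G. mat_adjoint (\<rho> g) * P * \<rho> g = P)"

definition equivariant_idempotent :: "complex mat \<Rightarrow> bool" where
  "equivariant_idempotent E \<longleftrightarrow> E \<in> carrier_mat n n \<and> E * E = E \<and>
     (\<forall>g\<in>carrier G. \<rho> g * E = E * \<rho> g)"

text \<open>An invariant form intertwines \<open>\<rho>\<close> with \<open>g \<mapsto> (\<rho>(g)\<^sup>*)\<inverse>\<close>.\<close>

lemma invariant_form_shift:
  assumes P: "invariant_form P" and g: "g \<in> carrier G"
  shows "P * \<rho> (inv g) = mat_adjoint (\<rho> g) * P"
proof -
  note c = rep_carrier[OF g] rep_carrier[OF inv_closed[OF g]] mat_adjoint_carrier[OF rep_carrier[OF g]]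
  have Pc: "P \<in> carrier_mat n n" and eq: "mat_adjoint (\<rho> g) * P * \<rho> g = P"
    using P g by (auto simp: invariant_form_def)
  have "P * \<rho> (inv g) = (mat_adjoint (\<rho> g) * P * \<rho> g) * \<rho> (inv g)" using eq by simp
  also have "\<dots> = (mat_adjoint (\<rho> g) * P) * (\<rho> g * \<rho> (inv g))"
    by (rule assoc_mult_mat[of _ n n _ n _ n]) (use c Pc in auto)
  also have "\<dots> = mat_adjoint (\<rho> g) * P"
    unfolding rep_inv(2)[OF g] by (rule right_mult_one_mat[of _ n n]) (use c Pc in auto)
  finally show ?thesis .
qed

text \<open>The kernel of an invariant form is stable, and a projection onto it is applied to vectors seen as
  matrices with one column.\<close>

lemma idempotent_onto_kernel:
  assumes ss: "semisimple 1" and P: "invariant_form P"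
  obtains E where "equivariant_idempotent E" "P * E = 0\<^sub>m n n"
    "\<And>v. v \<in> carrier_vec n \<Longrightarrow> P *\<^sub>v v = 0\<^sub>v n \<Longrightarrow> E *\<^sub>v v = v"
proof -
  have Pc: "P \<in> carrier_mat n n" using P by (simp add: invariant_form_def)
  let ?U = "{X \<in> carrier_mat n 1. P * X = 0\<^sub>m n 1}"
  have U: "stable 1 ?U"
    unfolding stable_def lin_sub_def
  proof (intro conjI ballI allI)
    show "0\<^sub>m n 1 \<in> ?U" using Pc by (simp add: right_mult_zero_mat[of P n n])
    fix X assume X: "X \<in> ?U"
    show "X + Y \<in> ?U" if "Y \<in> ?U" for Y
      using X that Pc mult_add_distrib_mat[of P n n X 1 Y] by simp
    show "c \<cdot>\<^sub>m X \<in> ?U" for c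
      using X Pc mult_smult_distrib[of P n n X 1 c] by simp
    fix g assume g: "g \<in> carrier G"
    have "P * \<rho> g = mat_adjoint (\<rho> (inv g)) * P"
      using invariant_form_shift[OF P inv_closed[OF g]] g by simp
    moreover have Xc: "X \<in> carrier_mat n 1" using X by blast
    ultimately have "P * (\<rho> g * X) = mat_adjoint (\<rho> (inv g)) * (P * X)"
      using assoc_mult_mat[OF Pc rep_carrier[OF g] Xc]
        assoc_mult_mat[OF mat_adjoint_carrier[OF rep_carrier[OF inv_closed[OF g]]] Pc Xc] by simp
    also have "\<dots> = 0\<^sub>m n 1"
      using X right_mult_zero_mat[OF mat_adjoint_carrier[OF rep_carrier[OF inv_closed[OF g]]]] by simp
    finally show "\<rho> g * X \<in> ?U" using X rep_carrier[OF g] by simp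
  qed blast
  obtain F where F: "\<And>X. X \<in> carrier_mat n 1 \<Longrightarrow> F X \<in> ?U" "\<And>X. X \<in> ?U \<Longrightarrow> F X = X"
    "\<And>X Y. X \<in> carrier_mat n 1 \<Longrightarrow> Y \<in> carrier_mat n 1 \<Longrightarrow> F (X + Y) = F X + F Y"
    "\<And>c X. X \<in> carrier_mat n 1 \<Longrightarrow> F (c \<cdot>\<^sub>m X) = c \<cdot>\<^sub>m F X"
    "\<And>g X. g \<in> carrier G \<Longrightarrow> X \<in> carrier_mat n 1 \<Longrightarrow> F (\<rho> g * X) = \<rho> g * F X"
    by (rule equivariant_projection[OF ss U], rule that, assumption+)
  have Fc: "F X \<in> carrier_mat n 1" if "X \<in> carrier_mat n 1" for X using F(1)[OF that] by simp
  let ?p = "in_column 1 0"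
  have pcol: "?p (col X 0) = X" if "X \<in> carrier_mat n 1" for X
    using that by (intro eq_matI) (auto simp: in_column_def)
  have colp: "col (?p v) 0 = v" for v
    by (intro eq_vecI) (auto simp: in_column_def)
  let ?E = "mat n n (\<lambda>(i, k). F (?p (unit_vec n k)) $$ (i, 0))"
  have E: "F (?p v) = ?p (?E *\<^sub>v v)" if v: "v \<in> carrier_vec n" for v
  proof -
    have "F (?p v) $$ (i, 0) = (?E *\<^sub>v v) $ i" if i: "i < n" for i
    proof -
      have "F (?p v) $$ (i, 0) = vec n (\<lambda>k. F (?p (unit_vec n k)) $$ (i, 0)) \<bullet> v"
      proof (rule linear_functional_vec[OF _ _ v, of "\<lambda>v. F (?p v) $$ (i, 0)"])
        fix x y :: "complex vec" assume xy: "x \<in> carrier_vec n" "y \<in> carrier_vec n"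
        have "F (?p (x + y)) = F (?p x) + F (?p y)"
          unfolding in_column_add[OF xy] by (rule F(3)) (use xy in auto)
        then show "F (?p (x + y)) $$ (i, 0) = F (?p x) $$ (i, 0) + F (?p y) $$ (i, 0)"
          using Fc[OF in_column_carrier[OF xy(2), of 1 0]] i by simp
      next
        fix c and x :: "complex vec" assume x: "x \<in> carrier_vec n"
        have "F (?p (c \<cdot>\<^sub>v x)) = c \<cdot>\<^sub>m F (?p x)"
          unfolding in_column_smult[OF x] by (rule F(4)) (use x in auto)
        then show "F (?p (c \<cdot>\<^sub>v x)) $$ (i, 0) = c * F (?p x) $$ (i, 0)"
          using Fc[OF in_column_carrier[OF x, of 1 0]] i by simp
      qed
      also have "vec n (\<lambda>k. F (?p (unit_vec n k)) $$ (i, 0)) = row ?E i"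
        using i by (intro eq_vecI) auto
      finally show ?thesis using i by simp
    qed
    note entry = this
    have "F (?p v) \<in> carrier_mat n 1" by (rule Fc[OF in_column_carrier[OF v]])
    then show ?thesis
      using entry by (intro eq_matI) (auto simp: in_column_def)
  qed
  have Ec: "?E \<in> carrier_mat n n" by simp
  have Ev: "?E *\<^sub>v v = col (F (?p v)) 0" if "v \<in> carrier_vec n" for v
    unfolding E[OF that] colp ..
  have fix_kernel: "?E *\<^sub>v v = v" if v: "v \<in> carrier_vec n" and Pv: "P *\<^sub>v v = 0\<^sub>v n" for v
  proof -
    have "P * ?p v = 0\<^sub>m n 1"
      unfolding mult_in_column[OF Pc v] Pv by (rule in_column_zero)
    then have "F (?p v) = ?p v" using v by (intro F(2)) simp
    then show ?thesis unfolding Ev[OF v] by (simp only: colp)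
  qed
  have PE: "P *\<^sub>v (?E *\<^sub>v v) = 0\<^sub>v n" if v: "v \<in> carrier_vec n" for v
  proof -
    have "P * F (?p v) = 0\<^sub>m n 1" using F(1)[OF in_column_carrier[OF v]] by simp
    then have "?p (P *\<^sub>v (?E *\<^sub>v v)) = 0\<^sub>m n 1"
      unfolding E[OF v] by (subst (asm) mult_in_column[OF Pc mult_mat_vec_carrier[OF Ec v]])
    then have "col (?p (P *\<^sub>v (?E *\<^sub>v v))) 0 = col (0\<^sub>m n 1) 0" by simp
    then show ?thesis unfolding colp by simp
  qed
  show thesis
  proof
    show "equivariant_idempotent ?E"
      unfolding equivariant_idempotent_def
    proof (intro conjI ballI Ec)
      show "?E * ?E = ?E"
      proof (rule mat_eq_by_vecs[of _ n])
        fix v :: "complex vec" assume v: "v \<in> carrier_vec n"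
        show "(?E * ?E) *\<^sub>v v = ?E *\<^sub>v v"
          unfolding assoc_mult_mat_vec[OF Ec Ec v]
          by (rule fix_kernel[OF mult_mat_vec_carrier[OF Ec v] PE[OF v]])
      qed auto
      fix g assume g: "g \<in> carrier G"
      note r = rep_carrier[OF g]
      show "\<rho> g * ?E = ?E * \<rho> g"
      proof (rule mat_eq_by_vecs[of _ n])
        fix v :: "complex vec" assume v: "v \<in> carrier_vec n"
        note rv = mult_mat_vec_carrier[OF r v] and Evc = mult_mat_vec_carrier[OF Ec v]
        have "?p (?E *\<^sub>v (\<rho> g *\<^sub>v v)) = \<rho> g * F (?p v)"
          unfolding E[OF rv, symmetric] mult_in_column[OF r v, symmetric]
          by (rule F(5)[OF g]) (use v in simp)
        also have "\<dots> = ?p (\<rho> g *\<^sub>v (?E *\<^sub>v v))"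
          unfolding E[OF v] by (rule mult_in_column[OF r Evc])
        finally have "?E *\<^sub>v (\<rho> g *\<^sub>v v) = \<rho> g *\<^sub>v (?E *\<^sub>v v)" by (metis colp)
        then show "(\<rho> g * ?E) *\<^sub>v v = (?E * \<rho> g) *\<^sub>v v"
          unfolding assoc_mult_mat_vec[OF Ec r v] assoc_mult_mat_vec[OF r Ec v] ..
      qed (use r Ec in auto)
    qed
    show "P * ?E = 0\<^sub>m n n"
    proof (rule mat_eq_by_vecs[of _ n])
      fix v :: "complex vec" assume v: "v \<in> carrier_vec n"
      have "0\<^sub>m n n *\<^sub>v v = 0\<^sub>v n" using v by (intro eq_vecI) auto
      then show "(P * ?E) *\<^sub>v v = 0\<^sub>m n n *\<^sub>v v"
        unfolding assoc_mult_mat_vec[OF Pc Ec v] PE[OF v] by simp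
    qed (use Pc in auto)
  qed (fact fix_kernel)
qed

text \<open>Here \<open>E\<close> projects onto the kernel of \<open>P\<close>, and \<open>g \<mapsto> trace (E * \<rho> g)\<close> is the character of the kernel.
  On the complement \<open>P\<close> is nondegenerate and identifies it with its conjugate dual, so the character of
  the complement has the symmetry in question; as the full character has it, so has the difference.

  The identification is made explicit by the matrix \<open>S = P + E\<^sup>* E\<close>, which is invertible: as
  \<open>E\<^sup>* S = E\<^sup>* E\<close>, the equation \<open>S v = 0\<close> forces \<open>E v = 0\<close> and \<open>P v = 0\<close>, so \<open>v = E v = 0\<close>. It
  satisfies
  \<open>S (1 - E) = P = (1 - E)\<^sup>* S\<close>.\<close>

lemma trace_idempotent_inv:
  assumes P: "invariant_form P" and herm: "mat_adjoint P = P" and E: "equivariant_idempotent E"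
    and PE: "P * E = 0\<^sub>m n n"
    and ker: "\<And>v. v \<in> carrier_vec n \<Longrightarrow> P *\<^sub>v v = 0\<^sub>v n \<Longrightarrow> E *\<^sub>v v = v"
    and tr: "\<And>g. g \<in> carrier G \<Longrightarrow> trace (\<rho> (inv g)) = cnj (trace (\<rho> g))"
    and g: "g \<in> carrier G"
  shows "trace (E * \<rho> (inv g)) = cnj (trace (E * \<rho> g))"
proof -
  have Pc: "P \<in> carrier_mat n n" using P by (simp add: invariant_form_def)
  have Ec: "E \<in> carrier_mat n n" and EE: "E * E = E"
    using E by (simp_all add: equivariant_idempotent_def)
  let ?A = "mat_adjoint E"
  have Ac: "?A \<in> carrier_mat n n" using Ec by simp
  have AP: "?A * P = 0\<^sub>m n n"
    using arg_cong[OF PE, of mat_adjoint] unfolding mat_adjoint_mult[OF Pc Ec] herm adjoint_zero .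
  have AA: "?A * ?A = ?A" using mat_adjoint_mult[OF Ec Ec] EE by simp
  let ?S = "P + ?A * E"
  have AEc: "?A * E \<in> carrier_mat n n" using Ac Ec by simp
  have Sc: "?S \<in> carrier_mat n n" using Pc AEc by simp
  have AS: "?A * ?S = ?A * E"
  proof -
    have "?A * ?S = ?A * P + ?A * (?A * E)" by (rule mult_add_distrib_mat[OF Ac Pc AEc])
    also have "?A * (?A * E) = ?A * E" unfolding assoc_mult_mat[OF Ac Ac Ec, symmetric] AA ..
    finally show ?thesis unfolding AP using AEc by simp
  qed
  have SE: "?S * E = ?A * E"
  proof -
    have "?S * E = P * E + ?A * E * E" by (rule add_mult_distrib_mat[OF Pc AEc Ec])
    also have "?A * E * E = ?A * E" unfolding assoc_mult_mat[OF Ac Ec Ec] EE ..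
    finally show ?thesis unfolding PE using AEc by simp
  qed
  have inj: "v = 0\<^sub>v n" if v: "v \<in> carrier_vec n" and Sv: "?S *\<^sub>v v = 0\<^sub>v n" for v
  proof -
    have "(?A * E) *\<^sub>v v = ?A *\<^sub>v (?S *\<^sub>v v)"
      unfolding assoc_mult_mat_vec[OF Ac Sc v, symmetric] AS ..
    also have "\<dots> = 0\<^sub>v n" unfolding Sv using Ac by (intro eq_vecI) auto
    finally have 0: "(?A * E) *\<^sub>v v = 0\<^sub>v n" .
    then have 1: "?A *\<^sub>v (E *\<^sub>v v) = 0\<^sub>v n" unfolding assoc_mult_mat_vec[OF Ac Ec v] .
    have Evc: "E *\<^sub>v v \<in> carrier_vec n" using Ec v by simp
    have "P *\<^sub>v v = ?S *\<^sub>v v"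
      unfolding add_mult_distrib_mat_vec[OF Pc AEc v] 0 using Pc v by simp
    then have "E *\<^sub>v v = v" using ker[OF v] Sv by simp
    moreover have "(E *\<^sub>v v) \<bullet>c (E *\<^sub>v v) = 0"
      unfolding adjoint_cscalar_prod[OF Ec v Evc] 1 using v by simp
    then have "E *\<^sub>v v = 0\<^sub>v n" using conjugate_square_eq_0_vec[OF Evc] by simp
    ultimately show ?thesis by simp
  qed
  have "det ?S \<noteq> 0" using inj det_0_iff_vec_prod_zero[OF Sc] by blast
  from det_non_zero_imp_unit[OF Sc this, of "()"] obtain R where
    R: "R \<in> carrier_mat n n" and RS: "R * ?S = 1\<^sub>m n" and SR: "?S * R = 1\<^sub>m n"
    unfolding Units_def ring_mat_def by auto
  let ?Q = "1\<^sub>m n - E"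
  have Qc: "?Q \<in> carrier_mat n n" by (rule minus_carrier_mat[OF Ec])
  let ?B = "1\<^sub>m n - ?A"
  have Bc: "?B \<in> carrier_mat n n" by (rule minus_carrier_mat[OF Ac])
  have cancel: "P + X - X = P" if "X \<in> carrier_mat n n" for X
    using Pc that by (intro eq_matI) auto
  have SQ: "?S * ?Q = P"
  proof -
    have "?S * ?Q = ?S * 1\<^sub>m n - ?S * E" by (rule mult_minus_distrib_mat[OF Sc _ Ec]) simp
    then show ?thesis unfolding SE right_mult_one_mat[OF Sc] cancel[OF AEc] .
  qed
  have BS: "?B * ?S = P"
  proof -
    have "?B * ?S = 1\<^sub>m n * ?S - ?A * ?S" by (rule minus_mult_distrib_mat[OF _ Ac Sc]) simp
    then show ?thesis unfolding AS left_mult_one_mat[OF Sc] cancel[OF AEc] .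
  qed
  note r = rep_carrier[OF g] and ri = rep_carrier[OF inv_closed[OF g]]
  note rA = mat_adjoint_carrier[OF r]
  have "R * (?S * ?Q) = ?Q"
    unfolding assoc_mult_mat[OF R Sc Qc, symmetric] RS by (rule left_mult_one_mat[OF Qc])
  then have "R * P = ?Q" unfolding SQ .
  then have "?Q * \<rho> (inv g) = R * (P * \<rho> (inv g))"
    using assoc_mult_mat[OF R Pc ri] by simp
  also have "\<dots> = R * (mat_adjoint (\<rho> g) * (?B * ?S))"
    unfolding invariant_form_shift[OF P g] BS ..
  finally have "trace (?Q * \<rho> (inv g)) = trace (R * (mat_adjoint (\<rho> g) * (?B * ?S)))" by simp
  also have "\<dots> = trace ((mat_adjoint (\<rho> g) * (?B * ?S)) * R)"
    by (rule trace_comm[of _ n n]) (use R rA Bc Sc in auto)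
  also have "(mat_adjoint (\<rho> g) * (?B * ?S)) * R = mat_adjoint (\<rho> g) * ?B"
    using R rA Bc Sc SR right_mult_one_mat[OF Bc] by (simp add: assoc_mult_mat[of _ n n _ n _ n])
  also have "mat_adjoint (\<rho> g) * ?B = mat_adjoint (?Q * \<rho> g)"
  proof -
    have "mat_adjoint ?Q = ?B" unfolding mat_adjoint_eq using Ec by (intro eq_matI) auto
    then show ?thesis using mat_adjoint_mult[OF Qc r] by simp
  qed
  also have "trace \<dots> = cnj (trace (?Q * \<rho> g))" by (rule trace_adjoint[OF mult_square[OF Qc r]])
  finally have Q: "trace (?Q * \<rho> (inv g)) = cnj (trace (?Q * \<rho> g))" .
  have split: "trace X = trace (?Q * X) + trace (E * X)" if X: "X \<in> carrier_mat n n" for X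
  proof -
    have "?Q * X + E * X = (?Q + E) * X" by (rule add_mult_distrib_mat[OF Qc Ec X, symmetric])
    also have "?Q + E = 1\<^sub>m n" using Ec by (intro eq_matI) auto
    finally have "X = ?Q * X + E * X" using X by simp
    then show ?thesis using trace_add[of "?Q * X" n "E * X"] Qc Ec X by simp
  qed
  show ?thesis using split[OF r] split[OF ri] Q tr[OF g] by simp
qed

end

section \<open>An invariant form from the character\<close>

lemma trace_zero [simp]: "trace (0\<^sub>m n n) = 0"
  by (simp add: trace_def)

context matrix_rep
begin

text \<open>The span of the pairs \<open>(E \<rho>(g), \<rho>(g)\<inverse> E)\<close>, conjugate linear in the second component. It would be the
  graph of the antilinear involution \<open>\<rho>(g) \<mapsto> \<rho>(g)\<inverse>\<close> on the algebra spanned by the representation (on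
  the summand cut out by \<open>E\<close>), were that map known to be well defined. A relation avoids this
  question.\<close>

inductive_set adjoint_graph :: "complex mat \<Rightarrow> (complex mat \<times> complex mat) set" for E where
  zero: "(0\<^sub>m n n, 0\<^sub>m n n) \<in> adjoint_graph E"
| add: "(X, Y) \<in> adjoint_graph E \<Longrightarrow> (X', Y') \<in> adjoint_graph E \<Longrightarrow> (X + X', Y + Y') \<in> adjoint_graph E"
| smult: "(X, Y) \<in> adjoint_graph E \<Longrightarrow> (c \<cdot>\<^sub>m X, cnj c \<cdot>\<^sub>m Y) \<in> adjoint_graph E"
| gen: "g \<in> carrier G \<Longrightarrow> (E * \<rho> g, \<rho> (inv g) * E) \<in> adjoint_graph E"

lemma adjoint_graph_carrier:
  assumes "E \<in> carrier_mat n n" "(X, Y) \<in> adjoint_graph E"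
  shows "X \<in> carrier_mat n n \<and> Y \<in> carrier_mat n n"
  using assms(2) by induction (use assms(1) rep_carrier in auto)

lemma adjoint_graph_left_mult:
  assumes E: "equivariant_idempotent E" and g: "g \<in> carrier G" and XY: "(X, Y) \<in> adjoint_graph E"
  shows "(\<rho> g * X, Y * \<rho> (inv g)) \<in> adjoint_graph E"
  using XY
proof induction
  have Ec: "E \<in> carrier_mat n n" using E by (simp add: equivariant_idempotent_def)
  note r = rep_carrier[OF g] and ri = rep_carrier[OF inv_closed[OF g]]
  {
    case zero
    then show ?case
      using adjoint_graph.zero left_mult_zero_mat[OF ri] right_mult_zero_mat[OF r] by simp
  next
    case (add X Y X' Y')
    then show ?case
      using adjoint_graph_carrier[OF Ec add(1)] adjoint_graph_carrier[OF Ec add(2)] adjoint_graph.add[OF add(3,4)]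
        mult_add_distrib_mat[OF r, of X n X'] add_mult_distrib_mat[OF _ _ ri, of Y n Y'] by simp
  next
    case (smult X Y c)
    then show ?case
      using adjoint_graph_carrier[OF Ec smult(1)] adjoint_graph.smult[OF smult(2), of c]
        mult_smult_distrib[OF r, of X n c] mult_smult_assoc_mat[OF _ ri, of Y n "cnj c"] by simp
  next
    case (gen h)
    note s = rep_carrier[OF gen] and si = rep_carrier[OF inv_closed[OF gen]]
    have comm: "\<rho> k * E = E * \<rho> k" if "k \<in> carrier G" for k
      using E that by (simp add: equivariant_idempotent_def)
    have "\<rho> g * (E * \<rho> h) = E * \<rho> (g \<otimes> h)"
      unfolding rep_mult[OF g gen] assoc_mult_mat[OF r Ec s, symmetric] comm[OF g]
      by (rule assoc_mult_mat[OF Ec r s])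
    moreover have "\<rho> (inv h) * E * \<rho> (inv g) = \<rho> (inv (g \<otimes> h)) * E"
      unfolding inv_mult_group[OF g gen] rep_mult[OF inv_closed[OF gen] inv_closed[OF g]]
        assoc_mult_mat[OF si Ec ri] comm[OF inv_closed[OF g], symmetric]
      by (rule assoc_mult_mat[OF si ri Ec, symmetric])
    ultimately show ?case using adjoint_graph.gen[of "g \<otimes> h" E] g gen by simp
  }
qed

text \<open>The symmetry of the character extends from group elements to their span. It implies that
  \<open>trace (Y * X')\<close> depends on \<open>Y\<close> only through \<open>X\<close>, so it is a well-defined pairing of \<open>X\<close> with \<open>X'\<close>.\<close>

lemma adjoint_graph_trace_symmetric:
  assumes E: "equivariant_idempotent E"
    and sym: "\<And>g. g \<in> carrier G \<Longrightarrow> trace (E * \<rho> (inv g)) = cnj (trace (E * \<rho> g))"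
    and XY: "(X, Y) \<in> adjoint_graph E" and XY': "(X', Y') \<in> adjoint_graph E"
  shows "trace (Y * X') = cnj (trace (Y' * X))"
proof -
  have Ec: "E \<in> carrier_mat n n" and EE: "E * E = E"
    using E by (simp_all add: equivariant_idempotent_def)
  note gc = adjoint_graph_carrier[OF Ec]
  have gens: "trace (\<rho> (inv g) * E * (E * \<rho> h)) = cnj (trace (\<rho> (inv h) * E * (E * \<rho> g)))"
    if g: "g \<in> carrier G" and h: "h \<in> carrier G" for g h
  proof -
    have *: "trace (\<rho> (inv a) * E * (E * \<rho> b)) = trace (E * \<rho> (b \<otimes> inv a))"
      if a: "a \<in> carrier G" and b: "b \<in> carrier G" for a b
    proof -
      note r = rep_carrier[OF inv_closed[OF a]] and s = rep_carrier[OF b]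
      have "trace (\<rho> (inv a) * E * (E * \<rho> b)) = trace (E * \<rho> b * (\<rho> (inv a) * E))"
        by (rule trace_comm[of _ n n]) (use r s Ec in auto)
      also have "\<dots> = trace (E * (\<rho> b * \<rho> (inv a) * E))"
        using r s Ec by (simp add: assoc_mult_mat[of _ n n _ n _ n])
      also have "\<dots> = trace (\<rho> b * \<rho> (inv a) * E * E)"
        by (rule trace_comm[of _ n n]) (use r s Ec in auto)
      also have "\<rho> b * \<rho> (inv a) * E * E = \<rho> (b \<otimes> inv a) * E"
        unfolding rep_mult[OF b inv_closed[OF a]] using EE r s Ec
        by (simp add: assoc_mult_mat[of _ n n _ n _ n])
      also have "trace \<dots> = trace (E * \<rho> (b \<otimes> inv a))"
        by (rule trace_comm[of _ n n]) (use rep_carrier a b Ec in auto)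
      finally show ?thesis .
    qed
    have "inv (g \<otimes> inv h) = h \<otimes> inv g" using g h by (simp add: inv_mult_group)
    then show ?thesis unfolding *[OF g h] *[OF h g] using sym[of "g \<otimes> inv h"] g h by simp
  qed
  have base: "trace (\<rho> (inv g) * E * X') = cnj (trace (Y' * (E * \<rho> g)))"
    if g: "g \<in> carrier G" for g
    using XY'
  proof induction
    note c = mult_square[OF rep_carrier[OF inv_closed[OF g]] Ec] mult_square[OF Ec rep_carrier[OF g]]
    {
      case zero
      then show ?case using right_mult_zero_mat[OF c(1)] left_mult_zero_mat[OF c(2)] by simp
    next
      case (add X Y X' Y')
      have cs: "X \<in> carrier_mat n n" "X' \<in> carrier_mat n n" "Y \<in> carrier_mat n n" "Y' \<in> carrier_mat n n"
        using gc add(1,2) by blast+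
      show ?case
        unfolding mult_add_distrib_mat[OF c(1) cs(1,2)] add_mult_distrib_mat[OF cs(3,4) c(2)]
        using add(3,4) cs c by (simp add: trace_add[of _ n])
    next
      case (smult X Y c')
      have cs: "X \<in> carrier_mat n n" "Y \<in> carrier_mat n n" using gc smult(1) by blast+
      show ?case
        unfolding mult_smult_distrib[OF c(1) cs(1)] mult_smult_assoc_mat[OF cs(2) c(2)]
        using smult(2) cs c by (simp add: trace_smult[of _ n])
    next
      case (gen h)
      then show ?case using gens[OF g] by simp
    }
  qed
  show ?thesis using XY
  proof induction
    have c: "X' \<in> carrier_mat n n" "Y' \<in> carrier_mat n n" using gc[OF XY'] by blast+
    {
      case zero
      then show ?case using left_mult_zero_mat[OF c(1)] right_mult_zero_mat[OF c(2)] by simp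
    next
      case (add X1 Y1 X2 Y2)
      have cs: "X1 \<in> carrier_mat n n" "X2 \<in> carrier_mat n n" "Y1 \<in> carrier_mat n n" "Y2 \<in> carrier_mat n n"
        using gc add(1,2) by blast+
      show ?case
        unfolding add_mult_distrib_mat[OF cs(3,4) c(1)] mult_add_distrib_mat[OF c(2) cs(1,2)]
        using add(3,4) cs c by (simp add: trace_add[of _ n])
    next
      case (smult X Y c')
      have cs: "X \<in> carrier_mat n n" "Y \<in> carrier_mat n n" using gc smult(1) by blast+
      show ?case
        unfolding mult_smult_distrib[OF c(2) cs(1)] mult_smult_assoc_mat[OF cs(2) c(1)]
        using smult(2) cs c by (simp add: trace_smult[of _ n])
    next
      case (gen h)
      then show ?case using base by simp
    }
  qed
qed

lemma adjoint_graph_stable: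
  assumes E: "equivariant_idempotent E"
  shows "stable n (fst ` adjoint_graph E)"
  unfolding stable_def lin_sub_def
proof (intro conjI ballI allI)
  have Ec: "E \<in> carrier_mat n n" using E by (simp add: equivariant_idempotent_def)
  show "fst ` adjoint_graph E \<subseteq> carrier_mat n n" using adjoint_graph_carrier[OF Ec] by auto
  show "0\<^sub>m n n \<in> fst ` adjoint_graph E" using adjoint_graph.zero by force
  fix X assume "X \<in> fst ` adjoint_graph E"
  then obtain Y where XY: "(X, Y) \<in> adjoint_graph E" by auto
  show "c \<cdot>\<^sub>m X \<in> fst ` adjoint_graph E" for c using imageI[OF adjoint_graph.smult[OF XY], of fst] by simp
  show "\<rho> g * X \<in> fst ` adjoint_graph E" if "g \<in> carrier G" for g
    using imageI[OF adjoint_graph_left_mult[OF E that XY], of fst] by simp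
  fix X' assume "X' \<in> fst ` adjoint_graph E"
  then obtain Y' where "(X', Y') \<in> adjoint_graph E" by auto
  from imageI[OF adjoint_graph.add[OF XY this], of fst] show "X + X' \<in> fst ` adjoint_graph E" by simp
qed

text \<open>On the span \<open>A\<close> of the matrices \<open>E \<rho>(g)\<close> there is a Hermitian form with
  \<open>\<langle>E \<rho>(g), E \<rho>(h)\<rangle> = trace (E \<rho>(g\<inverse> h))\<close>; it is invariant under left multiplication. Composing with an
  equivariant projection of the space of all matrices onto \<open>A\<close> extends it to that space, which as a
  representation is a sum of \<open>n\<close> copies of \<open>\<rho>\<close>.\<close>

lemma trace_form_on_matrices:
  assumes ss: "semisimple n" and E: "equivariant_idempotent E"
    and sym: "\<And>g. g \<in> carrier G \<Longrightarrow> trace (E * \<rho> (inv g)) = cnj (trace (E * \<rho> g))"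
  obtains T where
    "\<And>X Y Z. X \<in> carrier_mat n n \<Longrightarrow> Y \<in> carrier_mat n n \<Longrightarrow> Z \<in> carrier_mat n n \<Longrightarrow>
      T X (Y + Z) = T X Y + T X Z"
    "\<And>X Y c. X \<in> carrier_mat n n \<Longrightarrow> Y \<in> carrier_mat n n \<Longrightarrow> T X (c \<cdot>\<^sub>m Y) = c * T X Y"
    "\<And>X Y. X \<in> carrier_mat n n \<Longrightarrow> Y \<in> carrier_mat n n \<Longrightarrow> T Y X = cnj (T X Y)"
    "\<And>X Y g. X \<in> carrier_mat n n \<Longrightarrow> Y \<in> carrier_mat n n \<Longrightarrow> g \<in> carrier G \<Longrightarrow>
      T (\<rho> g * X) (\<rho> g * Y) = T X Y"
    "T E E = trace E"
proof -
  have Ec: "E \<in> carrier_mat n n" and EE: "E * E = E"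
    using E by (simp_all add: equivariant_idempotent_def)
  note gc = adjoint_graph_carrier[OF Ec]
  let ?A = "fst ` adjoint_graph E"
  obtain F where F: "\<And>X. X \<in> carrier_mat n n \<Longrightarrow> F X \<in> ?A" "\<And>X. X \<in> ?A \<Longrightarrow> F X = X"
    "\<And>X Y. X \<in> carrier_mat n n \<Longrightarrow> Y \<in> carrier_mat n n \<Longrightarrow> F (X + Y) = F X + F Y"
    "\<And>c X. X \<in> carrier_mat n n \<Longrightarrow> F (c \<cdot>\<^sub>m X) = c \<cdot>\<^sub>m F X"
    "\<And>g X. g \<in> carrier G \<Longrightarrow> X \<in> carrier_mat n n \<Longrightarrow> F (\<rho> g * X) = \<rho> g * F X"
    by (rule equivariant_projection[OF ss adjoint_graph_stable[OF E]], rule that, assumption+)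
  define partner where "partner X = (SOME Y. (F X, Y) \<in> adjoint_graph E)" for X
  have partner: "(F X, partner X) \<in> adjoint_graph E" if "X \<in> carrier_mat n n" for X
  proof -
    have "\<exists>Y. (F X, Y) \<in> adjoint_graph E" using F(1)[OF that] by auto
    then show ?thesis unfolding partner_def by (rule someI_ex)
  qed
  \<comment> \<open>\<open>F\<close> projects onto the span of the first components; \<open>partner X\<close> stands for the image of \<open>F X\<close> under
    the antilinear involution.\<close>
  define T where "T X Y = trace (partner X * F Y)" for X Y
  have T_any: "T X Y = trace (Z * F Y)"
    if "X \<in> carrier_mat n n" "Y \<in> carrier_mat n n" "(F X, Z) \<in> adjoint_graph E" for X Y Z
    unfolding T_def
    by (rule trans[OF adjoint_graph_trace_symmetric[OF E sym partner[OF that(1)] partner[OF that(2)]]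
          adjoint_graph_trace_symmetric[OF E sym that(3) partner[OF that(2)], symmetric]])
  have Fc: "F X \<in> carrier_mat n n" "partner X \<in> carrier_mat n n" if "X \<in> carrier_mat n n" for X
    using gc[OF partner[OF that]] by auto
  have EG: "(E, E) \<in> adjoint_graph E"
    using adjoint_graph.gen[OF one_closed, of E] rep_one Ec by simp
  show thesis
  proof
    fix X Y Z :: "complex mat"
    assume X: "X \<in> carrier_mat n n" and Y: "Y \<in> carrier_mat n n" and Z: "Z \<in> carrier_mat n n"
    note px = Fc(2)[OF X] and fy = Fc(1)[OF Y] and fz = Fc(1)[OF Z]
    show "T X (Y + Z) = T X Y + T X Z"
      unfolding T_def F(3)[OF Y Z] mult_add_distrib_mat[OF px fy fz]
      by (rule trace_add[OF mult_square[OF px fy] mult_square[OF px fz]])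
  next
    fix X Y :: "complex mat" and c
    assume X: "X \<in> carrier_mat n n" and Y: "Y \<in> carrier_mat n n"
    note px = Fc(2)[OF X] and fy = Fc(1)[OF Y]
    show "T X (c \<cdot>\<^sub>m Y) = c * T X Y"
      unfolding T_def F(4)[OF Y] mult_smult_distrib[OF px fy]
      by (rule trace_smult[OF mult_square[OF px fy]])
  next
    fix X Y :: "complex mat"
    assume X: "X \<in> carrier_mat n n" and Y: "Y \<in> carrier_mat n n"
    show "T Y X = cnj (T X Y)"
      unfolding T_def by (rule adjoint_graph_trace_symmetric[OF E sym partner[OF Y] partner[OF X]])
  next
    fix X Y :: "complex mat" and g
    assume X: "X \<in> carrier_mat n n" and Y: "Y \<in> carrier_mat n n" and g: "g \<in> carrier G"
    note r = rep_carrier[OF g] and ri = rep_carrier[OF inv_closed[OF g]]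
    have "(F (\<rho> g * X), partner X * \<rho> (inv g)) \<in> adjoint_graph E"
      unfolding F(5)[OF g X] by (rule adjoint_graph_left_mult[OF E g partner[OF X]])
    from T_any[OF mult_square[OF r X] mult_square[OF r Y] this]
    have "T (\<rho> g * X) (\<rho> g * Y) = trace (partner X * \<rho> (inv g) * (\<rho> g * F Y))"
      unfolding F(5)[OF g Y] .
    also have "partner X * \<rho> (inv g) * (\<rho> g * F Y) = partner X * (\<rho> (inv g) * \<rho> g * F Y)"
      using Fc(2)[OF X] Fc(1)[OF Y] r ri by (simp add: assoc_mult_mat[of _ n n _ n _ n])
    also have "\<dots> = partner X * F Y"
      unfolding rep_inv(1)[OF g] left_mult_one_mat[OF Fc(1)[OF Y]] ..
    finally show "T (\<rho> g * X) (\<rho> g * Y) = T X Y" unfolding T_def .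
  next
    have FE: "F E = E" using F(2) imageI[OF EG, of fst] by simp
    have "T E E = trace (E * F E)" by (rule T_any[OF Ec Ec]) (unfold FE, rule EG)
    then show "T E E = trace E" unfolding FE EE .
  qed
qed

text \<open>The form \<open>T\<close> on the sum of \<open>n\<close> copies of \<open>\<rho>\<close> restricts, for each pair \<open>(i, j)\<close> of copies, to an
  invariant sesquilinear form \<open>M i j\<close> on the representation space. They cannot all vanish, because
  \<open>T E E = trace E\<close>. Multiplying by \<open>E\<close> first makes the forms live on the image of \<open>E\<close>.\<close>

lemma exists_invariant_form:
  assumes ss: "semisimple n" and E: "equivariant_idempotent E"
    and sym: "\<And>g. g \<in> carrier G \<Longrightarrow> trace (E * \<rho> (inv g)) = cnj (trace (E * \<rho> g))"
    and tr: "trace E \<noteq> 0"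
  obtains M where "invariant_form M" "M \<noteq> 0\<^sub>m n n" "mat_adjoint E * M * E = M"
proof -
  have Ec: "E \<in> carrier_mat n n" and EE: "E * E = E"
    and comm: "\<And>g. g \<in> carrier G \<Longrightarrow> \<rho> g * E = E * \<rho> g"
    using E by (auto simp add: equivariant_idempotent_def)
  obtain T where T: "\<And>X Y Z. X \<in> carrier_mat n n \<Longrightarrow> Y \<in> carrier_mat n n \<Longrightarrow> Z \<in> carrier_mat n n \<Longrightarrow>
      T X (Y + Z) = T X Y + T X Z"
    "\<And>X Y c. X \<in> carrier_mat n n \<Longrightarrow> Y \<in> carrier_mat n n \<Longrightarrow> T X (c \<cdot>\<^sub>m Y) = c * T X Y"
    "\<And>X Y. X \<in> carrier_mat n n \<Longrightarrow> Y \<in> carrier_mat n n \<Longrightarrow> T Y X = cnj (T X Y)"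
    "\<And>X Y g. X \<in> carrier_mat n n \<Longrightarrow> Y \<in> carrier_mat n n \<Longrightarrow> g \<in> carrier G \<Longrightarrow>
      T (\<rho> g * X) (\<rho> g * Y) = T X Y"
    "T E E = trace E"
    by (rule trace_form_on_matrices[OF ss E sym], assumption, rule that, assumption+)
  let ?f = "\<lambda>i j v w. T (E * in_column n i v) (E * in_column n j w)"
  have Ep: "E * in_column n i v = in_column n i (E *\<^sub>v v)" if "v \<in> carrier_vec n" for i v
    by (rule mult_in_column[OF Ec that])
  have Evc: "E *\<^sub>v v \<in> carrier_vec n" if "v \<in> carrier_vec n" for v
    using Ec that by simp
  have "\<exists>M\<in>carrier_mat n n.
      (\<forall>v\<in>carrier_vec n. \<forall>w\<in>carrier_vec n. ?f i j v w = (M *\<^sub>v w) \<bullet>c v)" for i j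
  proof -
    have 1: "?f i j w (u + v) = ?f i j w u + ?f i j w v"
      if "u \<in> carrier_vec n" "v \<in> carrier_vec n" "w \<in> carrier_vec n" for i j u v w
      using T(1) that Ep Evc in_column_add[OF Evc[OF that(1)] Evc[OF that(2)]] mult_add_distrib_mat_vec[OF Ec that(1,2)]
      by simp
    have 2: "?f i j v (c \<cdot>\<^sub>v w) = c * ?f i j v w"
      if "v \<in> carrier_vec n" "w \<in> carrier_vec n" for i j c v w
      using T(2) that Ep Evc in_column_smult[OF Evc[OF that(2)]] mult_mat_vec[OF Ec that(2)] by simp
    have 3: "?f i j v w = cnj (?f j i w v)" if "v \<in> carrier_vec n" "w \<in> carrier_vec n" for i j v w
      by (rule T(3)) (use that Ec in auto)
    have 4: "?f i j (u + v) w = ?f i j u w + ?f i j v w"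
      if "u \<in> carrier_vec n" "v \<in> carrier_vec n" "w \<in> carrier_vec n" for u v w
      unfolding 3[OF add_carrier_vec[OF that(1,2)] that(3)] 3[OF that(1,3)] 3[OF that(2,3)] 1[OF that]
      by simp
    have 5: "?f i j (c \<cdot>\<^sub>v v) w = cnj c * ?f i j v w"
      if "v \<in> carrier_vec n" "w \<in> carrier_vec n" for c v w
      unfolding 3[OF smult_carrier_vec[THEN iffD2, OF that(1)] that(2)] 3[OF that] 2[OF that(2,1)] by simp
    show ?thesis
      by (rule sesquilinear_form_matrix) (rule 4 5 1 2; assumption)+
  qed
  then have "\<exists>M. \<forall>i j. M i j \<in> carrier_mat n n \<and>
      (\<forall>v\<in>carrier_vec n. \<forall>w\<in>carrier_vec n. ?f i j v w = (M i j *\<^sub>v w) \<bullet>c v)"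
    unfolding Bex_def by (intro choice allI)
  then obtain M where Mc: "\<And>i j. M i j \<in> carrier_mat n n" and
    M: "\<And>i j v w. v \<in> carrier_vec n \<Longrightarrow> w \<in> carrier_vec n \<Longrightarrow> ?f i j v w = (M i j *\<^sub>v w) \<bullet>c v"
    by blast
  have inv: "invariant_form (M i j)" for i j
    unfolding invariant_form_def
  proof (intro conjI ballI Mc)
    fix g assume g: "g \<in> carrier G"
    note r = rep_carrier[OF g] and ra = mat_adjoint_carrier[OF rep_carrier[OF g]]
    show "mat_adjoint (\<rho> g) * M i j * \<rho> g = M i j"
    proof (rule mat_eq_by_forms[of _ n])
      fix v w :: "complex vec" assume v: "v \<in> carrier_vec n" and w: "w \<in> carrier_vec n"
      note rv = mult_mat_vec_carrier[OF r v] and rw = mult_mat_vec_carrier[OF r w]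
      have shift: "E * in_column n k (\<rho> g *\<^sub>v u) = \<rho> g * (E * in_column n k u)" if u: "u \<in> carrier_vec n" for k u
        unfolding mult_in_column[OF r u, symmetric] assoc_mult_mat[OF Ec r in_column_carrier[OF u], symmetric]
          comm[OF g, symmetric] by (rule assoc_mult_mat[OF r Ec in_column_carrier[OF u]])
      have "(mat_adjoint (\<rho> g) * M i j * \<rho> g) *\<^sub>v w = mat_adjoint (\<rho> g) *\<^sub>v (M i j *\<^sub>v (\<rho> g *\<^sub>v w))"
        unfolding assoc_mult_mat_vec[OF mult_square[OF ra Mc] r w] by (rule assoc_mult_mat_vec[OF ra Mc rw])
      then have "((mat_adjoint (\<rho> g) * M i j * \<rho> g) *\<^sub>v w) \<bullet>c v = (M i j *\<^sub>v (\<rho> g *\<^sub>v w)) \<bullet>c (\<rho> g *\<^sub>v v)"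
        using adjoint_cscalar_prod[OF ra mult_mat_vec_carrier[OF Mc rw] v] adjoint_adjoint by simp
      also have "\<dots> = ?f i j v w"
        unfolding M[OF rv rw, symmetric] shift[OF v] shift[OF w]
        by (rule T(4)) (use Ec v w g in auto)
      finally show "((mat_adjoint (\<rho> g) * M i j * \<rho> g) *\<^sub>v w) \<bullet>c v = (M i j *\<^sub>v w) \<bullet>c v"
        unfolding M[OF v w] .
    qed (use r ra Mc in auto)
  qed
  have compress: "mat_adjoint E * M i j * E = M i j" for i j
  proof (rule mat_eq_by_forms[of _ n])
    note ra = mat_adjoint_carrier[OF Ec]
    fix v w :: "complex vec" assume v: "v \<in> carrier_vec n" and w: "w \<in> carrier_vec n"
    note rv = Evc[OF v] and rw = Evc[OF w]
    have shift: "E * in_column n k (E *\<^sub>v u) = E * in_column n k u" if u: "u \<in> carrier_vec n" for k u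
      unfolding mult_in_column[OF Ec u, symmetric] assoc_mult_mat[OF Ec Ec in_column_carrier[OF u], symmetric] EE ..
    have "(mat_adjoint E * M i j * E) *\<^sub>v w = mat_adjoint E *\<^sub>v (M i j *\<^sub>v (E *\<^sub>v w))"
      unfolding assoc_mult_mat_vec[OF mult_square[OF ra Mc] Ec w] by (rule assoc_mult_mat_vec[OF ra Mc rw])
    then have "((mat_adjoint E * M i j * E) *\<^sub>v w) \<bullet>c v = (M i j *\<^sub>v (E *\<^sub>v w)) \<bullet>c (E *\<^sub>v v)"
      using adjoint_cscalar_prod[OF ra mult_mat_vec_carrier[OF Mc rw] v] adjoint_adjoint by simp
    then show "((mat_adjoint E * M i j * E) *\<^sub>v w) \<bullet>c v = (M i j *\<^sub>v w) \<bullet>c v"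
      unfolding M[OF rv rw, symmetric] M[OF v w, symmetric] shift[OF v] shift[OF w] .
  qed (use Ec Mc in auto)
  have "\<exists>i j. M i j \<noteq> 0\<^sub>m n n"
  proof (rule ccontr)
    assume "\<nexists>i j. M i j \<noteq> 0\<^sub>m n n"
    then have f0: "?f i j v w = 0" if "v \<in> carrier_vec n" "w \<in> carrier_vec n" for i j v w
    proof -
      have "0\<^sub>m n n *\<^sub>v w = 0\<^sub>v n" using that by (intro eq_vecI) auto
      then show ?thesis using M[OF that, of i j] \<open>\<nexists>i j. M i j \<noteq> 0\<^sub>m n n\<close> that by simp
    qed
    have null: "{X \<in> carrier_mat n n. T Y (E * X) = 0} = carrier_mat n n"
      if Y: "Y \<in> carrier_mat n n" and zero: "\<And>j w. w \<in> carrier_vec n \<Longrightarrow> T Y (E * in_column n j w) = 0" for Y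
    proof (rule columns_span)
      have "T Y (0 \<cdot>\<^sub>m (0\<^sub>m n n)) = 0" using T(2)[OF Y, of "0\<^sub>m n n" 0] by simp
      moreover have "0 \<cdot>\<^sub>m (0\<^sub>m n n) = (0\<^sub>m n n :: complex mat)" by (intro eq_matI) auto
      ultimately have "T Y (E * 0\<^sub>m n n) = 0" using right_mult_zero_mat[OF Ec] by simp
      then show "lin_sub n n {X \<in> carrier_mat n n. T Y (E * X) = 0}"
        using mult_add_distrib_mat[OF Ec] mult_smult_distrib[OF Ec] T(1,2)[OF Y] Ec
        by (auto simp: lin_sub_def)
    qed (use zero in auto)
    have one: "T (E * in_column n i v) (E * X) = 0" if "v \<in> carrier_vec n" "X \<in> carrier_mat n n" for i v X
      using null[of "E * in_column n i v"] f0 that Ec by auto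
    have "T (E * X) (E * Y) = 0" if X: "X \<in> carrier_mat n n" and Y: "Y \<in> carrier_mat n n" for X Y
    proof -
      have "T (E * Y) (E * in_column n j w) = 0" if w: "w \<in> carrier_vec n" for j w
        using T(3)[of "E * in_column n j w" "E * Y"] one[OF w Y] Ec Y w by simp
      then have "T (E * Y) (E * X) = 0" using null[of "E * Y"] X Y Ec by auto
      then show ?thesis using T(3)[of "E * Y" "E * X"] X Y Ec by simp
    qed
    from this[of "1\<^sub>m n" "1\<^sub>m n"] have "T E E = 0" using Ec by simp
    then show False using T(5) tr by simp
  qed
  then show thesis using that inv compress by blast
qed

end

section \<open>Descent to a nondegenerate form\<close>

lemma congruence_add:
  fixes A :: "complex mat"
  assumes A: "A \<in> carrier_mat n n" and M: "M \<in> carrier_mat n n" and N: "N \<in> carrier_mat n n"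
  shows "mat_adjoint A * (M + N) * A = mat_adjoint A * M * A + mat_adjoint A * N * A"
  unfolding mult_add_distrib_mat[OF mat_adjoint_carrier[OF A] M N]
  by (rule add_mult_distrib_mat[of _ n n]) (use assms in auto)

lemma congruence_smult:
  fixes A :: "complex mat"
  assumes A: "A \<in> carrier_mat n n" and M: "M \<in> carrier_mat n n"
  shows "mat_adjoint A * (c \<cdot>\<^sub>m M) * A = c \<cdot>\<^sub>m (mat_adjoint A * M * A)"
  unfolding mult_smult_distrib[OF mat_adjoint_carrier[OF A] M]
  by (rule mult_smult_assoc_mat[of _ n n]) (use assms in auto)

lemma congruence_adjoint:
  fixes A :: "complex mat"
  assumes A: "A \<in> carrier_mat n n" and M: "M \<in> carrier_mat n n"
  shows "mat_adjoint A * mat_adjoint M * A = mat_adjoint (mat_adjoint A * M * A)"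
proof -
  note c = mat_adjoint_carrier[OF A] mat_adjoint_carrier[OF M]
  show ?thesis
    unfolding mat_adjoint_mult[OF mult_square[OF c(1) M] A] mat_adjoint_mult[OF c(1) M] adjoint_adjoint
    by (rule assoc_mult_mat[OF c(1,2) A])
qed

lemma right_minus_zero_mat:
  fixes A :: "complex mat"
  assumes "A \<in> carrier_mat n m"
  shows "A - 0\<^sub>m n m = A"
  using assms by (intro eq_matI) auto

context matrix_rep
begin

text \<open>One of \<open>M + M\<^sup>*\<close> and \<open>\<i> M - \<i> M\<^sup>*\<close> is nonzero.\<close>

lemma exists_hermitian_invariant_form:
  assumes M: "invariant_form M" and M0: "M \<noteq> 0\<^sub>m n n" and E: "E \<in> carrier_mat n n"
    and comp: "mat_adjoint E * M * E = M"
  obtains H where "invariant_form H" "mat_adjoint H = H" "H \<noteq> 0\<^sub>m n n" "mat_adjoint E * H * E = H"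
proof -
  have Mc: "M \<in> carrier_mat n n" using M by (simp add: invariant_form_def)
  let ?H = "\<lambda>c. c \<cdot>\<^sub>m M + cnj c \<cdot>\<^sub>m mat_adjoint M"
  have fixed: "mat_adjoint A * ?H c * A = ?H c"
    if A: "A \<in> carrier_mat n n" and fx: "mat_adjoint A * M * A = M" for A c
  proof -
    note c = smult_carrier_mat[OF Mc] smult_carrier_mat[OF mat_adjoint_carrier[OF Mc]]
    show ?thesis
      unfolding congruence_add[OF A c] congruence_smult[OF A Mc]
        congruence_smult[OF A mat_adjoint_carrier[OF Mc]] congruence_adjoint[OF A Mc] fx ..
  qed
  have inv: "invariant_form (?H c)" for c
    using M fixed[OF rep_carrier] Mc unfolding invariant_form_def by auto
  have herm: "mat_adjoint (?H c) = ?H c" for c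
  proof -
    have "mat_adjoint (?H c) = cnj c \<cdot>\<^sub>m mat_adjoint M + c \<cdot>\<^sub>m M"
      using Mc by (subst adjoint_add[of _ n]) (auto simp: adjoint_smult adjoint_adjoint)
    also have "\<dots> = ?H c" by (rule comm_add_mat[of _ n n]) (use Mc in auto)
    finally show ?thesis .
  qed
  \<comment> \<open>If both vanish, then \<open>M\<^sup>* = - M\<close> and \<open>M\<^sup>* = M\<close>.\<close>
  have "?H 1 \<noteq> 0\<^sub>m n n \<or> ?H \<i> \<noteq> 0\<^sub>m n n"
  proof (rule ccontr)
    assume "\<not> (?H 1 \<noteq> 0\<^sub>m n n \<or> ?H \<i> \<noteq> 0\<^sub>m n n)"
    then have z: "?H 1 = 0\<^sub>m n n" "?H \<i> = 0\<^sub>m n n" by auto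
    have "M $$ (i, j) = 0" if ij: "i < n" "j < n" for i j
    proof -
      let ?a = "M $$ (i, j)" and ?b = "mat_adjoint M $$ (i, j)"
      have Ma: "mat_adjoint M \<in> carrier_mat n n" using Mc by simp
      have "?a + ?b = 0" using arg_cong[OF z(1), of "\<lambda>X. X $$ (i, j)"] ij Mc Ma by simp
      moreover have "\<i> * ?a - \<i> * ?b = 0"
        using arg_cong[OF z(2), of "\<lambda>X. X $$ (i, j)"] ij Mc Ma by simp
      then have "\<i> * (?a - ?b) = 0" by (simp only: right_diff_distrib)
      then have "?a = ?b" by simp
      ultimately show ?thesis by simp
    qed
    then have "M = 0\<^sub>m n n" using Mc by (intro eq_matI) auto
    then show False using M0 by simp
  qed
  then show thesis using that inv herm fixed[OF E comp] by blast
qed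

text \<open>A nonzero form \<open>H\<close> on the kernel of \<open>P\<close>, extended by zero to the complement, is added to \<open>P\<close>. The
  kernel of \<open>P + H\<close> is the kernel of \<open>H\<close> within that of \<open>P\<close>, hence smaller, and its dimension, the
  trace of the projection, drops by \<open>k\<close>.\<close>

lemma enlarge_invariant_form:
  assumes ss: "\<And>m. semisimple m"
    and tr: "\<And>g. g \<in> carrier G \<Longrightarrow> trace (\<rho> (inv g)) = cnj (trace (\<rho> g))"
    and P: "invariant_form P" and herm: "mat_adjoint P = P" and E: "equivariant_idempotent E"
    and PE: "P * E = 0\<^sub>m n n"
    and ker: "\<And>v. v \<in> carrier_vec n \<Longrightarrow> P *\<^sub>v v = 0\<^sub>v n \<Longrightarrow> E *\<^sub>v v = v"
    and E0: "trace E \<noteq> 0"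
  obtains P' E' k where "invariant_form P'" "mat_adjoint P' = P'" "equivariant_idempotent E'"
    "P' * E' = 0\<^sub>m n n" "\<And>v. v \<in> carrier_vec n \<Longrightarrow> P' *\<^sub>v v = 0\<^sub>v n \<Longrightarrow> E' *\<^sub>v v = v"
    "trace E = trace E' + of_nat k" "0 < k"
proof -
  have Pc: "P \<in> carrier_mat n n" using P by (simp add: invariant_form_def)
  have Ec: "E \<in> carrier_mat n n" and EE: "E * E = E"
    and Ecomm: "\<And>g. g \<in> carrier G \<Longrightarrow> \<rho> g * E = E * \<rho> g"
    using E by (auto simp add: equivariant_idempotent_def)
  note sym = trace_idempotent_inv[OF P herm E PE ker tr]
  obtain M where M: "invariant_form M" "M \<noteq> 0\<^sub>m n n" "mat_adjoint E * M * E = M"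
    by (rule exists_invariant_form[OF ss E _ E0]) (use sym that in blast)+
  obtain H where H: "invariant_form H" "mat_adjoint H = H" "H \<noteq> 0\<^sub>m n n" "mat_adjoint E * H * E = H"
    by (rule exists_hermitian_invariant_form[OF M(1,2) Ec M(3)]) (use that in blast)
  have Hc: "H \<in> carrier_mat n n" using H(1) by (simp add: invariant_form_def)
  let ?A = "mat_adjoint E"
  have Ac: "?A \<in> carrier_mat n n" using Ec by simp
  have AP: "?A * P = 0\<^sub>m n n"
    using arg_cong[OF PE, of mat_adjoint] unfolding mat_adjoint_mult[OF Pc Ec] herm adjoint_zero .
  have AA: "?A * ?A = ?A" using mat_adjoint_mult[OF Ec Ec] EE by simp
  have HE: "H * E = H"
  proof -
    have "(?A * H * E) * E = ?A * H * E"
      unfolding assoc_mult_mat[OF mult_square[OF Ac Hc] Ec Ec] EE ..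
    then show ?thesis unfolding H(4) .
  qed
  have AH: "?A * H = H"
    using arg_cong[OF HE, of mat_adjoint] unfolding mat_adjoint_mult[OF Hc Ec] H(2) .
  let ?P = "P + H"
  have P'c: "?P \<in> carrier_mat n n" using Pc Hc by simp
  have inv': "invariant_form ?P"
    using P H(1) congruence_add[OF rep_carrier Pc Hc] P'c unfolding invariant_form_def by simp
  have herm': "mat_adjoint ?P = ?P" using adjoint_add[OF Pc Hc] herm H(2) by simp
  have ker': "E *\<^sub>v v = v" if v: "v \<in> carrier_vec n" and z: "?P *\<^sub>v v = 0\<^sub>v n" for v
  proof -
    have "?A * ?P = H"
      unfolding mult_add_distrib_mat[OF Ac Pc Hc] AP AH using Hc by simp
    then have "H *\<^sub>v v = ?A *\<^sub>v (?P *\<^sub>v v)" using assoc_mult_mat_vec[OF Ac P'c v] by simp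
    also have "\<dots> = 0\<^sub>v n" unfolding z using Ac by (intro eq_vecI) auto
    finally have "H *\<^sub>v v = 0\<^sub>v n" .
    then have "P *\<^sub>v v = 0\<^sub>v n"
      using z Pc v unfolding add_mult_distrib_mat_vec[OF Pc Hc v] by simp
    then show ?thesis by (rule ker[OF v])
  qed
  obtain F where F: "equivariant_idempotent F" and PF: "?P * F = 0\<^sub>m n n"
    and kerF: "\<And>v. v \<in> carrier_vec n \<Longrightarrow> ?P *\<^sub>v v = 0\<^sub>v n \<Longrightarrow> F *\<^sub>v v = v"
    by (rule idempotent_onto_kernel[OF ss inv'], rule that, assumption+)
  have Fc: "F \<in> carrier_mat n n" and FF: "F * F = F"
    and Fcomm: "\<And>g. g \<in> carrier G \<Longrightarrow> \<rho> g * F = F * \<rho> g"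
    using F by (auto simp add: equivariant_idempotent_def)
  have EF: "E * F = F"
  proof (rule mat_eq_by_vecs[OF mult_square[OF Ec Fc] Fc])
    fix v :: "complex vec" assume v: "v \<in> carrier_vec n"
    have "?P *\<^sub>v (F *\<^sub>v v) = 0\<^sub>m n n *\<^sub>v v"
      unfolding assoc_mult_mat_vec[OF P'c Fc v, symmetric] PF ..
    also have "\<dots> = 0\<^sub>v n" using v by (intro eq_vecI) auto
    finally show "(E * F) *\<^sub>v v = F *\<^sub>v v"
      unfolding assoc_mult_mat_vec[OF Ec Fc v] by (intro ker') (use Fc v in auto)
  qed
  \<comment> \<open>The image of \<open>F\<close> lies in that of \<open>E\<close>, but \<open>E\<close> and \<open>F\<close> need not commute. The product \<open>F * E\<close>
    has the same image as \<open>F\<close> and makes the difference \<open>E - F * E\<close> idempotent.\<close>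
  let ?F = "F * E"
  have FEc: "?F \<in> carrier_mat n n" using Fc Ec by simp
  have FEF: "?F * F = F" unfolding assoc_mult_mat[OF Fc Ec Fc] EF FF ..
  have idem: "?F * ?F = ?F"
    unfolding assoc_mult_mat[OF FEc Fc Ec, symmetric] FEF ..
  have EFE: "E * ?F = ?F" unfolding assoc_mult_mat[OF Ec Fc Ec, symmetric] EF ..
  have FEE: "?F * E = ?F" unfolding assoc_mult_mat[OF Fc Ec Ec] EE ..
  have eqF: "equivariant_idempotent ?F"
    unfolding equivariant_idempotent_def
  proof (intro conjI ballI FEc idem)
    fix g assume g: "g \<in> carrier G"
    note r = rep_carrier[OF g]
    show "\<rho> g * ?F = ?F * \<rho> g"
      unfolding assoc_mult_mat[OF r Fc Ec, symmetric] Fcomm[OF g] assoc_mult_mat[OF Fc r Ec]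
        Ecomm[OF g] by (rule assoc_mult_mat[OF Fc Ec r, symmetric])
  qed
  have PF': "?P * ?F = 0\<^sub>m n n"
    unfolding assoc_mult_mat[OF P'c Fc Ec, symmetric] PF by (rule left_mult_zero_mat[OF Ec])
  have kerF': "?F *\<^sub>v v = v" if v: "v \<in> carrier_vec n" and z: "?P *\<^sub>v v = 0\<^sub>v n" for v
    unfolding assoc_mult_mat_vec[OF Fc Ec v] ker'[OF v z] by (rule kerF[OF v z])
  let ?D = "E - ?F"
  have Dc: "?D \<in> carrier_mat n n" by (rule minus_carrier_mat[OF FEc])
  have DD: "?D * ?D = ?D"
  proof -
    have "?D * ?D = ?D * E - ?D * ?F" by (rule mult_minus_distrib_mat[OF Dc Ec FEc])
    also have "?D * E = ?D"
      unfolding minus_mult_distrib_mat[OF Ec FEc Ec] EE FEE ..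
    also have "?D * ?F = 0\<^sub>m n n"
      unfolding minus_mult_distrib_mat[OF Ec FEc FEc] EFE idem using FEc by simp
    also have "?D - 0\<^sub>m n n = ?D" by (rule right_minus_zero_mat[OF Dc])
    finally show ?thesis .
  qed
  obtain k :: nat where k: "trace ?D = of_nat k" "k = 0 \<Longrightarrow> ?D = 0\<^sub>m n n"
    by (rule trace_idempotent[OF Dc DD], rule that)
  have ED: "E = ?F + ?D"
  proof (rule eq_matI)
    fix i j assume "i < dim_row (?F + ?D)" "j < dim_col (?F + ?D)"
    then have ij: "i < n" "j < n" using carrier_matD[OF Dc] by simp_all
    then have "(?F + ?D) $$ (i, j) = ?F $$ (i, j) + (E $$ (i, j) - ?F $$ (i, j))"
      using carrier_matD[OF Dc] carrier_matD[OF FEc] by simp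
    then show "E $$ (i, j) = (?F + ?D) $$ (i, j)" by simp
  qed (use carrier_matD[OF Dc] carrier_matD[OF Ec] in simp_all)
  have "k \<noteq> 0"
  proof
    assume "k = 0"
    then have "E = ?F" using ED k(2) FEc by simp
    then have "?P * E = 0\<^sub>m n n" using PF' by simp
    then have "H = 0\<^sub>m n n"
      unfolding add_mult_distrib_mat[OF Pc Hc Ec] PE HE using Hc by simp
    then show False using H(3) by simp
  qed
  moreover have "trace E = trace ?F + of_nat k"
    unfolding k(1)[symmetric] trace_add[OF FEc Dc, symmetric] ED[symmetric] ..
  ultimately show thesis
    using that[OF inv' herm' eqF PF' kerF'] by simp
qed

text \<open>The descent starts from the zero form, whose kernel is everything, and ends when the kernel
  is zero.\<close>

theorem exists_nondegenerate_hermitian_form: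
  assumes ss: "\<And>m. semisimple m"
    and tr: "\<And>g. g \<in> carrier G \<Longrightarrow> trace (\<rho> (inv g)) = cnj (trace (\<rho> g))"
  obtains P where "invariant_form P" "mat_adjoint P = P" "det P \<noteq> 0"
proof -
  have descent: "\<exists>P. invariant_form P \<and> mat_adjoint P = P \<and> det P \<noteq> 0"
    if "invariant_form P" "mat_adjoint P = P" "equivariant_idempotent E" "P * E = 0\<^sub>m n n"
      "\<And>v. v \<in> carrier_vec n \<Longrightarrow> P *\<^sub>v v = 0\<^sub>v n \<Longrightarrow> E *\<^sub>v v = v" "trace E = of_nat k"
    for P E k
    using that
  proof (induction k arbitrary: P E rule: less_induct)
    case (less k)
    have Pc: "P \<in> carrier_mat n n" using less.prems(1) by (simp add: invariant_form_def)
    have Ec: "E \<in> carrier_mat n n" and EE: "E * E = E"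
      using less.prems(3) by (auto simp add: equivariant_idempotent_def)
    show ?case
    proof (cases "k = 0")
      case True
      obtain j :: nat where j: "trace E = of_nat j" "j = 0 \<Longrightarrow> E = 0\<^sub>m n n"
        by (rule trace_idempotent[OF Ec EE], rule that)
      have E0: "E = 0\<^sub>m n n" using j less.prems(6) True by simp
      have "v = 0\<^sub>v n" if v: "v \<in> carrier_vec n" and Pv: "P *\<^sub>v v = 0\<^sub>v n" for v
      proof -
        have "0\<^sub>m n n *\<^sub>v v = 0\<^sub>v n" using v by (intro eq_vecI) auto
        then show ?thesis using less.prems(5)[OF v Pv] unfolding E0 by simp
      qed
      then have "det P \<noteq> 0" using det_0_iff_vec_prod_zero[OF Pc] by blast
      then show ?thesis using less.prems(1,2) by blast
    next
      case False
      then have E0: "trace E \<noteq> 0" using less.prems(6) by simp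
      obtain P' E' l where
        *: "invariant_form P'" "mat_adjoint P' = P'" "equivariant_idempotent E'"
          "P' * E' = 0\<^sub>m n n" "\<And>v. v \<in> carrier_vec n \<Longrightarrow> P' *\<^sub>v v = 0\<^sub>v n \<Longrightarrow> E' *\<^sub>v v = v"
        and l: "trace E = trace E' + of_nat l" "0 < l"
        by (rule enlarge_invariant_form[OF ss tr less.prems(1-5) E0], assumption+, rule that, assumption+)
      have E'c: "E' \<in> carrier_mat n n" and EE': "E' * E' = E'"
        using *(3) by (auto simp add: equivariant_idempotent_def)
      obtain j :: nat where j: "trace E' = of_nat j"
        by (rule trace_idempotent[OF E'c EE'], rule that)
      have "(of_nat k :: complex) = of_nat (j + l)" using l(1) j less.prems(6) by simp
      then have "j < k" using l(2) unfolding of_nat_eq_iff by simp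
      then show ?thesis by (rule less.IH[OF _ *(1-5) j])
    qed
  qed
  have "invariant_form (0\<^sub>m n n)"
    unfolding invariant_form_def
    using right_mult_zero_mat[OF mat_adjoint_carrier[OF rep_carrier]] left_mult_zero_mat[OF rep_carrier]
    by simp
  moreover have "equivariant_idempotent (1\<^sub>m n)"
    unfolding equivariant_idempotent_def
    using left_mult_one_mat[OF rep_carrier] right_mult_one_mat[OF rep_carrier] by simp
  moreover have "trace (1\<^sub>m n) = of_nat n" by (simp add: trace_def)
  ultimately show thesis
    using descent[of "0\<^sub>m n n" "1\<^sub>m n" n] adjoint_zero that by auto
qed

end

section \<open>Normal form of a nondegenerate Hermitian form\<close>

lemma I_pq_index:
  "i < p + q \<Longrightarrow> j < p + q \<Longrightarrow> I_pq p q $$ (i, j) = (if i = j then if i < p then 1 else -1 else 0)"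
  by (auto simp: I_pq_def)

lemma I_pq_carrier [simp]: "I_pq p q \<in> carrier_mat (p + q) (p + q)"
  by (auto simp: I_pq_def)

lemma I_pq_Suc_left:
  "I_pq (Suc p) q = four_block_mat (1\<^sub>m 1) (0\<^sub>m 1 (p + q)) (0\<^sub>m (p + q) 1) (I_pq p q)"
proof (rule eq_matI)
  fix i j
  assume "i < dim_row (four_block_mat (1\<^sub>m 1) (0\<^sub>m 1 (p + q)) (0\<^sub>m (p + q) 1) (I_pq p q))"
    "j < dim_col (four_block_mat (1\<^sub>m 1) (0\<^sub>m 1 (p + q)) (0\<^sub>m (p + q) 1) (I_pq p q))"
  then have ij: "i < Suc (p + q)" "j < Suc (p + q)" by (auto simp: I_pq_def)
  then show "I_pq (Suc p) q $$ (i, j)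
      = four_block_mat (1\<^sub>m 1) (0\<^sub>m 1 (p + q)) (0\<^sub>m (p + q) 1) (I_pq p q) $$ (i, j)"
    using carrier_matD[OF I_pq_carrier[of p q]]
    by (cases i; cases j) (auto simp: I_pq_index)
qed (auto simp: I_pq_def)

lemma I_pq_Suc_right:
  "I_pq p (Suc q) = four_block_mat (I_pq p q) (0\<^sub>m (p + q) 1) (0\<^sub>m 1 (p + q)) (- 1\<^sub>m 1)"
proof (rule eq_matI)
  fix i j
  assume "i < dim_row (four_block_mat (I_pq p q) (0\<^sub>m (p + q) 1) (0\<^sub>m 1 (p + q)) (- 1\<^sub>m 1))"
    "j < dim_col (four_block_mat (I_pq p q) (0\<^sub>m (p + q) 1) (0\<^sub>m 1 (p + q)) (- 1\<^sub>m 1))"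
  then have ij: "i < Suc (p + q)" "j < Suc (p + q)" by (auto simp: I_pq_def)
  then show "I_pq p (Suc q) $$ (i, j)
      = four_block_mat (I_pq p q) (0\<^sub>m (p + q) 1) (0\<^sub>m 1 (p + q)) (- 1\<^sub>m 1) $$ (i, j)"
    using carrier_matD[OF I_pq_carrier[of p q]] by (auto simp: I_pq_index less_Suc_eq)
qed (auto simp: I_pq_def)

lemma adjoint_four_block:
  fixes A :: "complex mat"
  assumes "A \<in> carrier_mat r1 c1" "B \<in> carrier_mat r1 c2" "C \<in> carrier_mat r2 c1" "D \<in> carrier_mat r2 c2"
  shows "mat_adjoint (four_block_mat A B C D)
    = four_block_mat (mat_adjoint A) (mat_adjoint C) (mat_adjoint B) (mat_adjoint D)"
  unfolding mat_adjoint_eq using assms by (intro eq_matI) auto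

text \<open>Gram--Schmidt applied to a basis that begins with an eigenvector.\<close>

lemma orthogonal_basis_from_eigenvector:
  fixes P :: "complex mat"
  assumes P: "P \<in> carrier_mat n n" and n: "0 < n"
  obtains W e where "W \<in> carrier_mat n n" "det W \<noteq> 0" "P *\<^sub>v col W 0 = e \<cdot>\<^sub>v col W 0"
    "\<And>i. 0 < i \<Longrightarrow> i < n \<Longrightarrow> col W 0 \<bullet>c col W i = 0"
proof -
  obtain as where as: "char_poly P = (\<Prod>a\<leftarrow>as. [:- a, 1:])" "length as = n"
    using char_poly_factorized[OF P] by blast
  then obtain e es where "as = e # es" using n by (cases as) auto
  then have "eigenvalue P e" unfolding eigenvalue_root_char_poly[OF P] as(1) by simp
  then obtain v where "eigenvector P v e" by (auto simp: eigenvalue_def)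
  then have v: "v \<in> carrier_vec n" and v0: "v \<noteq> 0\<^sub>v n" and ev: "P *\<^sub>v v = e \<cdot>\<^sub>v v"
    using P by (auto simp: eigenvector_def)
  interpret cof_vec_space n "TYPE(complex)" .
  let ?b = "basis_completion v"
  have b: "distinct ?b" "\<not> lin_dep (set ?b)" "set ?b \<subseteq> carrier_vec n" "hd ?b = v" "length ?b = n"
    using basis_completion[OF v v0] by auto
  define ws where "ws = gram_schmidt n ?b"
  have ws: "set ws \<subseteq> carrier_vec n" "corthogonal ws" "length ws = n"
    using gram_schmidt_result[OF b(3,1,2) refl, folded ws_def] b(5) by auto
  obtain vs where bv: "?b = v # vs" using b(4,5) n by (cases ?b) auto
  have hd: "hd ws = v" using gram_schmidt_hd[OF v, of vs, folded bv] unfolding ws_def .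
  define W where "W = mat_of_cols n ws"
  have W: "W \<in> carrier_mat n n" unfolding W_def using ws(3) by auto
  have orth: "corthogonal_mat W" unfolding W_def by (rule orthogonal_mat_of_cols[OF ws])
  have "ws ! 0 = v" using hd ws(3) n by (cases ws) auto
  then have col0: "col W 0 = v" unfolding W_def using ws(3) n v by (simp add: col_mat_of_cols)
  have W': "corthogonal_inv W \<in> carrier_mat n n"
    unfolding corthogonal_inv_def mat_of_rows_def using W by auto
  have "corthogonal_inv W * W = 1\<^sub>m n"
    using corthogonal_inv_result[OF orth] W' unfolding inverts_mat_def by simp
  then have "det (corthogonal_inv W) * det W = 1"
    using det_mult[OF W' W] det_one by metis
  then have "det W \<noteq> 0" by auto
  moreover have "col W 0 \<bullet>c col W i = 0" if "0 < i" "i < n" for i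
    using corthogonal_matD[OF orth, of 0 i] W that by auto
  ultimately show thesis using that[OF W] ev unfolding col0 by blast
qed

text \<open>In an orthogonal basis beginning with an eigenvector of \<open>P\<close>, the first column of the form vanishes
  below the diagonal, and by symmetry so does the first row.\<close>

lemma hermitian_block:
  fixes P :: "complex mat"
  assumes P: "P \<in> carrier_mat (Suc m) (Suc m)" and herm: "mat_adjoint P = P" and det: "det P \<noteq> 0"
  obtains W D and r :: real where "W \<in> carrier_mat (Suc m) (Suc m)" "det W \<noteq> 0"
    "D \<in> carrier_mat m m" "mat_adjoint D = D" "det D \<noteq> 0" "r \<noteq> 0"
    "mat_adjoint W * P * W = four_block_mat (of_real r \<cdot>\<^sub>m 1\<^sub>m 1) (0\<^sub>m 1 m) (0\<^sub>m m 1) D"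
proof -
  obtain W e where W: "W \<in> carrier_mat (Suc m) (Suc m)" and dW: "det W \<noteq> 0"
    and ev: "P *\<^sub>v col W 0 = e \<cdot>\<^sub>v col W 0"
    and orth: "\<And>i. 0 < i \<Longrightarrow> i < Suc m \<Longrightarrow> col W 0 \<bullet>c col W i = 0"
    by (rule orthogonal_basis_from_eigenvector[OF P zero_less_Suc], rule that, assumption+)
  let ?B = "mat_adjoint W * P * W"
  have Wa: "mat_adjoint W \<in> carrier_mat (Suc m) (Suc m)" by (rule mat_adjoint_carrier[OF W])
  have B: "?B \<in> carrier_mat (Suc m) (Suc m)" by (rule mult_square[OF mult_square[OF Wa P] W])
  have Bherm: "mat_adjoint ?B = ?B" using congruence_adjoint[OF W P] herm by simp
  have Bsym: "?B $$ (i, j) = cnj (?B $$ (j, i))" if "i < Suc m" "j < Suc m" for i j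
  proof -
    have "?B $$ (i, j) = mat_adjoint ?B $$ (i, j)" unfolding Bherm ..
    also have "\<dots> = cnj (?B $$ (j, i))" using that carrier_matD[OF B] by (simp add: mat_adjoint_eq)
    finally show ?thesis .
  qed
  have w0: "col W 0 \<in> carrier_vec (Suc m)" using W by (intro carrier_vecI) simp
  have "?B $$ (i, 0) = 0" if i: "0 < i" "i < Suc m" for i
  proof -
    have wi: "col W i \<in> carrier_vec (Suc m)" using W by (intro carrier_vecI) simp
    have row: "row (mat_adjoint W) i = conjugate (col W i)"
      using W i by (intro eq_vecI) (auto simp: mat_adjoint_eq)
    have "?B $$ (i, 0) = (mat_adjoint W * (P * W)) $$ (i, 0)"
      using assoc_mult_mat[OF Wa P W] by simp
    also have "\<dots> = row (mat_adjoint W) i \<bullet> col (P * W) 0"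
      using i carrier_matD[OF Wa] W P by (intro index_mult_mat(1)) auto
    also have "col (P * W) 0 = e \<cdot>\<^sub>v col W 0" using col_mult2[OF P W] ev by simp
    also have "row (mat_adjoint W) i \<bullet> (e \<cdot>\<^sub>v col W 0) = (e \<cdot>\<^sub>v col W 0) \<bullet>c col W i"
      unfolding row by (rule comm_scalar_prod[of _ "Suc m"]) (use w0 wi in auto)
    also have "\<dots> = e * (col W 0 \<bullet>c col W i)"
      by (rule smult_scalar_prod_distrib[of _ "Suc m"]) (use w0 wi in auto)
    finally show ?thesis using orth[OF i] by simp
  qed
  note low = this
  have up: "?B $$ (0, i) = 0" if i: "0 < i" "i < Suc m" for i
    using Bsym[of 0 i] low[OF i] i by simp
  let ?r = "Re (?B $$ (0, 0))"
  let ?D = "mat m m (\<lambda>(i, j). ?B $$ (Suc i, Suc j))"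
  have r: "?B $$ (0, 0) = of_real ?r"
    using Bsym[of 0 0] by (simp add: complex_eq_iff)
  have block: "?B = four_block_mat (of_real ?r \<cdot>\<^sub>m 1\<^sub>m 1) (0\<^sub>m 1 m) (0\<^sub>m m 1) ?D" (is "_ = ?F")
  proof (rule eq_matI)
    fix i j assume "i < dim_row ?F" "j < dim_col ?F"
    then have ij: "i < Suc m" "j < Suc m" by auto
    show "?B $$ (i, j) = ?F $$ (i, j)"
    proof (cases i)
      case 0
      show ?thesis
      proof (cases j)
        case 0
        have "?F $$ (0, 0) = of_real ?r" by simp
        then show ?thesis unfolding \<open>i = 0\<close> 0 by (intro trans[OF r]) (rule sym)
      next
        case (Suc l)
        then show ?thesis using up[of j] ij \<open>i = 0\<close> by simp
      qed
    next
      case (Suc k)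
      show ?thesis
      proof (cases j)
        case 0
        then show ?thesis using low[of i] ij Suc by simp
      next
        case (Suc l)
        then show ?thesis using ij \<open>i = Suc k\<close> by simp
      qed
    qed
  qed (use carrier_matD[OF B] in auto)
  have D: "?D \<in> carrier_mat m m" by simp
  have R: "of_real ?r \<cdot>\<^sub>m 1\<^sub>m 1 \<in> carrier_mat 1 1" by simp
  have "det ?B = det (mat_adjoint W) * det P * det W"
    using det_mult[OF mult_square[OF Wa P] W] det_mult[OF Wa P] by simp
  moreover have "det (mat_adjoint W) \<noteq> 0"
  proof -
    have "W \<in> carrier (GL (Suc m))" using det_non_zero_imp_unit[OF W dW] by simp
    from adjoint_GL(1)[OF this] show ?thesis
      using unit_imp_det_non_zero[of "mat_adjoint W" "Suc m" "()"] by simp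
  qed
  ultimately have dB: "det ?B \<noteq> 0" using det dW by simp
  have "det ?F = det (of_real ?r \<cdot>\<^sub>m 1\<^sub>m 1 :: complex mat) * det ?D"
    by (rule det_four_block_mat_upper_right_zero[OF R refl _ D]) simp
  also have "det (of_real ?r \<cdot>\<^sub>m 1\<^sub>m 1 :: complex mat) = of_real ?r"
    by (simp add: det_smult)
  finally have "of_real ?r * det ?D \<noteq> 0" using dB unfolding block[symmetric] by simp
  then have "?r \<noteq> 0" "det ?D \<noteq> 0" by auto
  moreover have "mat_adjoint ?D = ?D"
  proof (rule eq_matI)
    fix i j assume "i < dim_row ?D" "j < dim_col ?D"
    then have ij: "i < m" "j < m" by auto
    have "mat_adjoint ?D $$ (i, j) = cnj (?D $$ (j, i))" using ij by (simp add: mat_adjoint_eq[of ?D])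
    also have "\<dots> = ?B $$ (Suc i, Suc j)" using Bsym[of "Suc i" "Suc j"] ij by simp
    finally show "mat_adjoint ?D $$ (i, j) = ?D $$ (i, j)" using ij by simp
  qed (simp_all add: mat_adjoint_eq[of ?D])
  ultimately show thesis using that[OF W dW D _ _ _ block] by blast
qed

text \<open>The sign of \<open>r\<close> decides where the new basis vector goes: a positive direction is put in front of the
  others, a negative one behind them, by the off-diagonal block matrix.\<close>

lemma block_signature:
  fixes D h :: "complex mat" and r :: real
  assumes h: "h \<in> carrier_mat (p + q) (p + q)" and D: "D = mat_adjoint h * I_pq p q * h" and r: "r \<noteq> 0"
  shows "\<exists>p' q' k. p' + q' = Suc (p + q) \<and> k \<in> carrier_mat (Suc (p + q)) (Suc (p + q)) \<and>
    four_block_mat (of_real r \<cdot>\<^sub>m 1\<^sub>m 1) (0\<^sub>m 1 (p + q)) (0\<^sub>m (p + q) 1) D = mat_adjoint k * I_pq p' q' * k"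
    (is "\<exists>p' q' k. _ \<and> _ \<and> ?B = _")
proof -
  let ?m = "p + q" and ?s = "of_real (sqrt \<bar>r\<bar>) \<cdot>\<^sub>m 1\<^sub>m 1 :: complex mat"
  have s: "?s \<in> carrier_mat 1 1" by simp
  have sa: "mat_adjoint ?s = ?s" unfolding mat_adjoint_eq by (intro eq_matI) auto
  have ss: "?s * ?s = of_real \<bar>r\<bar> \<cdot>\<^sub>m 1\<^sub>m 1"
    by (intro eq_matI) (auto simp: scalar_prod_def of_real_mult[symmetric] simp del: of_real_mult)
  have ha: "mat_adjoint h \<in> carrier_mat ?m ?m" using h by simp
  have hI: "mat_adjoint h * I_pq p q \<in> carrier_mat ?m ?m" by (rule mult_square[OF ha I_pq_carrier])
  have Dc: "D \<in> carrier_mat ?m ?m" unfolding D by (rule mult_square[OF hI h])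
  show ?thesis
  proof (cases "0 < r")
    case True
    let ?k = "four_block_mat ?s (0\<^sub>m 1 ?m) (0\<^sub>m ?m 1) h"
    have ka: "mat_adjoint ?k = four_block_mat ?s (0\<^sub>m 1 ?m) (0\<^sub>m ?m 1) (mat_adjoint h)"
      by (subst adjoint_four_block[OF s _ _ h]) (unfold sa adjoint_zero, simp_all add: h)
    have "mat_adjoint ?k * I_pq (Suc p) q = four_block_mat ?s (0\<^sub>m 1 ?m) (0\<^sub>m ?m 1) (mat_adjoint h * I_pq p q)"
      unfolding ka I_pq_Suc_left
      by (subst mult_four_block_mat[OF s _ _ ha _ _ _ I_pq_carrier])
        (use s ha hI right_mult_one_mat[OF s] in \<open>auto simp: right_mult_zero_mat[OF s] right_mult_zero_mat[OF ha] left_mult_zero_mat[OF I_pq_carrier]\<close>)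
    also have "\<dots> * ?k = ?B"
      unfolding D
      by (subst mult_four_block_mat[OF s _ _ hI s _ _ h])
        (use s hI h ss True in \<open>auto simp: right_mult_zero_mat[OF s] right_mult_zero_mat[OF hI] left_mult_zero_mat[OF h] left_mult_zero_mat[OF s]\<close>)
    finally have "?B = mat_adjoint ?k * I_pq (Suc p) q * ?k" by simp
    moreover have "?k \<in> carrier_mat (Suc ?m) (Suc ?m)" using four_block_carrier_mat[OF s h] by simp
    ultimately show ?thesis by (intro exI[of _ "Suc p"] exI[of _ q] exI[of _ ?k]) simp
  next
    case False
    \<comment> \<open>\<open>k\<close> moves the first coordinate to the end.\<close>
    let ?k = "four_block_mat (0\<^sub>m ?m 1) h ?s (0\<^sub>m 1 ?m)"
    have ns: "- ?s \<in> carrier_mat 1 1" by simp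
    have ka: "mat_adjoint ?k = four_block_mat (0\<^sub>m 1 ?m) ?s (mat_adjoint h) (0\<^sub>m ?m 1)"
      by (subst adjoint_four_block[OF _ h s]) (unfold sa adjoint_zero, simp_all add: h)
    have s1: "?s * (- 1\<^sub>m 1) = - ?s" by (intro eq_matI) (auto simp: scalar_prod_def)
    have sns: "- ?s * ?s = of_real r \<cdot>\<^sub>m 1\<^sub>m 1"
    proof -
      have "- ?s * ?s = - (?s * ?s)" by (rule uminus_mult_left_mat) simp
      then show ?thesis unfolding ss using False by (intro eq_matI) auto
    qed
    have "mat_adjoint ?k * I_pq p (Suc q) = four_block_mat (0\<^sub>m 1 ?m) (- ?s) (mat_adjoint h * I_pq p q) (0\<^sub>m ?m 1)"
      unfolding ka I_pq_Suc_right
      by (subst mult_four_block_mat[OF _ s ha _ I_pq_carrier])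
        (use s ha hI s1 ns in \<open>auto simp: right_mult_zero_mat[OF s] right_mult_zero_mat[OF ha] left_mult_zero_mat[OF I_pq_carrier]\<close>)
    also have "\<dots> * ?k = ?B"
      unfolding D
      by (subst mult_four_block_mat[OF _ ns hI _ _ h s])
        (use s ns hI h sns in \<open>auto simp: right_mult_zero_mat[OF ns] right_mult_zero_mat[OF hI] left_mult_zero_mat[OF h] left_mult_zero_mat[OF s]\<close>)
    finally have "?B = mat_adjoint ?k * I_pq p (Suc q) * ?k" by simp
    moreover have "?k \<in> carrier_mat (Suc ?m) (Suc ?m)" using h by (intro carrier_matI) auto
    ultimately show ?thesis by (intro exI[of _ p] exI[of _ "Suc q"] exI[of _ ?k]) simp
  qed
qed

text \<open>Induction on the dimension, splitting off one eigenvector at a time. Invertibility of \<open>g\<close>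
  follows at the end from \<open>det P \<noteq> 0\<close>.\<close>

theorem sylvester_inertia:
  fixes P :: "complex mat"
  assumes "P \<in> carrier_mat n n" "mat_adjoint P = P" "det P \<noteq> 0"
  shows "\<exists>p q g. p + q = n \<and> g \<in> carrier (GL n) \<and> P = mat_adjoint g * I_pq p q * g"
proof -
  have "\<exists>p q g. p + q = n \<and> g \<in> carrier_mat n n \<and> P = mat_adjoint g * I_pq p q * g"
    using assms
  proof (induction n arbitrary: P)
    case 0
    have "P = mat_adjoint (1\<^sub>m 0) * I_pq 0 0 * 1\<^sub>m 0"
      using 0(1) by (intro eq_matI) (auto simp: mat_adjoint_eq)
    then show ?case by (intro exI[of _ 0] exI[of _ "1\<^sub>m 0"]) simp
  next
    case (Suc m)
    obtain W D and r :: real where W: "W \<in> carrier_mat (Suc m) (Suc m)" and dW: "det W \<noteq> 0"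
      and D: "D \<in> carrier_mat m m" "mat_adjoint D = D" "det D \<noteq> 0" and r: "r \<noteq> 0"
      and B: "mat_adjoint W * P * W = four_block_mat (of_real r \<cdot>\<^sub>m 1\<^sub>m 1) (0\<^sub>m 1 m) (0\<^sub>m m 1) D"
      by (rule hermitian_block[OF Suc.prems], rule that, assumption+)
    from Suc.IH[OF D] obtain p q h where m: "m = p + q" and h: "h \<in> carrier_mat m m"
      and Dh: "D = mat_adjoint h * I_pq p q * h" by blast
    from block_signature[OF h[unfolded m] Dh r] obtain p' q' k where pq: "p' + q' = Suc m"
      and k: "k \<in> carrier_mat (Suc m) (Suc m)" and Bk: "mat_adjoint W * P * W = mat_adjoint k * I_pq p' q' * k"
      unfolding B m by blast
    have WG: "W \<in> carrier (GL (Suc m))" using det_non_zero_imp_unit[OF W dW] by simp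
    let ?V = "inv\<^bsub>GL (Suc m)\<^esub> W"
    have V: "?V \<in> carrier_mat (Suc m) (Suc m)" by (rule GL_carrier_mat[OF inv_GL(3)[OF WG]])
    note Va = mat_adjoint_carrier[OF V] and Wa = mat_adjoint_carrier[OF W] and P = Suc.prems(1)
      and ka = mat_adjoint_carrier[OF k] and I = I_pq_carrier[of p' q', unfolded pq]
    have VW: "mat_adjoint ?V * mat_adjoint W = 1\<^sub>m (Suc m)"
      using mat_adjoint_mult[OF W V] inv_GL(1)[OF WG] mat_adjoint_one by simp
    have "P = mat_adjoint ?V * (mat_adjoint W * P * W) * ?V"
    proof -
      have "mat_adjoint ?V * (mat_adjoint W * P * W) * ?V
          = (mat_adjoint ?V * mat_adjoint W) * P * (W * ?V)"
        using V W Va Wa P by (simp add: assoc_mult_mat[of _ "Suc m" "Suc m" _ "Suc m" _ "Suc m"])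
      also have "\<dots> = P" unfolding VW inv_GL(1)[OF WG] using P by simp
      finally show ?thesis ..
    qed
    also have "\<dots> = mat_adjoint (k * ?V) * I_pq p' q' * (k * ?V)"
      unfolding Bk mat_adjoint_mult[OF k V]
      using V k Va ka I by (simp add: assoc_mult_mat[of _ "Suc m" "Suc m" _ "Suc m" _ "Suc m"])
    finally show ?case using pq mult_square[OF k V] by blast
  qed
  then obtain p q g where pq: "p + q = n" and g: "g \<in> carrier_mat n n"
    and P: "P = mat_adjoint g * I_pq p q * g" by blast
  note ga = mat_adjoint_carrier[OF g] and I = I_pq_carrier[of p q, unfolded pq]
  have "det P = det (mat_adjoint g * I_pq p q) * det g"
    unfolding P by (rule det_mult[OF mult_square[OF ga I] g])
  then have "det g \<noteq> 0" using assms(3) by auto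
  then have "g \<in> carrier (GL n)" using det_non_zero_imp_unit[OF g] by simp
  then show ?thesis using pq P by blast
qed

section \<open>Characters\<close>

lemma regular_trace:
  assumes "g \<in> carrier G"
  shows "(\<lambda>\<rho>. \<Sum>i<n. \<rho> g $$ (i, i)) \<in> regular_funs G n"
proof -
  have "k \<le> n \<Longrightarrow> (\<lambda>\<rho>. \<Sum>i<k. \<rho> g $$ (i, i)) \<in> regular_funs G n" for k
  proof (induction k)
    case 0
    show ?case using regular_funs.const[of 0] by simp
  next
    case (Suc k)
    from regular_funs.add[OF Suc.IH[OF Suc_leD[OF Suc.prems]]
        regular_funs.entry[OF assms Suc_le_lessD[OF Suc.prems] Suc_le_lessD[OF Suc.prems]]]
    show ?case by simp
  qed
  then show ?thesis by simp
qed

lemma trace_invariant: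
  assumes g: "g \<in> carrier G"
  shows "(\<lambda>\<rho>. \<Sum>i<n. \<rho> g $$ (i, i)) \<in> invariant_funs G n"
  unfolding invariant_funs_def
proof (intro CollectI conjI regular_trace[OF g] ballI)
  fix \<rho> A assume \<rho>: "\<rho> \<in> hom G (GL n)" and A: "A \<in> carrier (GL n)"
  note r = GL_carrier_mat[OF hom_in_carrier[OF \<rho> g]] and a = GL_carrier_mat[OF A]
    and b = GL_carrier_mat[OF inv_GL(3)[OF A]]
  let ?B = "inv\<^bsub>GL n\<^esub> A"
  have "conj_rep n A \<rho> g = A * \<rho> g * ?B" by (simp add: conj_rep_def)
  moreover have "trace (A * \<rho> g * ?B) = trace (?B * (A * \<rho> g))"
    by (rule trace_comm[OF mult_square[OF a r] b])
  moreover have "?B * (A * \<rho> g) = \<rho> g"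
    unfolding assoc_mult_mat[OF b a r, symmetric] inv_GL(2)[OF A] by (rule left_mult_one_mat[OF r])
  ultimately have "trace (conj_rep n A \<rho> g) = trace (\<rho> g)" by simp
  moreover have "conj_rep n A \<rho> g \<in> carrier_mat n n"
    using a b r by (simp add: conj_rep_def)
  ultimately show "(\<Sum>i<n. conj_rep n A \<rho> g $$ (i, i)) = (\<Sum>i<n. \<rho> g $$ (i, i))"
    using r by (simp add: trace_def)
qed

lemma chi_eq_imp_trace_eq:
  assumes "\<rho> \<in> hom G (GL n)" "\<rho>' \<in> hom G (GL n)" "chi G n \<rho> = chi G n \<rho>'" "g \<in> carrier G"
  shows "trace (\<rho> g) = trace (\<rho>' g)"
proof -
  have "(\<Sum>i<n. \<rho> g $$ (i, i)) = (\<Sum>i<n. \<rho>' g $$ (i, i))"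
    using bspec[OF assms(3)[unfolded chi_eq_iff] trace_invariant[OF assms(4)]] .
  moreover have "\<rho> g \<in> carrier_mat n n" "\<rho>' g \<in> carrier_mat n n"
    by (rule GL_carrier_mat[OF hom_in_carrier]; fact)+
  ultimately show ?thesis by (simp add: trace_def)
qed

text \<open>The representation \<open>rho2 n \<rho>\<close> sends \<open>g\<inverse>\<close> to \<open>\<rho>(g)\<^sup>*\<close>.\<close>

lemma trace_inv_if_Phi2_fixed:
  assumes "group G" "\<rho> \<in> hom G (GL n)" "Phi2 G n (chi G n \<rho>) = chi G n \<rho>" "g \<in> carrier G"
  shows "trace (\<rho> (inv\<^bsub>G\<^esub> g)) = cnj (trace (\<rho> g))"
proof -
  note inv = group.inv_closed[OF assms(1,4)]
  have "chi G n \<rho> = chi G n (rho2 n \<rho>)" using Phi2_chi[OF assms(1,2)] assms(3) by simp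
  from chi_eq_imp_trace_eq[OF assms(2) rho2_hom[OF assms(1,2)] this inv]
  have "trace (\<rho> (inv\<^bsub>G\<^esub> g)) = trace (mat_adjoint (\<rho> g))"
    using rho2_eq[OF assms(1,2) inv] group.inv_inv[OF assms(1,4)] by simp
  also have "\<dots> = cnj (trace (\<rho> g))"
    by (rule trace_adjoint[OF GL_carrier_mat[OF hom_in_carrier[OF assms(2,4)]]])
  finally show ?thesis .
qed

lemma conj_rep_in_U_pq:
  assumes g: "g \<in> carrier (GL n)" and pq: "p + q = n" and R: "R \<in> carrier (GL n)"
    and inv: "mat_adjoint R * (mat_adjoint g * I_pq p q * g) * R = mat_adjoint g * I_pq p q * g"
  shows "g * R * inv\<^bsub>GL n\<^esub> g \<in> U_pq p q"
proof -
  let ?h = "inv\<^bsub>GL n\<^esub> g" and ?I = "I_pq p q"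
  note h = inv_GL[OF g]
  note c = GL_carrier_mat[OF g] GL_carrier_mat[OF h(3)] GL_carrier_mat[OF R]
  note a = mat_adjoint_carrier[OF c(1)] mat_adjoint_carrier[OF c(2)] mat_adjoint_carrier[OF c(3)]
  have I: "?I \<in> carrier_mat n n" using I_pq_carrier[of p q] pq by simp
  note assoc = assoc_mult_mat[of _ n n _ n _ n]
  have hg: "mat_adjoint ?h * mat_adjoint g = 1\<^sub>m n"
    using mat_adjoint_mult[OF c(1,2)] h(1) mat_adjoint_one by simp
  have "mat_adjoint (g * R * ?h) * ?I * (g * R * ?h)
      = mat_adjoint ?h * (mat_adjoint R * (mat_adjoint g * ?I * g) * R) * ?h"
    unfolding mat_adjoint_mult[OF mult_square[OF c(1,3)] c(2)] mat_adjoint_mult[OF c(1,3)]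
    using a c I by (simp add: assoc)
  also have "\<dots> = mat_adjoint ?h * (mat_adjoint g * ?I * g) * ?h" unfolding inv ..
  also have "\<dots> = (mat_adjoint ?h * mat_adjoint g) * ?I * (g * ?h)"
    using a c I by (simp add: assoc)
  also have "\<dots> = ?I" unfolding hg h(1) using I by simp
  finally have "mat_adjoint (g * R * ?h) * ?I * (g * R * ?h) = ?I" .
  moreover have "g * R * ?h \<in> carrier (GL n)"
  proof -
    interpret GLn: group "GL n" by (rule group_GL)
    show ?thesis using GLn.m_closed[OF GLn.m_closed[OF g R] h(3)] by simp
  qed
  ultimately show ?thesis unfolding U_pq_def pq by simp
qed

theorem proposition6p7:
  fixes \<Gamma> :: "('a, 'b) monoid_scheme" and n :: nat and \<rho> :: "'a \<Rightarrow> complex mat"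
  assumes "finitely_generated_group \<Gamma>"
    and "0 < n"
    and "\<rho> \<in> hom \<Gamma> (GL n)"
    and "semisimple_rep \<Gamma> n \<rho>"
    and "Phi2 \<Gamma> n (chi \<Gamma> n \<rho>) = chi \<Gamma> n \<rho>"
  shows "\<exists>p q :: nat. p + q = n \<and>
    (\<exists>\<rho>'\<in>hom \<Gamma> (GL n). conjugate_reps \<Gamma> n \<rho> \<rho>' \<and> \<rho>' ` carrier \<Gamma> \<subseteq> U_pq p q)"
proof -
  have grp: "group \<Gamma>" using assms(1) by (simp add: finitely_generated_group_def)
  interpret matrix_rep \<Gamma> n \<rho>
    by (intro matrix_rep.intro matrix_rep_axioms.intro grp assms(3))
  obtain P where P: "invariant_form P" "mat_adjoint P = P" "det P \<noteq> 0"
    by (rule exists_nondegenerate_hermitian_form[OF semisimple_rep_imp_semisimple[OF grp assms(4)]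
          trace_inv_if_Phi2_fixed[OF grp assms(3,5)]], assumption, rule that)
  from P(1) have Pc: "P \<in> carrier_mat n n" by (simp add: invariant_form_def)
  obtain p q g where pq: "p + q = n" and g: "g \<in> carrier (GL n)"
    and Pg: "P = mat_adjoint g * I_pq p q * g"
    using sylvester_inertia[OF Pc P(2,3)] by blast
  have "conj_rep n g \<rho> \<gamma> \<in> U_pq p q" if "\<gamma> \<in> carrier \<Gamma>" for \<gamma>
  proof -
    have "mat_adjoint (\<rho> \<gamma>) * P * \<rho> \<gamma> = P" using P(1) that by (simp add: invariant_form_def)
    from conj_rep_in_U_pq[OF g pq rep_GL[OF that] this[unfolded Pg]] show ?thesis
      by (simp add: conj_rep_def)
  qed
  moreover have "conjugate_reps \<Gamma> n \<rho> (conj_rep n g \<rho>)"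
    unfolding conjugate_reps_def using g by blast
  ultimately show ?thesis using conj_rep_hom[OF assms(3) g] pq by blast
qed

end
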